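(* Let $X_1,\dots,X_n$ be smooth real vector fields on a connected open set $\Omega\subseteq\mathbb{R}^N$, whose commutators of length $\le r$ span the tangent space at every point of $\Omega$. For each $x\in\Omega$, let $$Q(x):=\sum_{j=1}^r j\,n_j(x),\qquad n_j(x):=\dim V_j(x)-\dim V_{j-1}(x),$$ where $V_j(x)$ is the span of the commutators of $X_1,\dots,X_n$ of length $\le j$ at $x$ (and $V_0(x)=\{0\}$). Let $\Omega'$ be a nonempty relatively compact open subset of $\Omega$ with smooth boundary, and set $Q:=\sup_{x\in\overline{\Omega'}}Q(x)$. Let $1\le p<Q$ and $\frac1{p^*}=\frac1p-\frac1Q$. Then the exponent $p^*$ is the best possible in the Sobolev inequality on $\Omega'$: for every real number $q>p^*$ there is no constant $C$ such that $$\|f\|_{L^{q}(\Omega')}\le C\left(\|\nabla_bf\|_{L^p(\Omega')}+\|f\|_{L^p(\Omega')}\right)\quad\text{for all } f\in C^\infty(\overline{\Omega'}).$$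
   Context: Commutators: $X_1,\dots,X_n$ are the commutators of length $1$, and a commutator of length $j$ is a successive (iterated) Lie bracket involving $j$ of the fields $X_1,\dots,X_n$. The length of the subelliptic gradient is given by $|\nabla_bf|^2:=|X_1f|^2+\dots+|X_nf|^2$. Functions may be complex-valued; $L^p(\Omega')$ is taken with respect to Lebesgue measure. $Q(x)$ is called the non-isotropic dimension at $x$, and $Q$ the non-isotropic dimension of $\overline{\Omega'}$. *)

theory Defs
  imports "HOL-Analysis.Analysis"
begin

text \<open>\<open>Ck_on k S f\<close>: all iterated directional derivatives of f of order at most k exist and
  are continuous on S (used for open S only).\<close>

primrec Ck_on :: "nat \<Rightarrow> 'a::real_normed_vector set \<Rightarrow> ('a \<Rightarrow> 'b::real_normed_vector) \<Rightarrow> bool" where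
  "Ck_on 0 S f \<longleftrightarrow> continuous_on S f"
| "Ck_on (Suc k) S f \<longleftrightarrow>
     (\<forall>x\<in>S. f differentiable (at x)) \<and> (\<forall>v. Ck_on k S (\<lambda>x. frechet_derivative f (at x) v))"

definition smooth_on :: "'a::real_normed_vector set \<Rightarrow> ('a \<Rightarrow> 'b::real_normed_vector) \<Rightarrow> bool" where
  "smooth_on S f \<longleftrightarrow> (\<forall>k. Ck_on k S f)"

text \<open>\<open>C\<^sup>\<infinity>\<close> of the closure of S: restrictions of smooth functions on open neighbourhoods.\<close>

definition smooth_up_to_boundary ::
    "'a::real_normed_vector set \<Rightarrow> ('a \<Rightarrow> 'b::real_normed_vector) \<Rightarrow> bool" where
  "smooth_up_to_boundary S f \<longleftrightarrow> (\<exists>U. open U \<and> closure S \<subseteq> U \<and> smooth_on U f)"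

text \<open>Near each boundary point, S is a strict sublevel set of a smooth function
  whose differential does not vanish there; so S lies locally on one side of its boundary.\<close>

definition smooth_boundary :: "'a::real_normed_vector set \<Rightarrow> bool" where
  "smooth_boundary S \<longleftrightarrow>
     (\<forall>x\<in>frontier S. \<exists>U (\<rho> :: 'a \<Rightarrow> real).
        open U \<and> x \<in> U \<and> smooth_on U \<rho> \<and> \<rho> x = 0 \<and>
        frechet_derivative \<rho> (at x) \<noteq> (\<lambda>_. 0) \<and>
        S \<inter> U = {y\<in>U. \<rho> y < 0})"

text \<open>A vector field \<open>Y\<close> on an open subset of a vector space is a vector-valued function;
  it acts on functions by \<open>(Y f)(x) = Df(x) (Y x)\<close>.\<close>

definition vf_apply ::
    "('a::real_normed_vector \<Rightarrow> 'a) \<Rightarrow> ('a \<Rightarrow> 'b::real_normed_vector) \<Rightarrow> 'a \<Rightarrow> 'b" where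
  "vf_apply Y f x = frechet_derivative f (at x) (Y x)"

text \<open>The components of \<open>[Y, Z] = YZ - ZY\<close> are Y applied to the components of Z minus
  Z applied to the components of Y.\<close>

definition lie_bracket ::
    "('a::real_normed_vector \<Rightarrow> 'a) \<Rightarrow> ('a \<Rightarrow> 'a) \<Rightarrow> 'a \<Rightarrow> 'a" where
  "lie_bracket Y Z x = vf_apply Y Z x - vf_apply Z Y x"

inductive commutator ::
    "nat \<Rightarrow> (nat \<Rightarrow> 'a::real_normed_vector \<Rightarrow> 'a) \<Rightarrow> nat \<Rightarrow> ('a \<Rightarrow> 'a) \<Rightarrow> bool"
  for n :: nat and X :: "nat \<Rightarrow> 'a \<Rightarrow> 'a"
where
  field: "i \<in> {1..n} \<Longrightarrow> commutator n X 1 (X i)"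
| bracket: "i \<in> {1..n} \<Longrightarrow> commutator n X j Y \<Longrightarrow> commutator n X (Suc j) (lie_bracket (X i) Y)"

definition commutator_span ::
    "nat \<Rightarrow> (nat \<Rightarrow> 'a::real_normed_vector \<Rightarrow> 'a) \<Rightarrow> nat \<Rightarrow> 'a \<Rightarrow> 'a set" where
  "commutator_span n X j x = span {Y x | Y k. k \<le> j \<and> commutator n X k Y}"

definition nonisotropic_dim_at ::
    "nat \<Rightarrow> (nat \<Rightarrow> 'a::euclidean_space \<Rightarrow> 'a) \<Rightarrow> nat \<Rightarrow> 'a \<Rightarrow> real" where
  "nonisotropic_dim_at n X r x =
     (\<Sum>j=1..r. real j *
        (real (dim (commutator_span n X j x)) - real (dim (commutator_span n X (j - 1) x))))"

definition nonisotropic_dim ::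
    "nat \<Rightarrow> (nat \<Rightarrow> 'a::euclidean_space \<Rightarrow> 'a) \<Rightarrow> nat \<Rightarrow> 'a set \<Rightarrow> real" where
  "nonisotropic_dim n X r S = (SUP x\<in>S. nonisotropic_dim_at n X r x)"

definition subelliptic_gradient_length ::
    "nat \<Rightarrow> (nat \<Rightarrow> 'a::real_normed_vector \<Rightarrow> 'a) \<Rightarrow> ('a \<Rightarrow> complex) \<Rightarrow> 'a \<Rightarrow> real" where
  "subelliptic_gradient_length n X f x = sqrt (\<Sum>i=1..n. (cmod (vf_apply (X i) f x))\<^sup>2)"

text \<open>The Bochner integral is 0 for non-integrable integrands, so \<open>Lp_norm\<close> is the usual norm only
  for functions in \<open>L\<^sup>p\<close>, for instance bounded measurable functions on bounded open sets.\<close>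

definition Lp_norm ::
    "real \<Rightarrow> 'a::euclidean_space set \<Rightarrow> ('a \<Rightarrow> 'b::real_normed_vector) \<Rightarrow> real" where
  "Lp_norm p S f = (LINT x:S|lebesgue. norm (f x) powr p) powr (1 / p)"

end

theory Submission
  imports Defs "HOL-Library.Multiset"
begin

text \<open>Why the exponent is sharp. Functions concentrated at scale \<open>\<delta>\<close> around a point \<open>x0\<close> with large
  non-isotropic dimension \<open>Q(x0)\<close> live on a set of volume at most \<open>\<delta>\<close> to the power \<open>Q(x0)\<close>, up to an
  arbitrarily small loss in the exponent, while one derivative along an \<open>X i\<close> costs only a factor
  \<open>1 / \<delta>\<close>. Since \<open>p * q / (q - p) < Q\<close> means \<open>q > p\<^sup>*\<close>, a point \<open>x0\<close> of the closure with
  \<open>Q(x0) > p * q / (q - p)\<close> is available, and it may lie on the boundary.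

  The concentrated functions come from privileged coordinates. At \<open>x0\<close> choose a frame adapted to the
  filtration by commutator length (\<open>adapted_frame_exists\<close>). Up to shorter words of the same weight the
  letters of an iterated derivative commute, so the ordered frame words determine all iterated
  derivatives at \<open>x0\<close> (\<open>words_vanish\<close>). There are smooth functions dual to these words
  (\<open>interpolation\<close>), and \<open>X i\<close> lowers their weights by at most one (\<open>vf_apply_dual_bound\<close>). The gauge
  at scale \<open>\<delta>\<close> is essentially the sum of squares of the rescaled dual functions, and it satisfies
  \<open>\<bar>X i gauge\<bar> \<le> C / \<delta> * gauge\<close> (\<open>gauge_gradient\<close>). Only polynomials in linear coordinates and
  values at \<open>x0\<close> enter; no flows are integrated. The dual functions of single letters form a
  coordinate system whose boxes have volume at most \<open>C \<tau> ^ Q(x0)\<close> (\<open>anisotropic_box_volume\<close>).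

  Negative powers of the gauge are the test functions. The Sobolev inequality is iterated in the
  manner of Moser, which avoids comparing the volumes that different gauge balls have inside the
  domain: it bounds the integral of a lower power of the gauge from below by that of a higher one
  (\<open>sobolev_gauge_integral\<close>). The iteration turns any polynomial lower bound
  (\<open>gauge_integral_lower\<close>, where the smoothness of the boundary enters) into one with exponent as close to \<open>p * q / (q - p)\<close> as desired (\<open>moser_lower_bound\<close>). As that is less than
  \<open>Q(x0)\<close>, it contradicts the upper bound \<open>gauge_integral_upper\<close>.\<close>

section \<open>Calculus of smooth functions\<close>

lemma frechet_has_derivative:
  "f differentiable (at x) \<Longrightarrow> (f has_derivative frechet_derivative f (at x)) (at x)"
  by (simp add: frechet_derivative_works)

lemma frechet_derivative_eqI:
  "(f has_derivative f') (at x) \<Longrightarrow> frechet_derivative f (at x) = f'"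
  using frechet_derivative_at by blast

lemma frechet_derivative_cong_open:
  assumes "open S" "\<forall>x\<in>S. f x = g x" "x \<in> S"
  shows "frechet_derivative f (at x) = frechet_derivative g (at x)"
proof -
  have "(f has_derivative D) (at x) \<longleftrightarrow> (g has_derivative D) (at x)" for D
    using assms by (metis has_derivative_transform_within_open)
  thus ?thesis unfolding frechet_derivative_def by simp
qed

lemma Ck_on_cong:
  assumes "open S" "\<forall>x\<in>S. f x = g x" "Ck_on k S f"
  shows "Ck_on k S g"
  using assms(2,3)
proof (induction k arbitrary: f g)
  case 0
  then show ?case using continuous_on_cong by (metis Ck_on.simps(1))
next
  case (Suc k)
  have "g differentiable (at x)" if "x \<in> S" for x
    using Suc.prems that assms(1)
    by (metis Ck_on.simps(2) differentiable_def has_derivative_transform_within_open)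
  moreover have "Ck_on k S (\<lambda>x. frechet_derivative g (at x) v)" for v
  proof (rule Suc.IH)
    show "Ck_on k S (\<lambda>x. frechet_derivative f (at x) v)"
      using Suc.prems by simp
    show "\<forall>x\<in>S. frechet_derivative f (at x) v = frechet_derivative g (at x) v"
      using frechet_derivative_cong_open[OF assms(1) Suc.prems(1)] by simp
  qed
  ultimately show ?case by simp
qed

lemma Ck_on_Suc_D: "Ck_on (Suc k) S f \<Longrightarrow> Ck_on k S f"
proof (induction k arbitrary: f)
  case 0
  then show ?case
    by (simp add: continuous_at_imp_continuous_on differentiable_imp_continuous_within)
next
  case (Suc k)
  then show ?case by (metis Ck_on.simps(2))
qed

lemma Ck_on_const: "Ck_on k S (\<lambda>x. c)"
  by (induction k arbitrary: c) auto

lemma Ck_on_bounded_linear: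
  assumes "open S" "bounded_linear L" "Ck_on k S f"
  shows "Ck_on k S (\<lambda>x. L (f x))"
  using assms(3)
proof (induction k arbitrary: f)
  case 0
  then show ?case using bounded_linear.continuous_on[OF assms(2)] by simp
next
  case (Suc k)
  have D: "((\<lambda>x. L (f x)) has_derivative (\<lambda>v. L (frechet_derivative f (at x) v))) (at x)"
    if "x \<in> S" for x
    by (rule bounded_linear.has_derivative[OF assms(2) frechet_has_derivative])
       (use Suc.prems that in simp)
  have "Ck_on k S (\<lambda>x. frechet_derivative (\<lambda>x. L (f x)) (at x) v)" for v
  proof (rule Ck_on_cong[OF assms(1)])
    show "Ck_on k S (\<lambda>x. L (frechet_derivative f (at x) v))"
      using Suc by simp
  qed (use frechet_derivative_eqI[OF D] in auto)
  moreover have "(\<lambda>x. L (f x)) differentiable (at x)" if "x \<in> S" for x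
    using D[OF that] differentiableI by blast
  ultimately show ?case by simp
qed

lemma Ck_on_add:
  assumes "open S" "Ck_on k S f" "Ck_on k S g"
  shows "Ck_on k S (\<lambda>x. f x + g x)"
  using assms(2,3)
proof (induction k arbitrary: f g)
  case 0
  then show ?case by (simp add: continuous_on_add)
next
  case (Suc k)
  have D: "((\<lambda>x. f x + g x) has_derivative
      (\<lambda>v. frechet_derivative f (at x) v + frechet_derivative g (at x) v)) (at x)"
    if "x \<in> S" for x
    by (intro has_derivative_add frechet_has_derivative) (use Suc.prems that in simp_all)
  have "Ck_on k S (\<lambda>x. frechet_derivative (\<lambda>x. f x + g x) (at x) v)" for v
  proof (rule Ck_on_cong[OF assms(1)])
    show "Ck_on k S (\<lambda>x. frechet_derivative f (at x) v + frechet_derivative g (at x) v)"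
      using Suc by simp
  qed (use frechet_derivative_eqI[OF D] in auto)
  moreover have "(\<lambda>x. f x + g x) differentiable (at x)" if "x \<in> S" for x
    using D[OF that] differentiableI by blast
  ultimately show ?case by simp
qed

lemma Ck_on_bilinear:
  assumes "open S" "bounded_bilinear b" "Ck_on k S f" "Ck_on k S g"
  shows "Ck_on k S (\<lambda>x. b (f x) (g x))"
  using assms(3,4)
proof (induction k arbitrary: f g)
  case 0
  then show ?case using bounded_bilinear.continuous_on[OF assms(2)] by simp
next
  case (Suc k)
  have D: "((\<lambda>x. b (f x) (g x)) has_derivative
      (\<lambda>v. b (f x) (frechet_derivative g (at x) v) + b (frechet_derivative f (at x) v) (g x))) (at x)"
    if "x \<in> S" for x
    by (intro bounded_bilinear.FDERIV[OF assms(2)] frechet_has_derivative)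
       (use Suc.prems that in simp_all)
  have "Ck_on k S (\<lambda>x. frechet_derivative (\<lambda>x. b (f x) (g x)) (at x) v)" for v
  proof (rule Ck_on_cong[OF assms(1)])
    show "Ck_on k S (\<lambda>x. b (f x) (frechet_derivative g (at x) v)
        + b (frechet_derivative f (at x) v) (g x))"
      using Suc.prems Ck_on_Suc_D[OF Suc.prems(1)] Ck_on_Suc_D[OF Suc.prems(2)]
      by (auto intro!: Ck_on_add[OF assms(1)] Suc.IH)
  qed (use frechet_derivative_eqI[OF D] in auto)
  moreover have "(\<lambda>x. b (f x) (g x)) differentiable (at x)" if "x \<in> S" for x
    using D[OF that] differentiableI by blast
  ultimately show ?case by simp
qed

lemma Ck_on_powr:
  fixes f :: "'a::real_normed_vector \<Rightarrow> real"
  assumes "open S" "\<forall>x\<in>S. 0 < f x" "Ck_on k S f"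
  shows "Ck_on k S (\<lambda>x. f x powr a)"
  using assms(3)
proof (induction k arbitrary: a)
  case 0
  then show ?case using assms(2) by (auto intro!: continuous_on_powr)
next
  case (Suc k)
  have D: "((\<lambda>x. f x powr a) has_derivative
      (\<lambda>v. (a * f x powr (a - 1)) * frechet_derivative f (at x) v)) (at x)"
    if "x \<in> S" for x
  proof -
    have p: "f x > 0" using assms(2) that by auto
    have "(f has_derivative frechet_derivative f (at x)) (at x)"
      using Suc.prems that frechet_has_derivative by auto
    moreover have "((\<lambda>z. z powr a) has_derivative (\<lambda>h. (a * f x powr (a - 1)) * h)) (at (f x))"
      using has_real_derivative_powr[OF p, of a] by (simp add: has_field_derivative_def)
    ultimately show ?thesis
      using diff_chain_at[of f "frechet_derivative f (at x)" x "\<lambda>z. z powr a"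
          "\<lambda>h. (a * f x powr (a - 1)) * h"]
      by (simp add: o_def)
  qed
  have "Ck_on k S (\<lambda>x. frechet_derivative (\<lambda>x. f x powr a) (at x) v)" for v
  proof (rule Ck_on_cong[OF assms(1)])
    have "Ck_on k S (\<lambda>x. a * f x powr (a - 1))"
      by (intro Ck_on_bilinear[OF assms(1) bounded_bilinear_mult] Ck_on_const
          Suc.IH Ck_on_Suc_D[OF Suc.prems])
    moreover have "Ck_on k S (\<lambda>x. frechet_derivative f (at x) v)"
      using Suc.prems by simp
    ultimately show "Ck_on k S (\<lambda>x. (a * f x powr (a - 1)) * frechet_derivative f (at x) v)"
      by (rule Ck_on_bilinear[OF assms(1) bounded_bilinear_mult])
  qed (use frechet_derivative_eqI[OF D] in auto)
  moreover have "(\<lambda>x. f x powr a) differentiable (at x)" if "x \<in> S" for x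
    using D[OF that] differentiableI by blast
  ultimately show ?case by simp
qed

lemma smooth_on_cong:
  "open S \<Longrightarrow> \<forall>x\<in>S. f x = g x \<Longrightarrow> smooth_on S f \<Longrightarrow> smooth_on S g"
  unfolding smooth_on_def using Ck_on_cong by blast

lemma smooth_on_const: "smooth_on S (\<lambda>x. c)"
  unfolding smooth_on_def using Ck_on_const by blast

lemma smooth_on_bounded_linear:
  "open S \<Longrightarrow> bounded_linear L \<Longrightarrow> smooth_on S f \<Longrightarrow> smooth_on S (\<lambda>x. L (f x))"
  unfolding smooth_on_def using Ck_on_bounded_linear by blast

lemma smooth_on_add:
  "open S \<Longrightarrow> smooth_on S f \<Longrightarrow> smooth_on S g \<Longrightarrow> smooth_on S (\<lambda>x. f x + g x)"
  unfolding smooth_on_def using Ck_on_add by blast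

lemma smooth_on_bilinear:
  "open S \<Longrightarrow> bounded_bilinear b \<Longrightarrow> smooth_on S f \<Longrightarrow> smooth_on S g
    \<Longrightarrow> smooth_on S (\<lambda>x. b (f x) (g x))"
  unfolding smooth_on_def using Ck_on_bilinear by blast

lemmas smooth_on_mult = smooth_on_bilinear[OF _ bounded_bilinear_mult]
lemmas smooth_on_scaleR = smooth_on_bilinear[OF _ bounded_bilinear_scaleR]

lemma smooth_on_diff:
  "open S \<Longrightarrow> smooth_on S f \<Longrightarrow> smooth_on S g \<Longrightarrow> smooth_on S (\<lambda>x. f x - g x)"
  using smooth_on_add[of S f "\<lambda>x. - g x"]
    smooth_on_bounded_linear[of S uminus g] by (simp add: bounded_linear_minus bounded_linear_ident)

lemma smooth_on_sum:
  assumes "open S" "\<And>i. i \<in> A \<Longrightarrow> smooth_on S (f i)"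
  shows "smooth_on S (\<lambda>x. \<Sum>i\<in>A. f i x)"
  using assms(2)
  by (induction A rule: infinite_finite_induct)
     (auto intro: smooth_on_const smooth_on_add[OF assms(1)])

lemma smooth_on_power:
  fixes f :: "'a::real_normed_vector \<Rightarrow> real"
  shows "open S \<Longrightarrow> smooth_on S f \<Longrightarrow> smooth_on S (\<lambda>x. f x ^ k)"
  by (induction k) (auto intro: smooth_on_const smooth_on_mult)

lemma smooth_on_powr:
  fixes f :: "'a::real_normed_vector \<Rightarrow> real"
  shows "open S \<Longrightarrow> \<forall>x\<in>S. 0 < f x \<Longrightarrow> smooth_on S f \<Longrightarrow> smooth_on S (\<lambda>x. f x powr a)"
  unfolding smooth_on_def using Ck_on_powr by blast

lemma smooth_on_linear:
  assumes "open S" "bounded_linear L"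
  shows "smooth_on S L"
proof -
  have "Ck_on k S (\<lambda>x. x)" for k :: nat
    by (cases k) (auto simp: Ck_on_const)
  hence "smooth_on S (\<lambda>x. x)" by (simp add: smooth_on_def)
  from smooth_on_bounded_linear[OF assms this] show ?thesis .
qed

lemma smooth_on_D:
  assumes "smooth_on S f"
  shows smooth_on_differentiable: "x \<in> S \<Longrightarrow> f differentiable (at x)"
    and smooth_on_continuous: "continuous_on S f"
    and smooth_on_frechet_derivative: "smooth_on S (\<lambda>x. frechet_derivative f (at x) v)"
proof -
  show "x \<in> S \<Longrightarrow> f differentiable (at x)"
    using assms unfolding smooth_on_def by (metis Ck_on.simps(2))
  show "continuous_on S f"
    using assms unfolding smooth_on_def by (metis Ck_on.simps(1))
  show "smooth_on S (\<lambda>x. frechet_derivative f (at x) v)"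
    using assms unfolding smooth_on_def by (metis Ck_on.simps(2))
qed

lemma smooth_on_has_derivative:
  "smooth_on S f \<Longrightarrow> x \<in> S \<Longrightarrow> (f has_derivative frechet_derivative f (at x)) (at x)"
  using smooth_on_differentiable frechet_has_derivative by blast

section \<open>Vector fields as derivations\<close>

lemma vf_apply_eqI:
  "(f has_derivative f') (at x) \<Longrightarrow> vf_apply Z f x = f' (Z x)"
  unfolding vf_apply_def using frechet_derivative_eqI by metis

lemma vf_apply_cong:
  assumes "open S" "\<forall>x\<in>S. f x = g x" "x \<in> S" "Y x = Z x"
  shows "vf_apply Y f x = vf_apply Z g x"
  unfolding vf_apply_def using frechet_derivative_cong_open[OF assms(1,2,3)] assms(4) by simp

lemma vf_apply_add:
  assumes "smooth_on S f" "smooth_on S g" "x \<in> S"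
  shows "vf_apply Z (\<lambda>x. f x + g x) x = vf_apply Z f x + vf_apply Z g x"
  unfolding vf_apply_def[of Z f] vf_apply_def[of Z g]
  by (rule vf_apply_eqI) (intro has_derivative_add smooth_on_has_derivative[OF _ assms(3)] assms)

lemma vf_apply_diff:
  assumes "smooth_on S f" "smooth_on S g" "x \<in> S"
  shows "vf_apply Z (\<lambda>x. f x - g x) x = vf_apply Z f x - vf_apply Z g x"
  unfolding vf_apply_def[of Z f] vf_apply_def[of Z g]
  by (rule vf_apply_eqI) (intro has_derivative_diff smooth_on_has_derivative[OF _ assms(3)] assms)

lemma vf_apply_mult:
  fixes f g :: "'a::real_normed_vector \<Rightarrow> real"
  assumes "smooth_on S f" "smooth_on S g" "x \<in> S"
  shows "vf_apply Z (\<lambda>x. f x * g x) x = f x * vf_apply Z g x + vf_apply Z f x * g x"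
  unfolding vf_apply_def[of Z f] vf_apply_def[of Z g]
  by (rule vf_apply_eqI) (intro has_derivative_mult smooth_on_has_derivative[OF _ assms(3)] assms)

lemma vf_apply_bounded_linear:
  assumes "bounded_linear L" "smooth_on S f" "x \<in> S"
  shows "vf_apply Z (\<lambda>x. L (f x)) x = L (vf_apply Z f x)"
  unfolding vf_apply_def[of Z f]
  by (rule vf_apply_eqI)
     (intro bounded_linear.has_derivative[OF assms(1)] smooth_on_has_derivative[OF _ assms(3)] assms)

lemma vf_apply_linear:
  assumes "bounded_linear L"
  shows "vf_apply Z L x = L (Z x)"
  by (rule vf_apply_eqI) (simp add: assms bounded_linear_imp_has_derivative)

lemma vf_apply_const [simp]: "vf_apply Z (\<lambda>x. c) x = 0"
  by (simp add: vf_apply_def)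

lemma vf_apply_sum:
  assumes "open S" "\<And>i. i \<in> A \<Longrightarrow> smooth_on S (f i)" "x \<in> S"
  shows "vf_apply Z (\<lambda>x. \<Sum>i\<in>A. f i x) x = (\<Sum>i\<in>A. vf_apply Z (f i) x)"
  using assms(2)
proof (induction A rule: infinite_finite_induct)
  case (insert a A)
  then show ?case
    using vf_apply_add[of S "f a" "\<lambda>x. \<Sum>i\<in>A. f i x" x Z] assms(3)
      smooth_on_sum[OF assms(1), of A f] by simp
qed auto

lemma vf_apply_cmult:
  fixes f :: "'a::real_normed_vector \<Rightarrow> real"
  assumes "smooth_on S f" "x \<in> S"
  shows "vf_apply Z (\<lambda>x. c * f x) x = c * vf_apply Z f x"
  using vf_apply_bounded_linear[OF bounded_linear_mult_right[of c] assms] by simp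

lemma vf_apply_vadd:
  assumes "smooth_on S f" "x \<in> S"
  shows "vf_apply (\<lambda>x. Y x + Z x) f x = vf_apply Y f x + vf_apply Z f x"
  unfolding vf_apply_def
  using linear_add[OF linear_frechet_derivative[OF smooth_on_differentiable[OF assms]]] by simp

lemma vf_apply_vdiff:
  assumes "smooth_on S f" "x \<in> S"
  shows "vf_apply (\<lambda>x. Y x - Z x) f x = vf_apply Y f x - vf_apply Z f x"
  unfolding vf_apply_def
  using linear_diff[OF linear_frechet_derivative[OF smooth_on_differentiable[OF assms]]] by simp

lemma vf_apply_vscale:
  assumes "smooth_on S f" "x \<in> S"
  shows "vf_apply (\<lambda>x. c *\<^sub>R Z x) f x = c *\<^sub>R vf_apply Z f x"
  unfolding vf_apply_def
  using linear_scale[OF linear_frechet_derivative[OF smooth_on_differentiable[OF assms]]] by simp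

lemma vf_apply_coords:
  fixes f :: "'a::euclidean_space \<Rightarrow> 'b::real_normed_vector"
  assumes "smooth_on S f" "x \<in> S"
  shows "vf_apply Z f x = (\<Sum>b\<in>Basis. (Z x \<bullet> b) *\<^sub>R frechet_derivative f (at x) b)"
proof -
  have l: "linear (frechet_derivative f (at x))"
    by (rule linear_frechet_derivative[OF smooth_on_differentiable[OF assms]])
  have "frechet_derivative f (at x) (Z x)
      = frechet_derivative f (at x) (\<Sum>b\<in>Basis. (Z x \<bullet> b) *\<^sub>R b)"
    by (simp add: euclidean_representation)
  also have "\<dots> = (\<Sum>b\<in>Basis. (Z x \<bullet> b) *\<^sub>R frechet_derivative f (at x) b)"
    by (simp add: linear_sum[OF l] linear_scale[OF l])
  finally show ?thesis by (simp add: vf_apply_def)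
qed

lemma smooth_on_vf_apply:
  fixes f :: "'a::euclidean_space \<Rightarrow> 'b::real_normed_vector"
  assumes "open S" "smooth_on S f" "smooth_on S Z"
  shows "smooth_on S (vf_apply Z f)"
proof (rule smooth_on_cong[OF assms(1)])
  show "\<forall>x\<in>S. (\<Sum>b\<in>Basis. (Z x \<bullet> b) *\<^sub>R frechet_derivative f (at x) b) = vf_apply Z f x"
    using vf_apply_coords[OF assms(2)] by simp
  show "smooth_on S (\<lambda>x. \<Sum>b\<in>Basis. (Z x \<bullet> b) *\<^sub>R frechet_derivative f (at x) b)"
    by (intro smooth_on_sum smooth_on_scaleR assms(1) smooth_on_frechet_derivative[OF assms(2)]
        smooth_on_bounded_linear[OF _ bounded_linear_inner_left] assms(3))
qed

lemma smooth_on_lie_bracket: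
  fixes Y Z :: "'a::euclidean_space \<Rightarrow> 'a"
  assumes "open S" "smooth_on S Y" "smooth_on S Z"
  shows "smooth_on S (lie_bracket Y Z)"
  unfolding lie_bracket_def[abs_def]
  by (intro smooth_on_diff smooth_on_vf_apply assms)

lemma second_difference_mvt:
  fixes f :: "'a::real_normed_vector \<Rightarrow> real"
  assumes "open S" "smooth_on S f" "t > 0"
    and seg: "\<And>a b. a \<in> {0..t} \<Longrightarrow> b \<in> {0..t} \<Longrightarrow> x + a *\<^sub>R u + b *\<^sub>R v \<in> S"
  shows "\<exists>a\<in>{0..t}. \<exists>b\<in>{0..t}.
    f (x + t *\<^sub>R u + t *\<^sub>R v) - f (x + t *\<^sub>R u) - f (x + t *\<^sub>R v) + f x
     = t * t * frechet_derivative (\<lambda>y. frechet_derivative f (at y) u)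
          (at (x + a *\<^sub>R u + b *\<^sub>R v)) v"
proof -
  have lin: "linear (frechet_derivative f (at y))" if "y \<in> S" for y
    by (rule linear_frechet_derivative[OF smooth_on_differentiable[OF assms(2) that]])
  define Du where "Du = (\<lambda>y. frechet_derivative f (at y) u)"
  have sDu: "smooth_on S Du"
    unfolding Du_def by (rule smooth_on_frechet_derivative[OF assms(2)])
  have lin2: "linear (frechet_derivative Du (at y))" if "y \<in> S" for y
    by (rule linear_frechet_derivative[OF smooth_on_differentiable[OF sDu that]])
  define g where "g = (\<lambda>s. f (x + s *\<^sub>R u + t *\<^sub>R v) - f (x + s *\<^sub>R u))"
  have dg: "(g has_derivative (\<lambda>h. h * (Du (x + s *\<^sub>R u + t *\<^sub>R v) - Du (x + s *\<^sub>R u)))) (at s within {0..t})"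
    if s: "0 \<le> s" "s \<le> t" for s
  proof -
    have i1: "x + s *\<^sub>R u + t *\<^sub>R v \<in> S" and i2: "x + s *\<^sub>R u \<in> S"
      using seg[of s t] seg[of s 0] s \<open>t > 0\<close> by auto
    have "((\<lambda>s. f (x + s *\<^sub>R u + t *\<^sub>R v)) has_derivative
        (\<lambda>h. frechet_derivative f (at (x + s *\<^sub>R u + t *\<^sub>R v)) (h *\<^sub>R u))) (at s within {0..t})"
      by (rule has_derivative_compose[where f="\<lambda>s. x + s *\<^sub>R u + t *\<^sub>R v" and g=f,
            OF _ smooth_on_has_derivative[OF assms(2) i1]])
         (auto intro!: derivative_eq_intros)
    moreover have "((\<lambda>s. f (x + s *\<^sub>R u)) has_derivative
        (\<lambda>h. frechet_derivative f (at (x + s *\<^sub>R u)) (h *\<^sub>R u))) (at s within {0..t})"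
      by (rule has_derivative_compose[where f="\<lambda>s. x + s *\<^sub>R u" and g=f,
            OF _ smooth_on_has_derivative[OF assms(2) i2]])
         (auto intro!: derivative_eq_intros)
    ultimately have "(g has_derivative (\<lambda>h. frechet_derivative f (at (x + s *\<^sub>R u + t *\<^sub>R v)) (h *\<^sub>R u)
        - frechet_derivative f (at (x + s *\<^sub>R u)) (h *\<^sub>R u))) (at s within {0..t})"
      unfolding g_def by (rule has_derivative_diff)
    thus ?thesis
      by (simp add: linear_scale[OF lin[OF i1]] linear_scale[OF lin[OF i2]] Du_def right_diff_distrib)
  qed
  obtain a where a: "a \<in> {0..t}"
    and ga: "g t - g 0 = (t - 0) * (Du (x + a *\<^sub>R u + t *\<^sub>R v) - Du (x + a *\<^sub>R u))"
    using mvt_very_simple[of 0 t g, OF _ dg] \<open>t > 0\<close> by auto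
  define k where "k = (\<lambda>s. Du (x + a *\<^sub>R u + s *\<^sub>R v))"
  have dk: "(k has_derivative (\<lambda>h. h * frechet_derivative Du (at (x + a *\<^sub>R u + s *\<^sub>R v)) v)) (at s within {0..t})"
    if s: "0 \<le> s" "s \<le> t" for s
  proof -
    have i1: "x + a *\<^sub>R u + s *\<^sub>R v \<in> S"
      using seg[of a s] s a by auto
    have "(k has_derivative
        (\<lambda>h. frechet_derivative Du (at (x + a *\<^sub>R u + s *\<^sub>R v)) (h *\<^sub>R v))) (at s within {0..t})"
      unfolding k_def
      by (rule has_derivative_compose[where f="\<lambda>s. x + a *\<^sub>R u + s *\<^sub>R v" and g=Du,
            OF _ smooth_on_has_derivative[OF sDu i1]])
         (auto intro!: derivative_eq_intros)
    thus ?thesis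
      by (simp add: linear_scale[OF lin2[OF i1]])
  qed
  obtain b where b: "b \<in> {0..t}"
    and kb: "k t - k 0 = (t - 0) * frechet_derivative Du (at (x + a *\<^sub>R u + b *\<^sub>R v)) v"
    using mvt_very_simple[of 0 t k, OF _ dk] \<open>t > 0\<close> by auto
  have "f (x + t *\<^sub>R u + t *\<^sub>R v) - f (x + t *\<^sub>R u) - f (x + t *\<^sub>R v) + f x = g t - g 0"
    by (simp add: g_def)
  also have "\<dots> = t * (k t - k 0)" using ga by (simp add: k_def)
  also have "\<dots> = t * t * frechet_derivative Du (at (x + a *\<^sub>R u + b *\<^sub>R v)) v"
    using kb by simp
  finally show ?thesis using a b unfolding Du_def by blast
qed

text \<open>The second difference of \<open>f\<close> in the directions \<open>u\<close> and \<open>v\<close> does not depend on their order,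
  and by the mean value theorem, applied twice, it is \<open>t * t\<close> times a value of either mixed
  derivative near \<open>x\<close>.\<close>

lemma second_derivative_symmetric:
  fixes f :: "'a::real_normed_vector \<Rightarrow> real"
  assumes "open S" "smooth_on S f" "x \<in> S"
  shows "frechet_derivative (\<lambda>y. frechet_derivative f (at y) u) (at x) v
       = frechet_derivative (\<lambda>y. frechet_derivative f (at y) v) (at x) u"
proof (rule ccontr)
  define F where "F = (\<lambda>u v y. frechet_derivative (\<lambda>y. frechet_derivative f (at y) u) (at y) v)"
  assume "\<not> ?thesis"
  hence ne: "F u v x \<noteq> F v u x" by (simp add: F_def)
  define e where "e = \<bar>F u v x - F v u x\<bar> / 2"
  have e: "e > 0" using ne by (simp add: e_def)
  have cont: "continuous_on S (F u v)" for u v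
    unfolding F_def by (intro smooth_on_continuous smooth_on_frechet_derivative assms(2))
  have ex: "\<exists>d>0. \<forall>y\<in>S. dist y x < d \<longrightarrow> dist (F u v y) (F u v x) < e" for u v
    using cont[of u v] assms(3) e unfolding continuous_on_iff by blast
  obtain d1 where d1: "d1 > 0" "\<And>y. y \<in> S \<Longrightarrow> dist y x < d1 \<Longrightarrow> dist (F u v y) (F u v x) < e"
    using ex by blast
  obtain d2 where d2: "d2 > 0" "\<And>y. y \<in> S \<Longrightarrow> dist y x < d2 \<Longrightarrow> dist (F v u y) (F v u x) < e"
    using ex by blast
  obtain d3 where d3: "d3 > 0" "ball x d3 \<subseteq> S"
    using assms(1,3) open_contains_ball by blast
  define d where "d = min d1 (min d2 d3)"
  have d: "d > 0" using d1 d2 d3 by (simp add: d_def)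
  define t where "t = d / (2 * (norm u + norm v + 1))"
  have den: "norm u + norm v + 1 > 0" by (smt (verit) norm_ge_zero)
  have t: "t > 0" using d den by (simp add: t_def)
  have tn: "t * (norm u + norm v) < d"
  proof -
    have "t * (norm u + norm v) \<le> t * (norm u + norm v + 1)" using t by simp
    also have "\<dots> = d / 2" using den by (simp add: t_def field_simps)
    finally show ?thesis using d by simp
  qed
  have close: "dist (x + a *\<^sub>R u + b *\<^sub>R v) x < d" if "a \<in> {0..t}" "b \<in> {0..t}" for a b
  proof -
    have "norm (a *\<^sub>R u + b *\<^sub>R v) \<le> a * norm u + b * norm v"
      using that norm_triangle_ineq[of "a *\<^sub>R u" "b *\<^sub>R v"] by simp
    also have "\<dots> \<le> t * norm u + t * norm v"
      using that by (intro add_mono mult_right_mono) auto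
    finally have "norm (a *\<^sub>R u + b *\<^sub>R v) < d" using tn by (simp add: algebra_simps)
    moreover have "x + a *\<^sub>R u + b *\<^sub>R v - x = a *\<^sub>R u + b *\<^sub>R v" by simp
    ultimately show ?thesis by (simp add: dist_norm)
  qed
  have inS: "x + a *\<^sub>R u + b *\<^sub>R v \<in> S" if "a \<in> {0..t}" "b \<in> {0..t}" for a b
    using close[OF that] d3(2) by (auto simp: d_def mem_ball dist_commute)
  obtain a b where ab: "a \<in> {0..t}" "b \<in> {0..t}"
    and E1: "f (x + t *\<^sub>R u + t *\<^sub>R v) - f (x + t *\<^sub>R u) - f (x + t *\<^sub>R v) + f x
      = t * t * F u v (x + a *\<^sub>R u + b *\<^sub>R v)"
    using second_difference_mvt[OF assms(1,2) t, of x u v] inS unfolding F_def by blast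
  have inS': "x + b *\<^sub>R v + a *\<^sub>R u \<in> S" if "a \<in> {0..t}" "b \<in> {0..t}" for a b
    using inS[OF that] by (simp add: add.commute add.left_commute)
  obtain a' b' where ab': "a' \<in> {0..t}" "b' \<in> {0..t}"
    and E2: "f (x + t *\<^sub>R v + t *\<^sub>R u) - f (x + t *\<^sub>R v) - f (x + t *\<^sub>R u) + f x
      = t * t * F v u (x + a' *\<^sub>R v + b' *\<^sub>R u)"
    using second_difference_mvt[OF assms(1,2) t, of x v u] inS' unfolding F_def by blast
  have "t * t * F u v (x + a *\<^sub>R u + b *\<^sub>R v) = t * t * F v u (x + a' *\<^sub>R v + b' *\<^sub>R u)"
  proof -
    have "x + t *\<^sub>R v + t *\<^sub>R u = x + t *\<^sub>R u + t *\<^sub>R v"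
      by (simp add: add.assoc add.commute[of "t *\<^sub>R v"])
    from E2[unfolded this] E1 show ?thesis by linarith
  qed
  hence eq: "F u v (x + a *\<^sub>R u + b *\<^sub>R v) = F v u (x + b' *\<^sub>R u + a' *\<^sub>R v)"
    using t by (simp add: add.commute add.left_commute)
  have "dist (F u v (x + a *\<^sub>R u + b *\<^sub>R v)) (F u v x) < e"
    using d1(2) inS[OF ab] close[OF ab] by (simp add: d_def)
  moreover have "dist (F v u (x + b' *\<^sub>R u + a' *\<^sub>R v)) (F v u x) < e"
    using d2(2) inS[OF ab'(2,1)] close[OF ab'(2,1)] by (simp add: d_def)
  ultimately have "\<bar>F u v x - F v u x\<bar> < 2 * e"
    unfolding eq dist_real_def by linarith
  thus False by (simp add: e_def)
qed

text \<open>The second-order parts of both compositions agree by symmetry of the second derivative, so the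
  commutator of the two derivations is again a derivation.\<close>

lemma vf_apply_lie_bracket:
  fixes f :: "'a::euclidean_space \<Rightarrow> real"
  assumes S: "open S" and f: "smooth_on S f" and Y: "smooth_on S Y" and Z: "smooth_on S Z"
    and x: "x \<in> S"
  shows "vf_apply (lie_bracket Y Z) f x = vf_apply Y (vf_apply Z f) x - vf_apply Z (vf_apply Y f) x"
proof -
  define D where "D = (\<lambda>b y. frechet_derivative f (at y) b)"
  have sD: "smooth_on S (D b)" for b
    unfolding D_def by (rule smooth_on_frechet_derivative[OF f])
  have comp: "smooth_on S (\<lambda>y. Z y \<bullet> b)" if "smooth_on S Z" for Z :: "'a \<Rightarrow> 'a" and b
    by (rule smooth_on_bounded_linear[OF S bounded_linear_inner_left that])
  have exp: "vf_apply Y (vf_apply Z f) x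
      = (\<Sum>b\<in>Basis. (Z x \<bullet> b) * (\<Sum>c\<in>Basis. (Y x \<bullet> c) * frechet_derivative (D b) (at x) c))
        + vf_apply (\<lambda>y. vf_apply Y Z y) f x"
    if Y: "smooth_on S Y" and Z: "smooth_on S Z" for Y Z
  proof -
    have "vf_apply Y (vf_apply Z f) x = vf_apply Y (\<lambda>y. \<Sum>b\<in>Basis. (Z y \<bullet> b) * D b y) x"
      using vf_apply_coords[OF f] by (intro vf_apply_cong[OF S _ x]) (auto simp: D_def)
    also have "\<dots> = (\<Sum>b\<in>Basis. vf_apply Y (\<lambda>y. (Z y \<bullet> b) * D b y) x)"
      by (intro vf_apply_sum[OF S _ x] smooth_on_mult S comp Z sD)
    also have "\<dots> = (\<Sum>b\<in>Basis. (Z x \<bullet> b) * vf_apply Y (D b) x + vf_apply Y (\<lambda>y. Z y \<bullet> b) x * D b x)"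
      by (intro sum.cong refl vf_apply_mult[OF comp[OF Z] sD x])
    also have "\<dots> = (\<Sum>b\<in>Basis. (Z x \<bullet> b) * vf_apply Y (D b) x)
        + (\<Sum>b\<in>Basis. (vf_apply Y Z x \<bullet> b) * D b x)"
      by (simp add: sum.distrib vf_apply_bounded_linear[OF bounded_linear_inner_left Z x])
    also have "(\<Sum>b\<in>Basis. (vf_apply Y Z x \<bullet> b) * D b x) = vf_apply (\<lambda>y. vf_apply Y Z y) f x"
      using vf_apply_coords[OF f x, of "\<lambda>y. vf_apply Y Z y"] by (simp add: D_def)
    also have "(\<Sum>b\<in>Basis. (Z x \<bullet> b) * vf_apply Y (D b) x)
       = (\<Sum>b\<in>Basis. (Z x \<bullet> b) * (\<Sum>c\<in>Basis. (Y x \<bullet> c) * frechet_derivative (D b) (at x) c))"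
      by (simp add: vf_apply_coords[OF sD x])
    finally show ?thesis .
  qed
  have sym: "(\<Sum>b\<in>Basis. (Z x \<bullet> b) * (\<Sum>c\<in>Basis. (Y x \<bullet> c) * frechet_derivative (D b) (at x) c))
     = (\<Sum>b\<in>Basis. (Y x \<bullet> b) * (\<Sum>c\<in>Basis. (Z x \<bullet> c) * frechet_derivative (D b) (at x) c))"
  proof -
    have "frechet_derivative (D b) (at x) c = frechet_derivative (D c) (at x) b" for b c
      unfolding D_def by (rule second_derivative_symmetric[OF S f x])
    thus ?thesis
      unfolding sum_distrib_left by (subst sum.swap) (simp add: mult.left_commute)
  qed
  have "vf_apply (lie_bracket Y Z) f x
      = vf_apply (\<lambda>y. vf_apply Y Z y) f x - vf_apply (\<lambda>y. vf_apply Z Y y) f x"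
    unfolding lie_bracket_def[abs_def] by (rule vf_apply_vdiff[OF f x])
  thus ?thesis using exp[OF Y Z] exp[OF Z Y] sym by simp
qed


section \<open>The filtration by commutator length\<close>

locale smooth_fields =
  fixes n :: nat and X :: "nat \<Rightarrow> 'a::euclidean_space \<Rightarrow> 'a" and \<Omega> :: "'a set"
  assumes op: "open \<Omega>"
    and smooth_X: "i \<in> {1..n} \<Longrightarrow> smooth_on \<Omega> (X i)"
begin

text \<open>Linear combinations with constant coefficients suffice: all that matters is the values at one
  point and closure under brackets. Rule \<open>filt_cong\<close> discards the values outside \<open>\<Omega>\<close>, where
  derivatives of the total functions representing the fields are meaningless.\<close>

inductive filt :: "nat \<Rightarrow> ('a \<Rightarrow> 'a) \<Rightarrow> bool" where
  filt_comm: "commutator n X k Y \<Longrightarrow> k \<le> l \<Longrightarrow> filt l Y"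
| filt_zero: "filt l (\<lambda>x. 0)"
| filt_add: "filt l Y \<Longrightarrow> filt l Z \<Longrightarrow> filt l (\<lambda>x. Y x + Z x)"
| filt_scale: "filt l Y \<Longrightarrow> filt l (\<lambda>x. c *\<^sub>R Y x)"
| filt_cong: "filt l Y \<Longrightarrow> \<forall>x\<in>\<Omega>. Y x = Z x \<Longrightarrow> filt l Z"

lemma commutator_smooth: "commutator n X k Y \<Longrightarrow> smooth_on \<Omega> Y"
  by (induction rule: commutator.induct) (intro smooth_X smooth_on_lie_bracket[OF op]; assumption)+

lemma filt_smooth: "filt l Y \<Longrightarrow> smooth_on \<Omega> Y"
proof (induction rule: filt.induct)
  case (filt_scale l Y c)
  then show ?case by (intro smooth_on_bounded_linear[OF op bounded_linear_scaleR_right])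
qed (auto intro: commutator_smooth smooth_on_const smooth_on_add[OF op] smooth_on_cong[OF op])

lemma filt_field: "i \<in> {1..n} \<Longrightarrow> filt 1 (X i)"
  using filt_comm commutator.field by blast

lemma filt_mono: "filt l Y \<Longrightarrow> l \<le> m \<Longrightarrow> filt m Y"
proof (induction rule: filt.induct)
  case (filt_comm k Y l)
  then show ?case using filt.filt_comm le_trans by blast
qed (auto intro: filt.intros)

lemma filt_value:
  assumes "filt l Y" "x \<in> \<Omega>"
  shows "Y x \<in> commutator_span n X l x"
  using assms
proof (induction rule: filt.induct)
  case (filt_comm k Y l)
  then show ?case unfolding commutator_span_def by (intro span_base) blast
qed (auto simp: commutator_span_def span_zero intro: span_add span_scale)

lemma commutator_span_filt:
  assumes "v \<in> commutator_span n X l x"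
  shows "\<exists>Y. filt l Y \<and> Y x = v"
  using assms unfolding commutator_span_def
proof (induction rule: span_induct_alt)
  case base
  then show ?case using filt_zero by fastforce
next
  case (step c v w)
  then obtain Y Z where "filt l Y" "Y x = v" "filt l Z" "Z x = w"
    by (blast intro: filt_comm)
  then show ?case using filt_add[OF filt_scale[of l Y c], of Z] by fastforce
qed

lemma lie_bracket_cong:
  assumes "\<forall>x\<in>\<Omega>. Y x = Y' x" "\<forall>x\<in>\<Omega>. Z x = Z' x" "x \<in> \<Omega>"
  shows "lie_bracket Y Z x = lie_bracket Y' Z' x"
  unfolding lie_bracket_def
  using vf_apply_cong[OF op assms(1,3)] vf_apply_cong[OF op assms(2,3)] assms by metis

lemma lie_bracket_add_right:
  assumes "smooth_on \<Omega> Y" "smooth_on \<Omega> Z" "smooth_on \<Omega> W" "x \<in> \<Omega>"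
  shows "lie_bracket Y (\<lambda>x. Z x + W x) x = lie_bracket Y Z x + lie_bracket Y W x"
  unfolding lie_bracket_def
  by (simp add: vf_apply_add[OF assms(2-4)] vf_apply_vadd[OF assms(1,4)])

lemma lie_bracket_scale_right:
  assumes "smooth_on \<Omega> Y" "smooth_on \<Omega> Z" "x \<in> \<Omega>"
  shows "lie_bracket Y (\<lambda>x. c *\<^sub>R Z x) x = c *\<^sub>R lie_bracket Y Z x"
  unfolding lie_bracket_def
  by (simp add: vf_apply_vscale[OF assms(1,3)] scaleR_diff_right
      vf_apply_bounded_linear[OF bounded_linear_scaleR_right assms(2,3)])

lemma lie_bracket_swap: "lie_bracket Y Z x = - lie_bracket Z Y x"
  by (simp add: lie_bracket_def)

lemma lie_bracket_zero_right:
  assumes "smooth_on \<Omega> Y" "x \<in> \<Omega>"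
  shows "lie_bracket Y (\<lambda>x. 0) x = 0"
  using lie_bracket_scale_right[OF assms(1) smooth_on_const assms(2), of 0 0] by simp

lemma lie_bracket_inner:
  assumes "smooth_on \<Omega> Y" "smooth_on \<Omega> Z" "x \<in> \<Omega>"
  shows "lie_bracket Y Z x \<bullet> b = vf_apply (lie_bracket Y Z) (\<lambda>y. y \<bullet> b) x"
  by (simp add: vf_apply_linear bounded_linear_inner_left)

text \<open>A field is determined by its action on the linear functionals; there the identity is the
  associativity of composition of derivations.\<close>

lemma lie_bracket_jacobi:
  assumes A: "smooth_on \<Omega> A" and B: "smooth_on \<Omega> B" and C: "smooth_on \<Omega> C" and x: "x \<in> \<Omega>"
  shows "lie_bracket (lie_bracket A B) C x
    = lie_bracket A (lie_bracket B C) x - lie_bracket B (lie_bracket A C) x"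
proof (rule euclidean_eqI)
  fix b :: 'a
  define c where "c = (\<lambda>y::'a. y \<bullet> b)"
  have c: "smooth_on \<Omega> c"
    unfolding c_def by (rule smooth_on_linear[OF op bounded_linear_inner_left])
  note sv = smooth_on_vf_apply[OF op] and sl = smooth_on_lie_bracket[OF op]
  have br: "vf_apply (lie_bracket Y (lie_bracket Z W)) c x
      = vf_apply Y (vf_apply Z (vf_apply W c)) x - vf_apply Y (vf_apply W (vf_apply Z c)) x
        - (vf_apply Z (vf_apply W (vf_apply Y c)) x - vf_apply W (vf_apply Z (vf_apply Y c)) x)"
    if Y: "smooth_on \<Omega> Y" and Z: "smooth_on \<Omega> Z" and W: "smooth_on \<Omega> W" for Y Z W
  proof -
    have "vf_apply (lie_bracket Y (lie_bracket Z W)) c x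
      = vf_apply Y (vf_apply (lie_bracket Z W) c) x - vf_apply (lie_bracket Z W) (vf_apply Y c) x"
      by (rule vf_apply_lie_bracket[OF op c Y sl[OF Z W] x])
    also have "vf_apply Y (vf_apply (lie_bracket Z W) c) x
      = vf_apply Y (\<lambda>y. vf_apply Z (vf_apply W c) y - vf_apply W (vf_apply Z c) y) x"
      by (rule vf_apply_cong[OF op _ x refl])
         (simp add: vf_apply_lie_bracket[OF op c Z W])
    also have "\<dots> = vf_apply Y (vf_apply Z (vf_apply W c)) x - vf_apply Y (vf_apply W (vf_apply Z c)) x"
      by (rule vf_apply_diff[OF _ _ x]) (intro sv c Z W)+
    also have "vf_apply (lie_bracket Z W) (vf_apply Y c) x
      = vf_apply Z (vf_apply W (vf_apply Y c)) x - vf_apply W (vf_apply Z (vf_apply Y c)) x"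
      by (rule vf_apply_lie_bracket[OF op sv[OF c Y] Z W x])
    finally show ?thesis .
  qed
  have inn: "lie_bracket Y Z x \<bullet> b = vf_apply (lie_bracket Y Z) c x"
    if "smooth_on \<Omega> Y" "smooth_on \<Omega> Z" for Y Z
    unfolding c_def by (rule lie_bracket_inner[OF that x])
  have "lie_bracket (lie_bracket A B) C x \<bullet> b = - (lie_bracket C (lie_bracket A B) x \<bullet> b)"
    by (subst lie_bracket_swap) simp
  also have "\<dots> = - vf_apply (lie_bracket C (lie_bracket A B)) c x"
    by (simp add: inn[OF C sl[OF A B]])
  also have "\<dots> = vf_apply (lie_bracket A (lie_bracket B C)) c x
      - vf_apply (lie_bracket B (lie_bracket A C)) c x"
    by (simp add: br A B C)
  also have "\<dots> = (lie_bracket A (lie_bracket B C) x - lie_bracket B (lie_bracket A C) x) \<bullet> b"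
    by (simp add: inn sl A B C inner_diff_left)
  finally show "lie_bracket (lie_bracket A B) C x \<bullet> b
    = (lie_bracket A (lie_bracket B C) x - lie_bracket B (lie_bracket A C) x) \<bullet> b" .
qed

lemma filt_bracket_induct_right:
  assumes Y: "smooth_on \<Omega> Y"
    and base: "\<And>k W. commutator n X k W \<Longrightarrow> k \<le> l \<Longrightarrow> filt m (lie_bracket Y W)"
    and Z: "filt l Z"
  shows "filt m (lie_bracket Y Z)"
  using Z base
proof (induction rule: filt.induct)
  case (filt_zero l)
  have "\<forall>x\<in>\<Omega>. 0 = lie_bracket Y (\<lambda>x. 0) x"
    using lie_bracket_zero_right[OF Y] by simp
  then show ?case by (rule filt_cong[OF filt.filt_zero])
next
  case (filt_add l Z W)
  have "\<forall>x\<in>\<Omega>. lie_bracket Y Z x + lie_bracket Y W x = lie_bracket Y (\<lambda>x. Z x + W x) x"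
    using lie_bracket_add_right[OF Y] filt_add filt_smooth by auto
  then show ?case
    using filt_cong[OF filt.filt_add] filt_add by blast
next
  case (filt_scale l Z c)
  have "\<forall>x\<in>\<Omega>. c *\<^sub>R lie_bracket Y Z x = lie_bracket Y (\<lambda>x. c *\<^sub>R Z x) x"
    using lie_bracket_scale_right[OF Y] filt_scale filt_smooth by auto
  then show ?case
    using filt_cong[OF filt.filt_scale] filt_scale by blast
next
  case (filt_cong l Z W)
  have "\<forall>x\<in>\<Omega>. lie_bracket Y Z x = lie_bracket Y W x"
    using lie_bracket_cong filt_cong by auto
  then show ?case using filt.filt_cong filt_cong by blast
qed auto

lemma filt_bracket_field:
  assumes "i \<in> {1..n}" "filt l Z"
  shows "filt (Suc l) (lie_bracket (X i) Z)"
  by (rule filt_bracket_induct_right[OF smooth_X[OF assms(1)] _ assms(2)])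
     (rule filt_comm[OF commutator.bracket[OF assms(1)]], simp_all)

text \<open>The commutators are nested to the right, so a bracket whose left entry is itself a bracket is
  reduced by the Jacobi identity.\<close>

lemma filt_bracket_comm:
  assumes "commutator n X a Y" "filt b Z"
  shows "filt (a + b) (lie_bracket Y Z)"
  using assms
proof (induction arbitrary: b Z rule: commutator.induct)
  case (field i)
  then show ?case using filt_bracket_field by simp
next
  case (bracket i j Y)
  have s: "smooth_on \<Omega> (X i)" "smooth_on \<Omega> Y" "smooth_on \<Omega> Z"
    using bracket smooth_X commutator_smooth filt_smooth by auto
  have "filt (Suc j + b) (lie_bracket (X i) (lie_bracket Y Z))"
    using filt_bracket_field[OF bracket.hyps(1) bracket.IH[OF bracket.prems]] by simp
  moreover have "filt (Suc j + b) (lie_bracket Y (lie_bracket (X i) Z))"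
    using bracket.IH[OF filt_bracket_field[OF bracket.hyps(1) bracket.prems]] by simp
  ultimately have "filt (Suc j + b) (\<lambda>x. lie_bracket (X i) (lie_bracket Y Z) x
      + (-1) *\<^sub>R lie_bracket Y (lie_bracket (X i) Z) x)"
    by (intro filt_add filt_scale)
  moreover have "\<forall>x\<in>\<Omega>. lie_bracket (X i) (lie_bracket Y Z) x
      + (-1) *\<^sub>R lie_bracket Y (lie_bracket (X i) Z) x = lie_bracket (lie_bracket (X i) Y) Z x"
    using lie_bracket_jacobi[OF s] by simp
  ultimately show ?case by (rule filt_cong)
qed

lemma filt_bracket:
  assumes "filt a Y" "filt b Z"
  shows "filt (a + b) (lie_bracket Y Z)"
proof -
  have "filt (a + b) (lie_bracket Z Y)"
  proof (rule filt_bracket_induct_right[OF filt_smooth[OF assms(2)] _ assms(1)])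
    fix k W assume W: "commutator n X k W" "k \<le> a"
    have "filt (k + b) (\<lambda>x. (-1) *\<^sub>R lie_bracket W Z x)"
      by (intro filt_scale filt_bracket_comm W assms)
    moreover have "\<forall>x\<in>\<Omega>. (-1) *\<^sub>R lie_bracket W Z x = lie_bracket Z W x"
      by (simp add: lie_bracket_def)
    ultimately show "filt (a + b) (lie_bracket Z W)"
      by (rule filt_mono[OF filt_cong]) (simp add: W)
  qed
  from filt_scale[OF this, of "-1"] show ?thesis
    by (rule filt_cong) (simp add: lie_bracket_def)
qed

section \<open>Iterated derivatives at a point\<close>

definition word :: "('a \<Rightarrow> 'a) list \<Rightarrow> ('a \<Rightarrow> real) \<Rightarrow> 'a \<Rightarrow> real" where
  "word Zs f = foldr vf_apply Zs f"

lemma word_Nil [simp]: "word [] f = f"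
  and word_Cons [simp]: "word (Z # Zs) f = vf_apply Z (word Zs f)"
  and word_append: "word (Zs @ Ws) f = word Zs (word Ws f)"
  by (simp_all add: word_def)

lemma word_smooth:
  "\<forall>Z\<in>set Zs. smooth_on \<Omega> Z \<Longrightarrow> smooth_on \<Omega> f \<Longrightarrow> smooth_on \<Omega> (word Zs f)"
  by (induction Zs) (auto intro: smooth_on_vf_apply[OF op])

lemma word_cong:
  assumes "\<forall>x\<in>\<Omega>. f x = g x" "x \<in> \<Omega>"
  shows "word Zs f x = word Zs g x"
  using assms(2)
proof (induction Zs arbitrary: x)
  case Nil
  then show ?case using assms by simp
next
  case (Cons Z Zs)
  have "vf_apply Z (word Zs f) x = vf_apply Z (word Zs g) x"
    by (rule vf_apply_cong[OF op _ Cons.prems refl]) (use Cons.IH in blast)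
  then show ?case by simp
qed

lemma word_add:
  assumes "\<forall>Z\<in>set Zs. smooth_on \<Omega> Z" "smooth_on \<Omega> f" "smooth_on \<Omega> g" "x \<in> \<Omega>"
  shows "word Zs (\<lambda>x. f x + g x) x = word Zs f x + word Zs g x"
  using assms(1,4)
proof (induction Zs arbitrary: x)
  case (Cons Z Zs)
  have "vf_apply Z (word Zs (\<lambda>x. f x + g x)) x = vf_apply Z (\<lambda>x. word Zs f x + word Zs g x) x"
    using Cons by (intro vf_apply_cong[OF op]) auto
  also have "\<dots> = vf_apply Z (word Zs f) x + vf_apply Z (word Zs g) x"
    using Cons.prems assms(2,3) by (intro vf_apply_add[of \<Omega>] word_smooth) auto
  finally show ?case by simp
qed simp

lemma word_cmult:
  assumes "\<forall>Z\<in>set Zs. smooth_on \<Omega> Z" "smooth_on \<Omega> f" "x \<in> \<Omega>"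
  shows "word Zs (\<lambda>x. c * f x) x = c * word Zs f x"
  using assms(1,3)
proof (induction Zs arbitrary: x)
  case (Cons Z Zs)
  have "vf_apply Z (word Zs (\<lambda>x. c * f x)) x = vf_apply Z (\<lambda>x. c * word Zs f x) x"
    using Cons by (intro vf_apply_cong[OF op]) auto
  also have "\<dots> = c * vf_apply Z (word Zs f) x"
    using Cons.prems assms(2) by (intro vf_apply_cmult[of \<Omega>] word_smooth) auto
  finally show ?case by simp
qed simp

lemma word_diff:
  assumes "\<forall>Z\<in>set Zs. smooth_on \<Omega> Z" "smooth_on \<Omega> f" "smooth_on \<Omega> g" "x \<in> \<Omega>"
  shows "word Zs (\<lambda>x. f x - g x) x = word Zs f x - word Zs g x"
  using word_add[OF assms(1,2) smooth_on_mult[OF op smooth_on_const[of \<Omega> "-1"] assms(3)] assms(4)]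
    word_cmult[OF assms(1,3,4), of "-1"] by simp

lemma word_sum:
  assumes "\<forall>Z\<in>set Zs. smooth_on \<Omega> Z" "\<And>i. i \<in> A \<Longrightarrow> smooth_on \<Omega> (f i)" "x \<in> \<Omega>"
  shows "word Zs (\<lambda>x. \<Sum>i\<in>A. c i * f i x) x = (\<Sum>i\<in>A. c i * word Zs (f i) x)"
  using assms(2)
proof (induction A rule: infinite_finite_induct)
  case (infinite A)
  then show ?case using word_cmult[OF assms(1) smooth_on_const assms(3), of 0 0] by simp
next
  case empty
  then show ?case using word_cmult[OF assms(1) smooth_on_const assms(3), of 0 0] by simp
next
  case (insert a A)
  have "word Zs (\<lambda>x. c a * f a x + (\<Sum>i\<in>A. c i * f i x)) x
    = word Zs (\<lambda>x. c a * f a x) x + word Zs (\<lambda>x. \<Sum>i\<in>A. c i * f i x) x"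
    using insert.prems
    by (intro word_add[OF assms(1) _ _ assms(3)] smooth_on_sum smooth_on_mult op smooth_on_const) auto
  then show ?case using insert word_cmult[OF assms(1) _ assms(3)] by simp
qed

end

text \<open>Swaps of neighbours move any letter to the front; induction takes care of the remaining word.\<close>

lemma swap_invariant_imp_mset_invariant:
  assumes swap: "\<And>xs a b ys. mset (xs @ a # b # ys) = M \<Longrightarrow> F (xs @ a # b # ys) = F (xs @ b # a # ys)"
    and "mset xs = M" "mset ys = M"
  shows "F xs = F ys"
proof -
  have shift: "F (ps @ us @ a # vs) = F (ps @ a # us @ vs)" if "mset (ps @ us @ a # vs) = M" for ps us vs a
    using that
  proof (induction us arbitrary: ps)
    case (Cons u us)
    have "F (ps @ (u # us) @ a # vs) = F (ps @ u # a # us @ vs)"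
      using Cons.IH[of "ps @ [u]"] Cons.prems by simp
    also have "\<dots> = F (ps @ a # u # us @ vs)"
      using Cons.prems by (intro swap) simp
    finally show ?case by simp
  qed simp
  have "F (ps @ xs) = F (ps @ ys)" if "mset xs = mset ys" "mset (ps @ xs) = M" for ps xs ys
    using that
  proof (induction xs arbitrary: ps ys)
    case (Cons x xs)
    then have "x \<in> set ys" by (metis list.set_intros(1) mset_eq_setD)
    then obtain us vs where ys: "ys = us @ x # vs" by (meson split_list)
    have "F ((ps @ [x]) @ xs) = F ((ps @ [x]) @ us @ vs)"
      using Cons.prems ys by (intro Cons.IH) auto
    also have "\<dots> = F (ps @ ys)"
      using shift[of ps us x vs] Cons.prems ys by simp
    finally show ?case by simp
  qed simp
  from this[of xs ys "[]"] assms show ?thesis by simp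
qed


section \<open>Frames adapted to the filtration\<close>

text \<open>An arbitrary ordering of the letters of a multiset. Which one is chosen is immaterial, as two
  orderings of a word differ by shorter words.\<close>

definition rep :: "'b multiset \<Rightarrow> 'b list" where
  "rep M = (SOME xs. mset xs = M)"

lemma mset_rep [simp]: "mset (rep M) = M"
  unfolding rep_def by (rule someI_ex[OF ex_mset])

lemma set_rep [simp]: "set (rep M) = set_mset M"
  by (metis mset_rep set_mset_mset)

lemma length_rep [simp]: "length (rep M) = size M"
  by (metis mset_rep size_mset)

text \<open>A basis \<open>B\<close> of the tangent space at \<open>x0\<close> that is adapted to the flag of the spans \<open>V\<^sub>j(x0)\<close>, each
  \<open>b \<in> B\<close> extended to a field \<open>Y b\<close> that is as low in the filtration as \<open>b\<close> is in the flag. Only the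
  values at \<open>x0\<close> are adapted: the dimensions of \<open>V\<^sub>j\<close> may jump at nearby points.\<close>

locale adapted_frame = smooth_fields n X \<Omega>
  for n :: nat and X :: "nat \<Rightarrow> 'a::euclidean_space \<Rightarrow> 'a" and \<Omega> :: "'a set" +
  fixes x0 :: 'a and r :: nat and B :: "'a set" and w :: "'a \<Rightarrow> nat" and Y :: "'a \<Rightarrow> 'a \<Rightarrow> 'a"
  assumes x0: "x0 \<in> \<Omega>"
    and indep_B: "independent B" and span_B: "span B = UNIV"
    and w_pos: "b \<in> B \<Longrightarrow> 1 \<le> w b" and w_le: "b \<in> B \<Longrightarrow> w b \<le> r"
    and filt_Y: "b \<in> B \<Longrightarrow> filt (w b) (Y b)" and Y_x0: "b \<in> B \<Longrightarrow> Y b x0 = b"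
    and adapted: "filt l Z \<Longrightarrow> Z x0 \<in> span {b \<in> B. w b \<le> l}"
begin

lemma finite_B: "finite B"
  using indep_B independent_bound_general by blast

lemma smooth_Y: "b \<in> B \<Longrightarrow> smooth_on \<Omega> (Y b)"
  using filt_smooth filt_Y by blast

definition wt :: "'a multiset \<Rightarrow> nat" where
  "wt M = (\<Sum>b\<in>#M. w b)"

definition msets :: "nat \<Rightarrow> 'a multiset set" where
  "msets S = {M. set_mset M \<subseteq> B \<and> size M \<le> S}"

lemma finite_msets: "finite (msets S)"
proof (rule finite_subset)
  show "msets S \<subseteq> mset ` {xs. set xs \<subseteq> B \<and> length xs \<le> S}"
  proof
    fix M assume "M \<in> msets S"
    hence "rep M \<in> {xs. set xs \<subseteq> B \<and> length xs \<le> S}" by (simp add: msets_def)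
    thus "M \<in> mset ` {xs. set xs \<subseteq> B \<and> length xs \<le> S}" by (metis imageI mset_rep)
  qed
  show "finite (mset ` {xs. set xs \<subseteq> B \<and> length xs \<le> S})"
    by (intro finite_imageI finite_lists_length_le finite_B)
qed

lemma word_swap:
  assumes "\<forall>Z\<in>set xs. smooth_on \<Omega> Z" "\<forall>Z\<in>set ys. smooth_on \<Omega> Z"
    and A: "smooth_on \<Omega> A" and C: "smooth_on \<Omega> C" and u: "smooth_on \<Omega> u" and x: "x \<in> \<Omega>"
  shows "word (xs @ A # C # ys) u x - word (xs @ C # A # ys) u x = word (xs @ lie_bracket A C # ys) u x"
proof -
  define g where "g = word ys u"
  have g: "smooth_on \<Omega> g" unfolding g_def by (rule word_smooth[OF assms(2) u])
  note sv = smooth_on_vf_apply[OF op]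
  have "word (xs @ A # C # ys) u x - word (xs @ C # A # ys) u x
     = word xs (\<lambda>x. vf_apply A (vf_apply C g) x - vf_apply C (vf_apply A g) x) x"
    unfolding word_append word_Cons g_def[symmetric]
    by (intro word_diff[symmetric] assms(1) sv g A C x)
  also have "\<dots> = word xs (vf_apply (lie_bracket A C) g) x"
    using vf_apply_lie_bracket[OF op g A C] by (intro word_cong x) simp
  finally show ?thesis by (simp add: word_append g_def)
qed

text \<open>The frame words control all words, which is the Poincare-Birkhoff-Witt argument at a point:
  modulo shorter words of the same total weight, letters commute; so every letter can be brought
  to the front, where only its value at \<open>x0\<close> matters, and that value is a combination of frame
  vectors of no larger weight. With \<open>L\<close> below the weight of interest the lemma compares weighted
  orders of vanishing, with \<open>L\<close> large the ordinary ones.\<close>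

lemma words_vanish:
  assumes u: "smooth_on \<Omega> u"
    and hyp: "\<And>M. M \<in> msets S \<Longrightarrow> wt M \<le> L \<Longrightarrow> word (map Y (rep M)) u x0 = 0"
  shows "\<forall>(l, Z)\<in>set zs. filt l Z \<Longrightarrow> length zs \<le> S \<Longrightarrow> sum_list (map fst zs) \<le> L
    \<Longrightarrow> word (map snd zs) u x0 = 0"
proof (induction "length zs" arbitrary: zs rule: less_induct)
  case less
  define good where "good = (\<lambda>zs'. (\<forall>(l, Z)\<in>set zs'. filt l Z) \<and> length zs' = length zs
      \<and> sum_list (map fst zs') \<le> L)"
  define val where "val = (\<lambda>zs' :: (nat \<times> ('a \<Rightarrow> 'a)) list. word (map snd zs') u x0)"
  have sm: "\<forall>Z\<in>set (map snd zs'). smooth_on \<Omega> Z" if "\<forall>(l, Z)\<in>set zs'. filt l Z" for zs'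
    using that filt_smooth by fastforce
  have perm: "val ps = val qs" if ps: "good ps" and pq: "mset ps = mset qs" for ps qs
  proof (rule swap_invariant_imp_mset_invariant[OF _ refl pq[symmetric]])
    fix xs a b ys assume m: "mset (xs @ a # b # ys) = mset ps"
    obtain l A where a: "a = (l, A)" by force
    obtain l' A' where b: "b = (l', A')" by force
    let ?c = "(l + l', lie_bracket A A')"
    have set: "set (xs @ a # b # ys) = set ps" using m by (metis set_mset_mset)
    have F: "\<forall>(l, Z)\<in>set (xs @ a # b # ys). filt l Z"
      unfolding set using ps by (simp add: good_def)
    have s: "sum_list (map fst (xs @ a # b # ys)) \<le> L"
      using ps m unfolding good_def by (metis mset_map sum_mset_sum_list)
    have len: "length (xs @ a # b # ys) = length zs"
      using ps m unfolding good_def by (metis size_mset)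
    have "val (xs @ a # b # ys) - val (xs @ b # a # ys) = val (xs @ ?c # ys)"
      using sm[OF F] word_swap[of "map snd xs" "map snd ys" A A' u x0] u x0
      by (simp add: val_def a b)
    also have "\<dots> = 0"
      unfolding val_def
    proof (rule less.hyps)
      show "length (xs @ ?c # ys) < length zs" using len by simp
      show "length (xs @ ?c # ys) \<le> S" using len less.prems by simp
      show "sum_list (map fst (xs @ ?c # ys)) \<le> L" using s a b by simp
      show "\<forall>(l, Z)\<in>set (xs @ ?c # ys). filt l Z"
        using F a b filt_bracket by auto
    qed
    finally show "val (xs @ a # b # ys) = val (xs @ b # a # ys)" by simp
  qed
  define fr where "fr = map (\<lambda>b. (w b, Y b))"
  have main: "val (fr bs @ zs') = 0" if "set bs \<subseteq> B" "good (fr bs @ zs')" for bs zs'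
    using that
  proof (induction zs' arbitrary: bs)
    case Nil
    define M where "M = mset bs"
    have "val (fr bs @ []) = val (fr (rep M))"
      using Nil by (intro perm) (auto simp: fr_def M_def)
    also have "\<dots> = word (map Y (rep M)) u x0"
      by (simp add: val_def fr_def o_def)
    also have "\<dots> = 0"
    proof (rule hyp)
      show "M \<in> msets S" using Nil less.prems by (auto simp: M_def msets_def good_def fr_def)
      have "wt M = sum_list (map fst (fr bs))"
        unfolding wt_def M_def fr_def by (simp add: o_def flip: sum_mset_sum_list)
      thus "wt M \<le> L" using Nil by (simp add: good_def)
    qed
    finally show ?case .
  next
    case (Cons z zs')
    obtain l Z where z: "z = (l, Z)" by force
    have Z: "filt l Z" using Cons.prems by (auto simp: good_def z)
    define g where "g = word (map snd (fr bs @ zs')) u"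
    have g: "smooth_on \<Omega> g"
      unfolding g_def using Cons.prems by (intro word_smooth u sm) (auto simp: good_def)
    have "val (fr bs @ z # zs') = val (z # fr bs @ zs')"
      using Cons.prems by (intro perm) auto
    also have "\<dots> = frechet_derivative g (at x0) (Z x0)"
      by (simp add: val_def z g_def vf_apply_def)
    also have "\<dots> = 0"
    proof (rule linear_eq_0_on_span[OF linear_frechet_derivative[OF smooth_on_differentiable[OF g x0]]
          _ adapted[OF Z]])
      fix b assume b: "b \<in> {b \<in> B. w b \<le> l}"
      have "val (fr (b # bs) @ zs') = 0"
        using Cons.prems b filt_Y z by (intro Cons.IH) (auto simp: good_def fr_def)
      thus "frechet_derivative g (at x0) b = 0"
        using b Y_x0 by (simp add: val_def fr_def g_def vf_apply_def)
    qed
    finally show ?case .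
  qed
  from main[of "[]" zs] less.prems show ?case by (simp add: good_def val_def fr_def)
qed

section \<open>Dual functions\<close>

definition lin_coord :: "'a \<Rightarrow> 'a \<Rightarrow> real" where
  "lin_coord b v = representation B v b"

lemma lin_coord_bounded_linear: "bounded_linear (lin_coord b)"
proof -
  have "linear (\<lambda>v. representation B v b)"
    by (rule linearI) (simp_all add: real_vector.representation_add[OF indep_B]
        real_vector.representation_scale[OF indep_B] span_B)
  thus ?thesis unfolding lin_coord_def[abs_def] by (simp add: linear_conv_bounded_linear)
qed

lemma lin_coord_basis: "c \<in> B \<Longrightarrow> lin_coord b c = (if b = c then 1 else 0)"
  by (simp add: lin_coord_def real_vector.representation_basis[OF indep_B])

lemma lin_coord_expansion: "(\<Sum>b\<in>B. lin_coord b v *\<^sub>R b) = v"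
  unfolding lin_coord_def
  using real_vector.sum_representation_eq[OF indep_B, of v B] span_B finite_B by simp

definition monom_at :: "'a multiset \<Rightarrow> 'a \<Rightarrow> real" where
  "monom_at M x = (\<Prod>b\<in>#M. lin_coord b (x - x0))"

lemma monom_at_empty [simp]: "monom_at {#} x = 1"
  and monom_at_add [simp]: "monom_at (add_mset b M) x = lin_coord b (x - x0) * monom_at M x"
  by (simp_all add: monom_at_def)

lemma smooth_lin_coord: "smooth_on \<Omega> (\<lambda>x. lin_coord b (x - x0))"
  by (intro smooth_on_bounded_linear[OF op lin_coord_bounded_linear] smooth_on_diff[OF op]
      smooth_on_linear[OF op bounded_linear_ident] smooth_on_const)

lemma vf_apply_lin_coord:
  assumes "x \<in> \<Omega>"
  shows "vf_apply Z (\<lambda>x. lin_coord b (x - x0)) x = lin_coord b (Z x)"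
proof (rule vf_apply_eqI)
  show "((\<lambda>x. lin_coord b (x - x0)) has_derivative lin_coord b) (at x)"
    by (rule bounded_linear.has_derivative[OF lin_coord_bounded_linear]) (auto intro!: derivative_eq_intros)
qed

lemma smooth_monom_at: "smooth_on \<Omega> (monom_at M)"
proof (induction M)
  case empty
  have "monom_at {#} = (\<lambda>x. 1)" by auto
  then show ?case by (simp add: smooth_on_const)
next
  case (add b M)
  have "monom_at (add_mset b M) = (\<lambda>x. lin_coord b (x - x0) * monom_at M x)" by auto
  then show ?case using smooth_on_mult[OF op smooth_lin_coord add] by simp
qed

lemma vf_apply_monom_at:
  assumes "set_mset M \<subseteq> B" "x \<in> \<Omega>"
  shows "vf_apply Z (monom_at M) x = (\<Sum>c\<in>B. count M c * (lin_coord c (Z x) * monom_at (M - {#c#}) x))"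
  using assms(1)
proof (induction M)
  case empty
  have "monom_at {#} = (\<lambda>x. 1)" by auto
  then show ?case by simp
next
  case (add a M)
  have m: "monom_at (add_mset a M) = (\<lambda>x. lin_coord a (x - x0) * monom_at M x)" by auto
  have "vf_apply Z (monom_at (add_mset a M)) x
     = lin_coord a (x - x0) * vf_apply Z (monom_at M) x + lin_coord a (Z x) * monom_at M x"
    unfolding m by (simp add: vf_apply_mult[OF smooth_lin_coord smooth_monom_at assms(2)] vf_apply_lin_coord assms)
  also have "lin_coord a (x - x0) * vf_apply Z (monom_at M) x
     = (\<Sum>c\<in>B. count M c * (lin_coord c (Z x) * monom_at (add_mset a M - {#c#}) x))"
  proof -
    have "lin_coord a (x - x0) * (count M c * (lin_coord c (Z x) * monom_at (M - {#c#}) x))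
       = count M c * (lin_coord c (Z x) * monom_at (add_mset a M - {#c#}) x)" for c
    proof (cases "c \<in># M")
      case True
      hence "add_mset a M - {#c#} = add_mset a (M - {#c#})"
        by (metis add_mset_commute add_mset_remove_trivial insert_DiffM)
      then show ?thesis by simp
    next
      case False
      then show ?thesis by (simp add: not_in_iff)
    qed
    hence "(\<Sum>c\<in>B. lin_coord a (x - x0) * (count M c * (lin_coord c (Z x) * monom_at (M - {#c#}) x)))
       = (\<Sum>c\<in>B. count M c * (lin_coord c (Z x) * monom_at (add_mset a M - {#c#}) x))"
      by (intro sum.cong refl)
    thus ?thesis using add by (simp add: sum_distrib_left)
  qed
  also have "lin_coord a (Z x) * monom_at M x
     = (\<Sum>c\<in>B. (if c = a then 1 else 0) * (lin_coord c (Z x) * monom_at (add_mset a M - {#c#}) x))"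
    using add.prems finite_B by (simp add: if_distrib[of "\<lambda>t. t * _"] cong: if_cong)
  finally show ?case
    unfolding sum.distrib[symmetric] by (simp, intro sum.cong refl, auto simp: distrib_right)
qed

definition mfact :: "'a multiset \<Rightarrow> real" where
  "mfact M = (\<Prod>c\<in>B. fact (count M c))"

lemma mfact_pos: "mfact M > 0"
  unfolding mfact_def by (intro prod_pos) simp

lemma mfact_remove:
  assumes "b \<in># M" "b \<in> B"
  shows "mfact M = count M b * mfact (M - {#b#})"
proof -
  obtain k where k: "count M b = Suc k" using assms(1) by (metis count_eq_zero_iff not0_implies_Suc)
  have "mfact M = fact (count M b) * (\<Prod>c\<in>B - {b}. fact (count M c))"
    unfolding mfact_def by (rule prod.remove[OF finite_B assms(2)])
  also have "(\<Prod>c\<in>B - {b}. fact (count M c)) = (\<Prod>c\<in>B - {b}. fact (count (M - {#b#}) c) :: real)"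
    by (intro prod.cong) auto
  also have "fact (count M b) = real (count M b) * fact (count (M - {#b#}) b)"
    using k by simp
  also have "real (count M b) * fact (count (M - {#b#}) b) * (\<Prod>c\<in>B - {b}. fact (count (M - {#b#}) c))
     = count M b * mfact (M - {#b#})"
    unfolding mfact_def by (simp add: prod.remove[OF finite_B assms(2)] mult.assoc)
  finally show ?thesis .
qed

text \<open>At \<open>x0\<close> every factor of the monomial vanishes, so each must be hit by a letter of its own, and a
  frame letter hits only the factor dual to it.\<close>

lemma word_monom_at:
  assumes "smooth_on \<Omega> h" "set bs \<subseteq> B" "set_mset M \<subseteq> B" "length bs \<le> size M"
  shows "word (map Y bs) (\<lambda>x. h x * monom_at M x) x0 = (if mset bs = M then h x0 * mfact M else 0)"
  using assms
proof (induction bs arbitrary: h M rule: rev_induct)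
  case Nil
  show ?case
  proof (cases M)
    case empty
    then show ?thesis by (simp add: mfact_def)
  next
    case (add b N)
    then show ?thesis using linear_0[OF bounded_linear.linear[OF lin_coord_bounded_linear]] by simp
  qed
next
  case (snoc b bs)
  have b: "b \<in> B" and bs: "set bs \<subseteq> B" using snoc.prems by auto
  have smb: "\<forall>Z\<in>set (map Y bs). smooth_on \<Omega> Z" using bs smooth_Y by auto
  define k where "k = (\<lambda>c x. h x * lin_coord c (Y b x))"
  have k: "smooth_on \<Omega> (k c)" for c
    unfolding k_def
    by (intro smooth_on_mult op snoc.prems smooth_on_bounded_linear[OF op lin_coord_bounded_linear] smooth_Y b)
  have km: "smooth_on \<Omega> (\<lambda>x. k c x * monom_at (M - {#c#}) x)" for c
    by (intro smooth_on_mult op k smooth_monom_at)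
  have hm: "smooth_on \<Omega> (\<lambda>x. vf_apply (Y b) h x * monom_at M x)"
    by (intro smooth_on_mult op smooth_on_vf_apply snoc.prems smooth_monom_at smooth_Y b)
  have e: "vf_apply (Y b) (\<lambda>x. h x * monom_at M x) x
      = (\<Sum>c\<in>B. count M c * (k c x * monom_at (M - {#c#}) x)) + vf_apply (Y b) h x * monom_at M x"
    if "x \<in> \<Omega>" for x
    by (simp add: vf_apply_mult[OF snoc.prems(1) smooth_monom_at that]
        vf_apply_monom_at[OF snoc.prems(3) that] k_def sum_distrib_left mult_ac)
  have "word (map Y (bs @ [b])) (\<lambda>x. h x * monom_at M x) x0
    = word (map Y bs) (vf_apply (Y b) (\<lambda>x. h x * monom_at M x)) x0"
    by (simp add: word_append)
  also have "\<dots> = word (map Y bs) (\<lambda>x. (\<Sum>c\<in>B. count M c * (k c x * monom_at (M - {#c#}) x))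
      + vf_apply (Y b) h x * monom_at M x) x0"
    by (rule word_cong[OF _ x0]) (simp add: e)
  also have "\<dots> = word (map Y bs) (\<lambda>x. \<Sum>c\<in>B. count M c * (k c x * monom_at (M - {#c#}) x)) x0
      + word (map Y bs) (\<lambda>x. vf_apply (Y b) h x * monom_at M x) x0"
    by (rule word_add[OF smb _ hm x0])
       (intro smooth_on_sum op smooth_on_mult[OF op smooth_on_const km])
  also have "word (map Y bs) (\<lambda>x. vf_apply (Y b) h x * monom_at M x) x0 = 0"
    using snoc.IH[of "vf_apply (Y b) h" M] bs snoc.prems smooth_Y[OF b]
    by (auto simp: smooth_on_vf_apply[OF op])
  also have "word (map Y bs) (\<lambda>x. \<Sum>c\<in>B. count M c * (k c x * monom_at (M - {#c#}) x)) x0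
     = (\<Sum>c\<in>B. count M c * word (map Y bs) (\<lambda>x. k c x * monom_at (M - {#c#}) x) x0)"
    by (rule word_sum[OF smb km x0])
  also have "\<dots> = (\<Sum>c\<in>B. if c = b then (if mset (bs @ [b]) = M then h x0 * mfact M else 0) else 0)"
  proof (rule sum.cong[OF refl])
    fix c assume c: "c \<in> B"
    show "count M c * word (map Y bs) (\<lambda>x. k c x * monom_at (M - {#c#}) x) x0
      = (if c = b then (if mset (bs @ [b]) = M then h x0 * mfact M else 0) else 0)"
    proof (cases "c \<in># M")
      case True
      have "set_mset (M - {#c#}) \<subseteq> B" using snoc.prems by (meson in_diffD subset_eq)
      moreover have "length bs \<le> size (M - {#c#})"
        using snoc.prems True by (simp add: size_Diff_singleton)
      ultimately have "word (map Y bs) (\<lambda>x. k c x * monom_at (M - {#c#}) x) x0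
        = (if mset bs = M - {#c#} then k c x0 * mfact (M - {#c#}) else 0)"
        by (rule snoc.IH[OF k bs])
      moreover have "k c x0 = (if c = b then h x0 else 0)"
        unfolding k_def using lin_coord_basis[OF b] Y_x0[OF b] by simp
      moreover have "mset bs = M - {#c#} \<longleftrightarrow> mset (bs @ [c]) = M"
        using True by auto
      ultimately show ?thesis using mfact_remove[OF True c] by auto
    next
      case False
      hence "count M c = 0" by (simp add: not_in_iff)
      moreover have "mset (bs @ [b]) \<noteq> M" if "c = b" using False that by auto
      ultimately show ?thesis by auto
    qed
  qed
  also have "\<dots> = (if mset (bs @ [b]) = M then h x0 * mfact M else 0)"
    using finite_B b by simp
  finally show ?case by simp
qed

text \<open>The matrix of frame words against monomials is block triangular by degree, with invertible
  diagonal blocks.\<close>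

lemma interpolation:
  "\<exists>g. smooth_on \<Omega> g \<and> (\<forall>M\<in>msets S. word (map Y (rep M)) g x0 = c M)"
proof (induction S)
  case 0
  have "\<forall>M\<in>msets 0. word (map Y (rep M)) (\<lambda>x. c {#}) x0 = c M"
    by (auto simp: msets_def rep_def)
  then show ?case using smooth_on_const by blast
next
  case (Suc S)
  then obtain g where g: "smooth_on \<Omega> g" "\<forall>M\<in>msets S. word (map Y (rep M)) g x0 = c M"
    by blast
  define T where "T = {M \<in> msets (Suc S). size M = Suc S}"
  have T: "finite T" unfolding T_def using finite_msets by simp
  define a where "a = (\<lambda>M. (c M - word (map Y (rep M)) g x0) / mfact M)"
  define g' where "g' = (\<lambda>x. g x + (\<Sum>M\<in>T. a M * monom_at M x))"
  have ss: "smooth_on \<Omega> (\<lambda>x. \<Sum>M\<in>T. a M * monom_at M x)"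
    by (intro smooth_on_sum op smooth_on_mult smooth_on_const smooth_monom_at)
  have "word (map Y (rep N)) g' x0 = c N" if N: "N \<in> msets (Suc S)" for N
  proof -
    have smb: "\<forall>Z\<in>set (map Y (rep N)). smooth_on \<Omega> Z"
      using N smooth_Y by (auto simp: msets_def)
    have "word (map Y (rep N)) (monom_at M) x0 = (if N = M then mfact M else 0)" if "M \<in> T" for M
      using word_monom_at[of "\<lambda>x. 1" "rep N" M] smooth_on_const[of \<Omega> "1::real"] N that
      by (auto simp: T_def msets_def)
    hence "(\<Sum>M\<in>T. a M * word (map Y (rep N)) (monom_at M) x0)
       = (\<Sum>M\<in>T. if N = M then a M * mfact M else 0)"
      by (intro sum.cong refl) auto
    hence "word (map Y (rep N)) g' x0
       = word (map Y (rep N)) g x0 + (\<Sum>M\<in>T. if N = M then a M * mfact M else 0)"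
      unfolding g'_def
      by (simp only: word_add[OF smb g(1) ss x0] word_sum[OF smb smooth_monom_at x0])
    also have "\<dots> = word (map Y (rep N)) g x0 + (if N \<in> T then a N * mfact N else 0)"
      using T by simp
    also have "\<dots> = c N"
    proof (cases "N \<in> T")
      case True
      then show ?thesis using mfact_pos[of N] by (simp add: a_def)
    next
      case False
      hence "N \<in> msets S" using N by (auto simp: T_def msets_def)
      then show ?thesis using g False by simp
    qed
    finally show ?thesis .
  qed
  moreover have "smooth_on \<Omega> g'" unfolding g'_def by (rule smooth_on_add[OF op g(1) ss])
  ultimately show ?case by blast
qed

text \<open>The single-letter functions \<open>dual {#b#}\<close> are privileged coordinates at \<open>x0\<close>: by
  \<open>words_vanish\<close>, all words of weight less than \<open>w b\<close> annihilate them at \<open>x0\<close>. Length \<open>Suc r\<close> is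
  that of a frame word of length \<open>r\<close> applied after one of the fields \<open>X i\<close>.\<close>

definition dual :: "'a multiset \<Rightarrow> 'a \<Rightarrow> real" where
  "dual M = (SOME g. smooth_on \<Omega> g \<and>
     (\<forall>N\<in>msets (Suc r). word (map Y (rep N)) g x0 = (if N = M then 1 else 0)))"

lemma smooth_dual: "smooth_on \<Omega> (dual M)"
  and word_dual: "N \<in> msets (Suc r) \<Longrightarrow> word (map Y (rep N)) (dual M) x0 = (if N = M then 1 else 0)"
  using someI_ex[OF interpolation[of "Suc r" "\<lambda>N. if N = M then 1 else 0"]]
  unfolding dual_def by blast+

section \<open>Taylor estimates\<close>

text \<open>The fields \<open>Y b\<close> stay close to the basis \<open>B\<close> near \<open>x0\<close>, so a functional small on all of them is
  small; the error made by replacing \<open>Y b x\<close> by \<open>b\<close> is absorbed into the left-hand side.\<close>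

lemma frame_bound:
  "\<exists>C\<ge>0. \<exists>e>0. ball x0 e \<subseteq> \<Omega> \<and> (\<forall>x\<in>ball x0 e. \<forall>L \<eta>. bounded_linear L \<longrightarrow>
     (\<forall>b\<in>B. \<bar>L (Y b x)\<bar> \<le> \<eta>) \<longrightarrow> onorm (L::'a\<Rightarrow>real) \<le> C * \<eta>)"
proof -
  define K where "K = (\<Sum>b\<in>B. onorm (lin_coord b))"
  have K0: "K \<ge> 0" unfolding K_def by (intro sum_nonneg onorm_pos_le lin_coord_bounded_linear)
  \<comment> \<open>small enough for the error term to be at most half of \<open>onorm L\<close>\<close>
  define \<kappa> where "\<kappa> = 1 / (2 * (K + 1))"
  have \<kappa>: "\<kappa> > 0" "K * \<kappa> \<le> 1 / 2" using K0 by (auto simp: \<kappa>_def field_simps)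
  have "\<exists>e>0. \<forall>x\<in>ball x0 e. x \<in> \<Omega> \<and> norm (Y b x - b) \<le> \<kappa>" if b: "b \<in> B" for b
  proof -
    have "isCont (Y b) x0"
      using smooth_on_continuous[OF smooth_Y[OF b]] op x0 continuous_on_eq_continuous_at by blast
    then obtain d where d: "d > 0" "\<And>x. dist x x0 < d \<Longrightarrow> dist (Y b x) (Y b x0) < \<kappa>"
      using \<kappa>(1) unfolding continuous_at_eps_delta by blast
    obtain d' where "d' > 0" "ball x0 d' \<subseteq> \<Omega>" using op x0 open_contains_ball by blast
    thus ?thesis using d Y_x0[OF b]
      by (intro exI[of _ "min d d'"]) (auto simp: dist_norm norm_minus_commute less_imp_le)
  qed
  then obtain e where e: "\<And>b. b \<in> B \<Longrightarrow> e b > 0"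
    "\<And>b x. b \<in> B \<Longrightarrow> x \<in> ball x0 (e b) \<Longrightarrow> norm (Y b x - b) \<le> \<kappa>" by metis
  obtain d' where d': "d' > 0" "ball x0 d' \<subseteq> \<Omega>" using op x0 open_contains_ball by blast
  define \<epsilon> where "\<epsilon> = Min (insert d' (e ` B))"
  have \<epsilon>: "\<epsilon> > 0" "\<epsilon> \<le> d'" "\<And>b. b \<in> B \<Longrightarrow> \<epsilon> \<le> e b"
    using e(1) d' finite_B by (auto simp: \<epsilon>_def)
  have "onorm L \<le> (2 * K) * \<eta>"
    if x: "x \<in> ball x0 \<epsilon>" and L: "bounded_linear L" and h: "\<forall>b\<in>B. \<bar>L (Y b x)\<bar> \<le> \<eta>" for x L \<eta>
  proof -
    have Lb: "\<bar>L b\<bar> \<le> \<eta> + onorm L * \<kappa>" if b: "b \<in> B" for b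
    proof -
      have "norm (Y b x - b) \<le> \<kappa>" using e(2)[OF b] x \<epsilon>(3)[OF b] by auto
      hence "\<bar>L (Y b x - b)\<bar> \<le> onorm L * \<kappa>"
        using onorm[OF L, of "Y b x - b"] mult_left_mono[of "norm (Y b x - b)" \<kappa> "onorm L"]
          onorm_pos_le[OF L] by simp
      moreover have "L (Y b x - b) = L (Y b x) - L b"
        by (rule linear_diff[OF bounded_linear.linear[OF L]])
      moreover have "\<bar>L (Y b x)\<bar> \<le> \<eta>" using h b by blast
      ultimately show ?thesis by linarith
    qed
    have "norm (L v) \<le> (K * (\<eta> + onorm L * \<kappa>)) * norm v" for v
    proof -
      have "L v = (\<Sum>b\<in>B. lin_coord b v * L b)"
        using arg_cong[OF lin_coord_expansion[of v], of L] bounded_linear.linear[OF L]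
        by (simp add: linear_sum linear_scale)
      also have "\<bar>\<dots>\<bar> \<le> (\<Sum>b\<in>B. \<bar>lin_coord b v\<bar> * \<bar>L b\<bar>)"
        by (rule order_trans[OF sum_abs]) (simp add: abs_mult)
      also have "\<dots> \<le> (\<Sum>b\<in>B. (onorm (lin_coord b) * norm v) * (\<eta> + onorm L * \<kappa>))"
      proof (rule sum_mono, rule mult_mono)
        fix b assume b: "b \<in> B"
        show "\<bar>lin_coord b v\<bar> \<le> onorm (lin_coord b) * norm v"
          using onorm[OF lin_coord_bounded_linear, of b v] by simp
        show "\<bar>L b\<bar> \<le> \<eta> + onorm L * \<kappa>" by (rule Lb[OF b])
      qed (simp_all add: onorm_pos_le[OF lin_coord_bounded_linear])
      also have "\<dots> = (K * (\<eta> + onorm L * \<kappa>)) * norm v"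
        unfolding K_def by (simp add: sum_distrib_left sum_distrib_right mult_ac)
      finally show ?thesis by simp
    qed
    hence "onorm L \<le> K * (\<eta> + onorm L * \<kappa>)" by (rule onorm_le)
    also have "\<dots> = K * \<eta> + (K * \<kappa>) * onorm L" by (simp add: algebra_simps)
    also have "\<dots> \<le> K * \<eta> + 1 / 2 * onorm L"
      by (intro add_left_mono mult_right_mono \<kappa> onorm_pos_le L)
    finally show ?thesis by simp
  qed
  moreover have "ball x0 \<epsilon> \<subseteq> \<Omega>" using d' \<epsilon> by (meson ball_subset_cball subset_ball subset_trans)
  ultimately show ?thesis using K0 \<epsilon>(1)
    by (intro exI[of _ "2*K"] conjI exI[of _ \<epsilon>]) auto
qed

text \<open>Taylor's formula by induction: the derivatives \<open>Y b u\<close> vanish to one order less, and they control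
  the whole differential of \<open>u\<close>.\<close>

lemma words_vanish_bound_near:
  assumes "smooth_on \<Omega> u" "\<And>bs. set bs \<subseteq> B \<Longrightarrow> length bs < k \<Longrightarrow> word (map Y bs) u x0 = 0"
  shows "\<exists>C\<ge>0. \<exists>e>0. \<forall>x\<in>ball x0 e. \<bar>u x\<bar> \<le> C * norm (x - x0) ^ k"
  using assms
proof (induction k arbitrary: u)
  case 0
  have "isCont u x0"
    using smooth_on_continuous[OF 0(1)] op x0 continuous_on_eq_continuous_at by blast
  then obtain d where d: "d > 0" "\<And>x. dist x x0 < d \<Longrightarrow> dist (u x) (u x0) < 1"
    unfolding continuous_at_eps_delta by (metis zero_less_one)
  have "\<bar>u x\<bar> \<le> (\<bar>u x0\<bar> + 1) * norm (x - x0) ^ 0" if "x \<in> ball x0 d" for x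
    using d(2)[of x] that by (auto simp: dist_norm norm_minus_commute)
  then show ?case using d(1) by (intro exI[of _ "\<bar>u x0\<bar> + 1"] conjI exI[of _ d]) auto
next
  case (Suc k)
  have "\<exists>C\<ge>0. \<exists>e>0. \<forall>x\<in>ball x0 e. \<bar>vf_apply (Y b) u x\<bar> \<le> C * norm (x - x0) ^ k" if b: "b \<in> B" for b
  proof (rule Suc.IH)
    show "smooth_on \<Omega> (vf_apply (Y b) u)" by (intro smooth_on_vf_apply op Suc.prems smooth_Y b)
    fix bs assume "set bs \<subseteq> B" "length bs < k"
    thus "word (map Y bs) (vf_apply (Y b) u) x0 = 0"
      using Suc.prems(2)[of "bs @ [b]"] b by (simp add: word_append)
  qed
  then obtain C e where Ce: "\<And>b. b \<in> B \<Longrightarrow> C b \<ge> 0" "\<And>b. b \<in> B \<Longrightarrow> e b > 0"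
    "\<And>b x. b \<in> B \<Longrightarrow> x \<in> ball x0 (e b) \<Longrightarrow> \<bar>vf_apply (Y b) u x\<bar> \<le> C b * norm (x - x0) ^ k"
    by metis
  obtain D d where D: "D \<ge> 0" "d > 0" "ball x0 d \<subseteq> \<Omega>"
    "\<And>x L \<eta>. x \<in> ball x0 d \<Longrightarrow> bounded_linear (L::'a\<Rightarrow>real) \<Longrightarrow> \<forall>b\<in>B. \<bar>L (Y b x)\<bar> \<le> \<eta> \<Longrightarrow> onorm L \<le> D * \<eta>"
    using frame_bound by blast
  define \<epsilon> where "\<epsilon> = Min (insert d (e ` B))"
  have \<epsilon>: "\<epsilon> > 0" "\<epsilon> \<le> d" "\<And>b. b \<in> B \<Longrightarrow> \<epsilon> \<le> e b"
    using Ce(2) D finite_B by (auto simp: \<epsilon>_def)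
  define C' where "C' = (\<Sum>b\<in>B. C b)"
  have C': "C' \<ge> 0" "\<And>b. b \<in> B \<Longrightarrow> C b \<le> C'"
    unfolding C'_def using Ce(1) finite_B by (auto intro: sum_nonneg member_le_sum)
  have "\<bar>u x\<bar> \<le> (D * C') * norm (x - x0) ^ Suc k" if x: "x \<in> ball x0 \<epsilon>" for x
  proof -
    define \<rho> where "\<rho> = norm (x - x0)"
    have sub: "cball x0 \<rho> \<subseteq> ball x0 \<epsilon>" using x by (auto simp: \<rho>_def dist_norm norm_minus_commute)
    have on: "onorm (frechet_derivative u (at y)) \<le> D * (C' * \<rho> ^ k)" if y: "y \<in> cball x0 \<rho>" for y
    proof (rule D(4))
      show y': "y \<in> ball x0 d" using y sub \<epsilon> by auto
      show "bounded_linear (frechet_derivative u (at y))"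
        using smooth_on_has_derivative[OF Suc.prems(1)] y' D(3) has_derivative_bounded_linear by blast
      show "\<forall>b\<in>B. \<bar>frechet_derivative u (at y) (Y b y)\<bar> \<le> C' * \<rho> ^ k"
      proof
        fix b assume b: "b \<in> B"
        have "y \<in> ball x0 (e b)" using y sub \<epsilon>(3)[OF b] by auto
        hence "\<bar>vf_apply (Y b) u y\<bar> \<le> C b * norm (y - x0) ^ k" by (rule Ce(3)[OF b])
        also have "\<dots> \<le> C' * \<rho> ^ k"
          using C' b Ce(1)[OF b] y by (intro mult_mono power_mono) (auto simp: dist_norm norm_minus_commute)
        finally show "\<bar>frechet_derivative u (at y) (Y b y)\<bar> \<le> C' * \<rho> ^ k" by (simp add: vf_apply_def)
      qed
    qed
    have sub2: "cball x0 \<rho> \<subseteq> \<Omega>" using sub subset_ball[OF \<epsilon>(2)] D(3) by (meson subset_trans)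
    have "norm (u x - u x0) \<le> D * (C' * \<rho> ^ k) * norm (x - x0)"
    proof (rule differentiable_bound[OF convex_cball _ on])
      fix y assume "y \<in> cball x0 \<rho>"
      thus "(u has_derivative frechet_derivative u (at y)) (at y within cball x0 \<rho>)"
        using smooth_on_has_derivative[OF Suc.prems(1)] sub2 has_derivative_at_withinI by blast
    qed (auto simp: \<rho>_def dist_norm norm_minus_commute)
    moreover have "u x0 = 0" using Suc.prems(2)[of "[]"] by simp
    ultimately show ?thesis by (simp add: \<rho>_def mult_ac)
  qed
  then show ?case using \<epsilon>(1) D(1) C'(1) by (intro exI[of _ "D * C'"] conjI exI[of _ \<epsilon>]) auto
qed

lemma words_vanish_bound:
  assumes u: "smooth_on \<Omega> u" "\<And>bs. set bs \<subseteq> B \<Longrightarrow> length bs < k \<Longrightarrow> word (map Y bs) u x0 = 0"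
    and K: "compact K" "K \<subseteq> \<Omega>"
  shows "\<exists>C\<ge>0. \<forall>x\<in>K. \<bar>u x\<bar> \<le> C * norm (x - x0) ^ k"
proof -
  obtain C e where C: "C \<ge> 0" "e > 0" "\<And>x. x \<in> ball x0 e \<Longrightarrow> \<bar>u x\<bar> \<le> C * norm (x - x0) ^ k"
    using words_vanish_bound_near[OF u] by blast
  have "compact (u ` K)"
    using K smooth_on_continuous[OF u(1)] continuous_on_subset compact_continuous_image by blast
  then obtain A where A: "\<And>x. x \<in> K \<Longrightarrow> \<bar>u x\<bar> \<le> A" "A > 0"
    using compact_imp_bounded bounded_pos by (metis imageI real_norm_def)
  have "\<bar>u x\<bar> \<le> max C (A / e ^ k) * norm (x - x0) ^ k" if x: "x \<in> K" for x
  proof (cases "x \<in> ball x0 e")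
    case True
    have "C * norm (x - x0) ^ k \<le> max C (A / e ^ k) * norm (x - x0) ^ k"
      by (intro mult_right_mono) auto
    then show ?thesis using C(3)[OF True] by linarith
  next
    case False
    hence "e ^ k \<le> norm (x - x0) ^ k"
      using C(2) by (intro power_mono) (auto simp: dist_norm norm_minus_commute)
    hence "A \<le> (A / e ^ k) * norm (x - x0) ^ k"
      using C(2) A(2) by (simp add: field_simps)
    also have "\<dots> \<le> max C (A / e ^ k) * norm (x - x0) ^ k"
      by (intro mult_right_mono) auto
    finally show ?thesis using A(1)[OF x] by linarith
  qed
  thus ?thesis using C(1) by (intro exI[of _ "max C (A / e ^ k)"]) auto
qed

text \<open>The frame words of \<open>X i (dual M)\<close> are its coefficients in the dual functions up to an error of
  order \<open>r\<close>. The word for \<open>N\<close> applied after \<open>X i\<close> has weight \<open>wt N + 1\<close>, so it annihilates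
  \<open>dual M\<close> at \<open>x0\<close> as long as this is less than \<open>wt M\<close>.\<close>

lemma vf_apply_dual_bound:
  assumes i: "i \<in> {1..n}" and M: "M \<in> msets r" and K: "compact K" "K \<subseteq> \<Omega>"
  shows "\<exists>c C. C \<ge> 0 \<and> (\<forall>N\<in>msets r. c N \<noteq> 0 \<longrightarrow> wt M \<le> Suc (wt N)) \<and>
    (\<forall>x\<in>K. \<bar>vf_apply (X i) (dual M) x\<bar>
       \<le> (\<Sum>N\<in>msets r. \<bar>c N\<bar> * \<bar>dual N x\<bar>) + C * norm (x - x0) ^ r)"
proof -
  define g where "g = vf_apply (X i) (dual M)"
  have g: "smooth_on \<Omega> g" unfolding g_def by (intro smooth_on_vf_apply op smooth_dual smooth_X i)
  define c where "c = (\<lambda>N. word (map Y (rep N)) g x0)"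
  have c0: "c N = 0" if N: "N \<in> msets r" and lt: "Suc (wt N) < wt M" for N
  proof -
    let ?zs = "map (\<lambda>b. (w b, Y b)) (rep N) @ [(1, X i)]"
    have "word (map snd ?zs) (dual M) x0 = 0"
    proof (rule words_vanish[OF smooth_dual, of "Suc r" "wt M - 1"])
      fix M' assume "M' \<in> msets (Suc r)" "wt M' \<le> wt M - 1"
      moreover have "M' \<noteq> M" using calculation lt by auto
      ultimately show "word (map Y (rep M')) (dual M) x0 = 0" using word_dual by simp
    next
      show "\<forall>(l, Z)\<in>set ?zs. filt l Z"
        using N filt_Y filt_field[OF i] by (auto simp: msets_def)
      show "length ?zs \<le> Suc r" using N by (simp add: msets_def)
      have "sum_list (map fst (map (\<lambda>b. (w b, Y b)) (rep N))) = wt N"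
        unfolding wt_def by (simp add: o_def flip: sum_mset_sum_list)
      thus "sum_list (map fst ?zs) \<le> wt M - 1" using lt by simp
    qed
    thus ?thesis by (simp add: c_def g_def word_append o_def)
  qed
  define h where "h = (\<lambda>x. g x - (\<Sum>N\<in>msets r. c N * dual N x))"
  have sd: "smooth_on \<Omega> (\<lambda>x. \<Sum>N\<in>msets r. c N * dual N x)"
    by (intro smooth_on_sum op smooth_on_mult smooth_on_const smooth_dual)
  have h: "smooth_on \<Omega> h" unfolding h_def by (rule smooth_on_diff[OF op g sd])
  have h0: "word (map Y (rep N)) h x0 = 0" if N: "N \<in> msets r" for N
  proof -
    have smb: "\<forall>Z\<in>set (map Y (rep N)). smooth_on \<Omega> Z"
      using N smooth_Y by (auto simp: msets_def)
    have "N \<in> msets (Suc r)" using N by (simp add: msets_def)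
    hence "(\<Sum>N'\<in>msets r. c N' * word (map Y (rep N)) (dual N') x0)
        = (\<Sum>N'\<in>msets r. if N = N' then c N' else 0)"
      by (intro sum.cong refl) (simp add: word_dual)
    moreover have "word (map Y (rep N)) g x0 = c N" by (simp add: c_def)
    ultimately have "word (map Y (rep N)) h x0 = c N - (\<Sum>N'\<in>msets r. if N = N' then c N' else 0)"
      unfolding h_def
      by (simp only: word_diff[OF smb g sd x0] word_sum[OF smb smooth_dual x0])
    also have "\<dots> = 0" using N finite_msets by simp
    finally show ?thesis .
  qed
  have "word (map Y bs) h x0 = 0" if bs: "set bs \<subseteq> B" "length bs < r" for bs
  proof -
    let ?zs = "map (\<lambda>b. (w b, Y b)) bs"
    have "word (map snd ?zs) h x0 = 0"
      by (rule words_vanish[OF h h0, of r "sum_list (map fst ?zs)"]) (use bs filt_Y in auto)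
    thus ?thesis by (simp add: o_def)
  qed
  from words_vanish_bound[OF h this K] obtain C where C: "C \<ge> 0"
    "\<And>x. x \<in> K \<Longrightarrow> \<bar>h x\<bar> \<le> C * norm (x - x0) ^ r" by blast
  have "\<bar>g x\<bar> \<le> (\<Sum>N\<in>msets r. \<bar>c N\<bar> * \<bar>dual N x\<bar>) + C * norm (x - x0) ^ r" if x: "x \<in> K" for x
  proof -
    have "g x = (\<Sum>N\<in>msets r. c N * dual N x) + h x" by (simp add: h_def)
    moreover have "\<bar>\<Sum>N\<in>msets r. c N * dual N x\<bar> \<le> (\<Sum>N\<in>msets r. \<bar>c N\<bar> * \<bar>dual N x\<bar>)"
      by (rule order_trans[OF sum_abs]) (simp add: abs_mult)
    ultimately show ?thesis using C(2)[OF x] by linarith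
  qed
  thus ?thesis using C(1) c0 unfolding g_def by (intro exI[of _ c] exI[of _ C]) force
qed

end


section \<open>Existence of adapted frames\<close>

lemma flag_basis:
  fixes V :: "nat \<Rightarrow> 'a::euclidean_space set"
  assumes "\<And>j. V j \<subseteq> V (Suc j)"
  shows "\<exists>B. B \<subseteq> V m \<and> independent B \<and> (\<forall>j\<le>m. V j \<subseteq> span (B \<inter> V j))"
proof (induction m)
  case 0
  obtain B where "B \<subseteq> V 0" "independent B" "V 0 \<subseteq> span B"
    using maximal_independent_subset by blast
  then show ?case by (intro exI[of _ B]) (auto simp: Int_absorb2)
next
  case (Suc m)
  then obtain B where B: "B \<subseteq> V m" "independent B" "\<forall>j\<le>m. V j \<subseteq> span (B \<inter> V j)" by blast
  have "B \<subseteq> V (Suc m)" using B assms by blast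
  then obtain B' where B': "B \<subseteq> B'" "B' \<subseteq> V (Suc m)" "independent B'" "V (Suc m) \<subseteq> span B'"
    using maximal_independent_subset_extend[OF _ B(2)] by blast
  have "V j \<subseteq> span (B' \<inter> V j)" if "j \<le> Suc m" for j
  proof (cases "j \<le> m")
    case True
    have "span (B \<inter> V j) \<subseteq> span (B' \<inter> V j)" using B' by (intro span_mono) auto
    then show ?thesis using B(3) True by blast
  next
    case False
    hence "j = Suc m" using that by simp
    then show ?thesis using B' by (simp add: Int_absorb2)
  qed
  then show ?case using B' by blast
qed

context smooth_fields
begin

lemma commutator_length_pos: "commutator n X k Z \<Longrightarrow> 1 \<le> k"
  by (induction rule: commutator.induct) auto

lemma commutator_span_0: "commutator_span n X 0 x = {0}"
proof -
  have "{Y x |Y k. k \<le> 0 \<and> commutator n X k Y} = {}"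
    using commutator_length_pos by force
  thus ?thesis by (simp add: commutator_span_def)
qed

lemma commutator_span_mono: "j \<le> k \<Longrightarrow> commutator_span n X j x \<subseteq> commutator_span n X k x"
  unfolding commutator_span_def by (intro span_mono) (use le_trans in blast)

text \<open>The weight of a basis vector is the first step of the flag that contains it, so
  \<open>dim V\<^sub>j - dim V\<^sub>j\<^sub>-\<^sub>1\<close> counts the vectors of weight \<open>j\<close> and the weights add up to \<open>Q(x0)\<close>.\<close>

lemma adapted_frame_exists:
  assumes x0: "x0 \<in> \<Omega>" and full: "commutator_span n X r x0 = UNIV"
  shows "\<exists>B w Y. adapted_frame n X \<Omega> x0 r B w Y \<and>
    real (\<Sum>b\<in>B. w b) = nonisotropic_dim_at n X r x0"
proof -
  define V where "V = (\<lambda>j. commutator_span n X j x0)"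
  have Vm: "j \<le> k \<Longrightarrow> V j \<subseteq> V k" for j k
    unfolding V_def by (rule commutator_span_mono)
  obtain B where B: "independent B" "\<forall>j\<le>r. V j \<subseteq> span (B \<inter> V j)"
    using flag_basis[of V r] Vm by (metis lessI less_imp_le)
  have finB: "finite B" using B(1) independent_bound_general by blast
  have Vr: "V r = UNIV" using full by (simp add: V_def)
  have "V r \<subseteq> span (B \<inter> V r)" using B(2) by blast
  hence spB: "span B = UNIV" using Vr by auto
  define w where "w = (\<lambda>b. LEAST j. b \<in> V j)"
  have wV: "b \<in> V (w b)" for b
    unfolding w_def by (rule LeastI[of _ r]) (simp add: Vr)
  have wle: "w b \<le> j \<longleftrightarrow> b \<in> V j" for b j
    using wV Vm Least_le[of "\<lambda>j. b \<in> V j"] unfolding w_def by blast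
  have w1: "1 \<le> w b" if "b \<in> B" for b
  proof (rule ccontr)
    assume "\<not> 1 \<le> w b"
    hence "w b = 0" by simp
    hence "b \<in> V 0" using wV[of b] by simp
    hence "b = 0" by (simp add: V_def commutator_span_0)
    thus False using that B(1) dependent_zero by blast
  qed
  have "\<exists>Z. filt (w b) Z \<and> Z x0 = b" for b
    using commutator_span_filt wV unfolding V_def by blast
  then obtain Y where Y: "\<And>b. filt (w b) (Y b)" "\<And>b. Y b x0 = b" by metis
  have "Z x0 \<in> span {b \<in> B. w b \<le> l}" if "filt l Z" for l Z
  proof (cases "l \<le> r")
    case True
    have "Z x0 \<in> V l" using filt_value[OF that x0] by (simp add: V_def)
    hence "Z x0 \<in> span (B \<inter> V l)" using B(2) True by blast
    moreover have "B \<inter> V l = {b \<in> B. w b \<le> l}" using wle by blast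
    ultimately show ?thesis by simp
  next
    case False
    hence "{b \<in> B. w b \<le> l} = B" using wle Vr Vm[of r l] by auto
    then show ?thesis using spB by simp
  qed
  hence frame: "adapted_frame n X \<Omega> x0 r B w Y"
    using x0 B(1) spB w1 wle Vr Y by unfold_locales auto
  have dimV: "dim (V j) = card {b \<in> B. w b \<le> j}" if "j \<le> r" for j
  proof (rule dim_unique)
    show "{b \<in> B. w b \<le> j} \<subseteq> V j" using wle by blast
    have "B \<inter> V j = {b \<in> B. w b \<le> j}" using wle by blast
    thus "V j \<subseteq> span {b \<in> B. w b \<le> j}" using B(2) that by metis
    show "independent {b \<in> B. w b \<le> j}" by (rule independent_mono[OF B(1)]) auto
  qed auto
  have diff: "real (dim (V j)) - real (dim (V (j - 1))) = card {b \<in> B. w b = j}"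
    if j: "j \<in> {1..r}" for j
  proof -
    have "{b \<in> B. w b \<le> j} = {b \<in> B. w b \<le> j - 1} \<union> {b \<in> B. w b = j}" using j by auto
    moreover have "card ({b \<in> B. w b \<le> j - 1} \<union> {b \<in> B. w b = j})
        = card {b \<in> B. w b \<le> j - 1} + card {b \<in> B. w b = j}"
      using finB j by (intro card_Un_disjoint) auto
    ultimately have "card {b \<in> B. w b \<le> j} = card {b \<in> B. w b \<le> j - 1} + card {b \<in> B. w b = j}"
      by simp
    moreover have "j \<le> r" "j - 1 \<le> r" using j by auto
    ultimately show ?thesis using dimV[of j] dimV[of "j - 1"] by simp
  qed
  have "(\<Sum>b\<in>B. w b) = (\<Sum>j=1..r. \<Sum>b\<in>{b\<in>B. w b = j}. w b)"
    using w1 wle Vr finB by (intro sum.group[symmetric]) auto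
  also have "\<dots> = (\<Sum>j=1..r. j * card {b \<in> B. w b = j})"
    by (intro sum.cong) (auto simp: mult.commute)
  finally have "real (\<Sum>b\<in>B. w b) = (\<Sum>j=1..r. real j * card {b \<in> B. w b = j})" by simp
  also have "\<dots> = nonisotropic_dim_at n X r x0"
    unfolding nonisotropic_dim_at_def using diff by (intro sum.cong) (auto simp: V_def)
  finally show ?thesis using frame by blast
qed

end

section \<open>The gauge\<close>

context adapted_frame
begin

lemma B_nonempty: "B \<noteq> {}"
proof
  assume "B = {}"
  hence "(UNIV :: 'a set) = {0}" using span_B by simp
  thus False by (metis UNIV_I SOME_Basis nonzero_Basis singletonD)
qed

lemma r_pos: "1 \<le> r"
  using B_nonempty w_pos w_le le_trans by blast

text \<open>The Taylor errors are of order \<open>r\<close> only, so no function may be rescaled by more than \<open>\<delta> ^ r\<close>.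
  The cap leaves the weights of the coordinates unchanged.\<close>

definition capped_wt :: "'a multiset \<Rightarrow> nat" where
  "capped_wt M = min (wt M) r"

text \<open>A smooth substitute for powers of the control distance to \<open>x0\<close>, rescaled by \<open>\<delta>\<close>. The last
  term dominates the Taylor errors, and it makes the gauge so large away from \<open>x0\<close> that its negative
  powers serve as cutoff functions.\<close>

definition gauge :: "real \<Rightarrow> 'a \<Rightarrow> real" where
  "gauge \<delta> x = 1 + (\<Sum>M\<in>msets r. (dual M x / \<delta> ^ capped_wt M)\<^sup>2) + (((x - x0) \<bullet> (x - x0)) / \<delta>\<^sup>2) ^ r"

lemma gauge_parts:
  shows gauge_ge_1: "1 \<le> gauge \<delta> x"
    and gauge_ge_dual: "M \<in> msets r \<Longrightarrow> (dual M x / \<delta> ^ capped_wt M)\<^sup>2 \<le> gauge \<delta> x"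
    and gauge_ge_norm: "(norm (x - x0) / \<delta>) ^ (2 * r) \<le> gauge \<delta> x"
proof -
  have s: "0 \<le> (\<Sum>M\<in>msets r. (dual M x / \<delta> ^ capped_wt M)\<^sup>2)" by (intro sum_nonneg) auto
  have q: "(((x - x0) \<bullet> (x - x0)) / \<delta>\<^sup>2) ^ r = (norm (x - x0) / \<delta>) ^ (2 * r)"
    by (simp add: power_mult power_divide flip: power2_norm_eq_inner)
  have q0: "0 \<le> (norm (x - x0) / \<delta>) ^ (2 * r)" by (simp add: power_mult)
  show "1 \<le> gauge \<delta> x" "(norm (x - x0) / \<delta>) ^ (2 * r) \<le> gauge \<delta> x"
    using s q q0 by (auto simp: gauge_def)
  show "(dual M x / \<delta> ^ capped_wt M)\<^sup>2 \<le> gauge \<delta> x" if "M \<in> msets r"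
  proof -
    have "(dual M x / \<delta> ^ capped_wt M)\<^sup>2 \<le> (\<Sum>M\<in>msets r. (dual M x / \<delta> ^ capped_wt M)\<^sup>2)"
      using that by (intro member_le_sum finite_msets) auto
    thus ?thesis unfolding gauge_def q using q0 by linarith
  qed
qed

lemma dual_le_gauge:
  assumes "M \<in> msets r" "\<delta> > 0"
  shows "\<bar>dual M x\<bar> / \<delta> ^ capped_wt M \<le> sqrt (gauge \<delta> x)"
  using real_sqrt_le_mono[OF gauge_ge_dual[OF assms(1), of x \<delta>]] assms(2)
  by (simp add: abs_divide)

lemma norm_le_gauge:
  assumes "\<delta> > 0"
  shows "(norm (x - x0) / \<delta>) ^ r \<le> sqrt (gauge \<delta> x)"
proof (rule real_le_rsqrt)
  show "((norm (x - x0) / \<delta>) ^ r)\<^sup>2 \<le> gauge \<delta> x"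
    using gauge_ge_norm[of x \<delta>] by (simp add: power_mult mult.commute flip: power_mult)
qed

lemma smooth_sqdist: "smooth_on \<Omega> (\<lambda>x. (x - x0) \<bullet> (x - x0))"
  by (intro smooth_on_bilinear[OF op bounded_bilinear_inner] smooth_on_diff[OF op]
      smooth_on_linear[OF op bounded_linear_ident] smooth_on_const)

lemma smooth_gauge: "smooth_on \<Omega> (gauge \<delta>)"
proof -
  have "smooth_on \<Omega> (\<lambda>x. 1 + (\<Sum>M\<in>msets r. (inverse (\<delta> ^ capped_wt M) * dual M x) ^ 2)
    + (inverse (\<delta>\<^sup>2) * ((x - x0) \<bullet> (x - x0))) ^ r)"
    by (intro smooth_on_add smooth_on_sum smooth_on_power smooth_on_mult smooth_on_const
        smooth_dual smooth_sqdist op)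
  moreover have "gauge \<delta> = (\<lambda>x. 1 + (\<Sum>M\<in>msets r. (inverse (\<delta> ^ capped_wt M) * dual M x) ^ 2)
    + (inverse (\<delta>\<^sup>2) * ((x - x0) \<bullet> (x - x0))) ^ r)"
    by (rule ext) (simp add: gauge_def divide_inverse mult.commute)
  ultimately show ?thesis by simp
qed

lemma vf_apply_gauge:
  assumes x: "x \<in> \<Omega>"
  shows "vf_apply Z (gauge \<delta>) x
    = (\<Sum>M\<in>msets r. 2 * (dual M x / \<delta> ^ capped_wt M) * (vf_apply Z (dual M) x / \<delta> ^ capped_wt M))
      + r * (((x - x0) \<bullet> (x - x0)) / \<delta>\<^sup>2) ^ (r - 1) * (2 * ((x - x0) \<bullet> Z x) / \<delta>\<^sup>2)"
proof (rule vf_apply_eqI[where f' = "\<lambda>v. (\<Sum>M\<in>msets r. 2 * (dual M x / \<delta> ^ capped_wt M)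
        * (frechet_derivative (dual M) (at x) v / \<delta> ^ capped_wt M))
      + r * (((x - x0) \<bullet> (x - x0)) / \<delta>\<^sup>2) ^ (r - 1) * (2 * ((x - x0) \<bullet> v) / \<delta>\<^sup>2)",
      THEN trans], goal_cases)
  case 1
  have d: "(dual M has_derivative frechet_derivative (dual M) (at x)) (at x)" for M
    by (rule smooth_on_has_derivative[OF smooth_dual x])
  have t1: "((\<lambda>x. (dual M x / \<delta> ^ capped_wt M)\<^sup>2) has_derivative
    (\<lambda>v. 2 * (dual M x / \<delta> ^ capped_wt M) * (frechet_derivative (dual M) (at x) v / \<delta> ^ capped_wt M))) (at x)" for M
  proof -
    have h: "((\<lambda>x. dual M x / \<delta> ^ capped_wt M) has_derivative (\<lambda>v. frechet_derivative (dual M) (at x) v / \<delta> ^ capped_wt M)) (at x)"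
      by (rule bounded_linear.has_derivative[OF bounded_linear_divide d])
    show ?thesis
      by (rule has_derivative_eq_rhs[OF has_derivative_power[OF h, of 2]])
         (auto simp: fun_eq_iff)
  qed
  have t2: "((\<lambda>x. (((x - x0) \<bullet> (x - x0)) / \<delta>\<^sup>2) ^ r) has_derivative
    (\<lambda>v. r * (((x - x0) \<bullet> (x - x0)) / \<delta>\<^sup>2) ^ (r - 1) * (2 * ((x - x0) \<bullet> v) / \<delta>\<^sup>2))) (at x)"
  proof -
    have "((\<lambda>x. (x - x0) \<bullet> (x - x0)) has_derivative (\<lambda>v. 2 * ((x - x0) \<bullet> v))) (at x)"
      by (rule has_derivative_eq_rhs[OF has_derivative_inner[of "\<lambda>x. x - x0" "\<lambda>v. v" x UNIV "\<lambda>x. x - x0" "\<lambda>v. v"]])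
         (auto intro!: derivative_eq_intros simp: inner_commute fun_eq_iff)
    from bounded_linear.has_derivative[OF bounded_linear_divide[of "\<delta>\<^sup>2"] this]
    have h: "((\<lambda>x. ((x - x0) \<bullet> (x - x0)) / \<delta>\<^sup>2) has_derivative (\<lambda>v. 2 * ((x - x0) \<bullet> v) / \<delta>\<^sup>2)) (at x)" .
    show ?thesis
      by (rule has_derivative_eq_rhs[OF has_derivative_power[OF h, of r]])
         (auto simp: fun_eq_iff)
  qed
  have "(gauge \<delta> has_derivative (\<lambda>v. 0 + (\<Sum>M\<in>msets r. 2 * (dual M x / \<delta> ^ capped_wt M)
        * (frechet_derivative (dual M) (at x) v / \<delta> ^ capped_wt M))
      + r * (((x - x0) \<bullet> (x - x0)) / \<delta>\<^sup>2) ^ (r - 1) * (2 * ((x - x0) \<bullet> v) / \<delta>\<^sup>2))) (at x)"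
    unfolding gauge_def[abs_def]
    by (intro has_derivative_add has_derivative_const has_derivative_sum t1 t2)
  then show ?case by simp
next
  case 2
  then show ?case by (simp add: vf_apply_def)
qed

text \<open>By \<open>vf_apply_dual_bound\<close>, \<open>X i\<close> maps the rescaled dual functions to combinations of rescaled dual
  functions, at the cost of one factor \<open>1 / \<delta>\<close>.\<close>

lemma gauge_gradient_field:
  assumes i: "i \<in> {1..n}" and K: "compact K" "K \<subseteq> \<Omega>"
  shows "\<exists>C\<ge>0. \<forall>\<delta> x. 0 < \<delta> \<longrightarrow> \<delta> \<le> 1 \<longrightarrow> x \<in> K \<longrightarrow>
    \<bar>vf_apply (X i) (gauge \<delta>) x\<bar> \<le> C / \<delta> * gauge \<delta> x"
proof -
  have "\<exists>D\<ge>0. \<forall>\<delta> x. 0 < \<delta> \<longrightarrow> \<delta> \<le> 1 \<longrightarrow> x \<in> K \<longrightarrow>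
    \<bar>vf_apply (X i) (dual M) x\<bar> / \<delta> ^ capped_wt M \<le> D / \<delta> * sqrt (gauge \<delta> x)" if M: "M \<in> msets r" for M
  proof -
    obtain c C where C: "C \<ge> 0" "\<And>N. N \<in> msets r \<Longrightarrow> c N \<noteq> 0 \<Longrightarrow> wt M \<le> Suc (wt N)"
      "\<And>x. x \<in> K \<Longrightarrow> \<bar>vf_apply (X i) (dual M) x\<bar>
         \<le> (\<Sum>N\<in>msets r. \<bar>c N\<bar> * \<bar>dual N x\<bar>) + C * norm (x - x0) ^ r"
      using vf_apply_dual_bound[OF i M K] by blast
    define D where "D = (\<Sum>N\<in>msets r. \<bar>c N\<bar>) + C"
    have "\<bar>vf_apply (X i) (dual M) x\<bar> / \<delta> ^ capped_wt M \<le> D / \<delta> * sqrt (gauge \<delta> x)"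
      if \<delta>: "0 < \<delta>" "\<delta> \<le> 1" and x: "x \<in> K" for \<delta> x
    proof -
      define s where "s = sqrt (gauge \<delta> x)"
      have pw: "1 / \<delta> ^ a \<le> 1 / \<delta> ^ b" if "a \<le> b" for a b :: nat
        using \<delta> that by (intro divide_left_mono power_decreasing) auto
      have t: "\<bar>c N\<bar> * \<bar>dual N x\<bar> / \<delta> ^ capped_wt M \<le> \<bar>c N\<bar> * (s / \<delta>)" if N: "N \<in> msets r" for N
      proof (cases "c N = 0")
        case False
        hence le: "capped_wt M \<le> Suc (capped_wt N)" using C(2)[OF N] by (auto simp: capped_wt_def)
        have "\<bar>dual N x\<bar> / \<delta> ^ capped_wt M \<le> \<bar>dual N x\<bar> / \<delta> ^ Suc (capped_wt N)"
          using mult_left_mono[OF pw[OF le], of "\<bar>dual N x\<bar>"] by simp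
        also have "\<dots> = (\<bar>dual N x\<bar> / \<delta> ^ capped_wt N) / \<delta>" by simp
        also have "\<dots> \<le> s / \<delta>"
          using dual_le_gauge[OF N \<delta>(1), of x] \<delta> unfolding s_def by (intro divide_right_mono) auto
        finally have "\<bar>c N\<bar> * (\<bar>dual N x\<bar> / \<delta> ^ capped_wt M) \<le> \<bar>c N\<bar> * (s / \<delta>)"
          by (intro mult_left_mono) auto
        then show ?thesis by simp
      qed simp
      have le: "capped_wt M \<le> Suc r" by (simp add: capped_wt_def)
      have "C * norm (x - x0) ^ r / \<delta> ^ capped_wt M \<le> C * norm (x - x0) ^ r / \<delta> ^ Suc r"
        using mult_left_mono[OF pw[OF le], of "C * norm (x - x0) ^ r"] C(1) by simp
      also have "\<dots> = C * ((norm (x - x0) / \<delta>) ^ r / \<delta>)" by (simp add: power_divide)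
      also have "\<dots> \<le> C * (s / \<delta>)"
        using norm_le_gauge[OF \<delta>(1), of x] \<delta> C(1) unfolding s_def
        by (intro mult_left_mono divide_right_mono) auto
      finally have t': "C * norm (x - x0) ^ r / \<delta> ^ capped_wt M \<le> C * (s / \<delta>)" .
      have "\<bar>vf_apply (X i) (dual M) x\<bar> / \<delta> ^ capped_wt M
        \<le> ((\<Sum>N\<in>msets r. \<bar>c N\<bar> * \<bar>dual N x\<bar>) + C * norm (x - x0) ^ r) / \<delta> ^ capped_wt M"
        using C(3)[OF x] \<delta> by (intro divide_right_mono) auto
      also have "\<dots> = (\<Sum>N\<in>msets r. \<bar>c N\<bar> * \<bar>dual N x\<bar> / \<delta> ^ capped_wt M) + C * norm (x - x0) ^ r / \<delta> ^ capped_wt M"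
        by (simp add: add_divide_distrib sum_divide_distrib)
      also have "\<dots> \<le> (\<Sum>N\<in>msets r. \<bar>c N\<bar> * (s / \<delta>)) + C * (s / \<delta>)"
        by (intro add_mono sum_mono t t')
      also have "\<dots> = D / \<delta> * s"
        unfolding D_def sum_distrib_right[symmetric] by (simp add: distrib_right add_divide_distrib)
      finally show ?thesis by (simp add: s_def)
    qed
    moreover have "D \<ge> 0" unfolding D_def using C(1) by (intro add_nonneg_nonneg sum_nonneg) auto
    ultimately show ?thesis by blast
  qed
  then obtain D where D: "\<And>M. M \<in> msets r \<Longrightarrow> D M \<ge> 0"
    "\<And>M \<delta> x. M \<in> msets r \<Longrightarrow> 0 < \<delta> \<Longrightarrow> \<delta> \<le> 1 \<Longrightarrow> x \<in> K \<Longrightarrow>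
      \<bar>vf_apply (X i) (dual M) x\<bar> / \<delta> ^ capped_wt M \<le> D M / \<delta> * sqrt (gauge \<delta> x)"
    by metis
  have "compact (X i ` K)"
    using K smooth_on_continuous[OF smooth_X[OF i]] continuous_on_subset compact_continuous_image by blast
  then obtain A where A: "\<And>x. x \<in> K \<Longrightarrow> norm (X i x) \<le> A" "A > 0"
    using compact_imp_bounded bounded_pos by (metis imageI)
  define C where "C = (\<Sum>M\<in>msets r. 2 * D M) + 2 * r * A"
  have "\<bar>vf_apply (X i) (gauge \<delta>) x\<bar> \<le> C / \<delta> * gauge \<delta> x"
    if \<delta>: "0 < \<delta>" "\<delta> \<le> 1" and x: "x \<in> K" for \<delta> x
  proof -
    define g where "g = gauge \<delta> x"
    have g1: "g \<ge> 1" using gauge_ge_1 by (simp add: g_def)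
    have ss: "sqrt g * sqrt g = g" using g1 by simp
    define t where "t = norm (x - x0) / \<delta>"
    have t0: "t \<ge> 0" using \<delta> by (simp add: t_def)
    have a1: "\<bar>2 * (dual M x / \<delta> ^ capped_wt M) * (vf_apply (X i) (dual M) x / \<delta> ^ capped_wt M)\<bar> \<le> 2 * D M * (g / \<delta>)"
      if M: "M \<in> msets r" for M
    proof -
      have "\<bar>2 * (dual M x / \<delta> ^ capped_wt M) * (vf_apply (X i) (dual M) x / \<delta> ^ capped_wt M)\<bar>
        = 2 * ((\<bar>dual M x\<bar> / \<delta> ^ capped_wt M) * (\<bar>vf_apply (X i) (dual M) x\<bar> / \<delta> ^ capped_wt M))"
        using \<delta> by (simp add: abs_mult)
      also have "\<dots> \<le> 2 * (sqrt g * (D M / \<delta> * sqrt g))"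
        using dual_le_gauge[OF M \<delta>(1), of x] D(2)[OF M \<delta> x] \<delta> g1 unfolding g_def
        by (intro mult_left_mono mult_mono) auto
      also have "\<dots> = 2 * D M * (sqrt g * sqrt g / \<delta>)" by (simp add: field_simps del: real_sqrt_mult_self)
      finally show ?thesis unfolding ss .
    qed
    have q: "((x - x0) \<bullet> (x - x0)) / \<delta>\<^sup>2 = t\<^sup>2"
      by (simp add: t_def power_divide flip: power2_norm_eq_inner)
    have tp: "t ^ (2 * r - 1) \<le> g"
    proof (cases "t \<le> 1")
      case True
      hence "t ^ (2 * r - 1) \<le> 1" using t0 by (intro power_le_one) auto
      then show ?thesis using g1 by linarith
    next
      case False
      hence "t ^ (2 * r - 1) \<le> t ^ (2 * r)" by (intro power_increasing) auto
      then show ?thesis using gauge_ge_norm[of x \<delta>] by (simp add: g_def t_def)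
    qed
    have a2: "\<bar>r * (t\<^sup>2) ^ (r - 1) * (2 * ((x - x0) \<bullet> X i x) / \<delta>\<^sup>2)\<bar> \<le> 2 * r * A * (g / \<delta>)"
    proof -
      have "\<bar>(x - x0) \<bullet> X i x\<bar> \<le> norm (x - x0) * A"
        using Cauchy_Schwarz_ineq2[of "x - x0" "X i x"] mult_left_mono[OF A(1)[OF x], of "norm (x - x0)"]
        by simp
      also have "\<dots> = t * \<delta> * A" using \<delta> by (simp add: t_def)
      finally have cs: "\<bar>(x - x0) \<bullet> X i x\<bar> \<le> t * \<delta> * A" .
      have "\<bar>r * (t\<^sup>2) ^ (r - 1) * (2 * ((x - x0) \<bullet> X i x) / \<delta>\<^sup>2)\<bar>
        = (2 * r * (t\<^sup>2) ^ (r - 1) / \<delta>\<^sup>2) * \<bar>(x - x0) \<bullet> X i x\<bar>"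
        by (simp add: abs_mult)
      also have "\<dots> \<le> (2 * r * (t\<^sup>2) ^ (r - 1) / \<delta>\<^sup>2) * (t * \<delta> * A)"
        by (intro mult_left_mono cs) auto
      also have "\<dots> = 2 * r * A * ((t * (t\<^sup>2) ^ (r - 1)) / \<delta>)"
        using \<delta> by (simp add: field_simps power2_eq_square)
      also have "t * (t\<^sup>2) ^ (r - 1) = t ^ (2 * r - 1)"
      proof -
        have "2 * r - 1 = Suc (2 * (r - 1))" using r_pos by simp
        thus ?thesis by (simp add: power_mult)
      qed
      also have "2 * r * A * (t ^ (2 * r - 1) / \<delta>) \<le> 2 * r * A * (g / \<delta>)"
        using tp \<delta> A(2) by (intro mult_left_mono divide_right_mono) auto
      finally show ?thesis .
    qed
    have xO: "x \<in> \<Omega>" using x K by blast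
    have "\<bar>vf_apply (X i) (gauge \<delta>) x\<bar>
      \<le> \<bar>\<Sum>M\<in>msets r. 2 * (dual M x / \<delta> ^ capped_wt M) * (vf_apply (X i) (dual M) x / \<delta> ^ capped_wt M)\<bar>
        + \<bar>r * (t\<^sup>2) ^ (r - 1) * (2 * ((x - x0) \<bullet> X i x) / \<delta>\<^sup>2)\<bar>"
      unfolding vf_apply_gauge[OF xO] q by (rule abs_triangle_ineq)
    also have "\<dots> \<le> (\<Sum>M\<in>msets r. 2 * D M * (g / \<delta>)) + 2 * r * A * (g / \<delta>)"
      by (intro add_mono a2 order_trans[OF sum_abs] sum_mono a1)
    also have "\<dots> = C / \<delta> * g"
      unfolding C_def sum_distrib_right[symmetric] by (simp add: distrib_right add_divide_distrib)
    finally show ?thesis by (simp add: g_def)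
  qed
  moreover have "C \<ge> 0" unfolding C_def using D(1) A(2) by (intro add_nonneg_nonneg sum_nonneg) auto
  ultimately show ?thesis by blast
qed

lemma gauge_gradient:
  assumes K: "compact K" "K \<subseteq> \<Omega>"
  shows "\<exists>C\<ge>0. \<forall>i\<in>{1..n}. \<forall>\<delta> x. 0 < \<delta> \<longrightarrow> \<delta> \<le> 1 \<longrightarrow> x \<in> K \<longrightarrow>
    \<bar>vf_apply (X i) (gauge \<delta>) x\<bar> \<le> C / \<delta> * gauge \<delta> x"
proof -
  obtain C where C: "\<And>i. i \<in> {1..n} \<Longrightarrow> C i \<ge> 0"
    "\<And>i \<delta> x. i \<in> {1..n} \<Longrightarrow> 0 < \<delta> \<Longrightarrow> \<delta> \<le> 1 \<Longrightarrow> x \<in> K \<Longrightarrow>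
      \<bar>vf_apply (X i) (gauge \<delta>) x\<bar> \<le> C i / \<delta> * gauge \<delta> x"
    using gauge_gradient_field[OF _ K] by metis
  have "\<bar>vf_apply (X i) (gauge \<delta>) x\<bar> \<le> (\<Sum>i=1..n. C i) / \<delta> * gauge \<delta> x"
    if i: "i \<in> {1..n}" and \<delta>: "0 < \<delta>" "\<delta> \<le> 1" and x: "x \<in> K" for i \<delta> x
  proof -
    have "C i \<le> (\<Sum>i=1..n. C i)" using i C(1) by (intro member_le_sum) auto
    hence "C i / \<delta> * gauge \<delta> x \<le> (\<Sum>i=1..n. C i) / \<delta> * gauge \<delta> x"
      using \<delta> gauge_ge_1[of \<delta> x] by (intro mult_right_mono divide_right_mono) auto
    thus ?thesis using C(2)[OF i \<delta> x] by linarith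
  qed
  moreover have "(\<Sum>i=1..n. C i) \<ge> 0" using C(1) by (intro sum_nonneg) auto
  ultimately show ?thesis by blast
qed

lemma gauge_bounded_near:
  "\<exists>C\<ge>1. \<exists>e>0. \<forall>\<delta> x. 0 < \<delta> \<longrightarrow> \<delta> \<le> 1 \<longrightarrow> norm (x - x0) \<le> e * \<delta> ^ r \<longrightarrow> gauge \<delta> x \<le> C"
proof -
  define k where "k = (\<lambda>M::'a multiset. if M = {#} then 0 else 1::nat)"
  have "\<exists>C\<ge>0. \<exists>e>0. \<forall>x\<in>ball x0 e. \<bar>dual M x\<bar> \<le> C * norm (x - x0) ^ k M" for M
  proof (rule words_vanish_bound_near[OF smooth_dual])
    fix bs assume bs: "set bs \<subseteq> B" "length bs < k M"
    hence "bs = []" "M \<noteq> {#}" by (auto simp: k_def split: if_splits)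
    moreover have "dual M x0 = 0" if "M \<noteq> {#}"
      using word_dual[of "{#}" M] that by (auto simp: msets_def rep_def)
    ultimately show "word (map Y bs) (dual M) x0 = 0" by simp
  qed
  then obtain C e where Ce: "\<And>M. C M \<ge> 0" "\<And>M. e M > 0"
    "\<And>M x. x \<in> ball x0 (e M) \<Longrightarrow> \<bar>dual M x\<bar> \<le> C M * norm (x - x0) ^ k M" by metis
  define \<epsilon> where "\<epsilon> = Min (insert 1 ((\<lambda>M. e M / 2) ` msets r))"
  have \<epsilon>: "\<epsilon> > 0" "\<epsilon> \<le> 1"
    using Ce(2) finite_msets by (auto simp: \<epsilon>_def)
  have \<epsilon>M: "\<epsilon> \<le> e M / 2" if "M \<in> msets r" for M
    unfolding \<epsilon>_def using that finite_msets by (intro Min_le) auto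
  have "gauge \<delta> x \<le> 1 + (\<Sum>M\<in>msets r. (C M)\<^sup>2) + 1"
    if \<delta>: "0 < \<delta>" "\<delta> \<le> 1" and x: "norm (x - x0) \<le> \<epsilon> * \<delta> ^ r" for \<delta> x
  proof -
    have dr: "\<delta> ^ r \<le> 1" using \<delta> by (intro power_le_one) auto
    have nr: "norm (x - x0) \<le> \<delta> ^ r" using x \<epsilon> \<delta> by (smt (verit) mult_left_le_one_le zero_le_power)
    have n\<epsilon>: "norm (x - x0) \<le> \<epsilon>" using x \<epsilon> dr by (smt (verit) mult_left_le)
    have a: "(dual M x / \<delta> ^ capped_wt M)\<^sup>2 \<le> (C M)\<^sup>2" if M: "M \<in> msets r" for M
    proof -
      have "x \<in> ball x0 (e M)" using n\<epsilon> \<epsilon>M[OF M] Ce(2)[of M] by (simp add: dist_norm norm_minus_commute)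
      hence "\<bar>dual M x\<bar> \<le> C M * norm (x - x0) ^ k M" by (rule Ce(3))
      also have "\<dots> \<le> C M * (\<delta> ^ r) ^ k M" using nr Ce(1) by (intro mult_left_mono power_mono) auto
      also have "\<dots> \<le> C M * \<delta> ^ capped_wt M"
      proof (cases "M = {#}")
        case True
        then show ?thesis by (simp add: k_def capped_wt_def wt_def)
      next
        case False
        have "\<delta> ^ r \<le> \<delta> ^ capped_wt M" using \<delta> by (intro power_decreasing) (auto simp: capped_wt_def)
        then show ?thesis using False Ce(1) by (auto simp: k_def intro: mult_left_mono)
      qed
      finally have "\<bar>dual M x / \<delta> ^ capped_wt M\<bar> \<le> C M" using \<delta> by (simp add: field_simps)
      thus ?thesis using Ce(1) by (simp add: abs_le_square_iff[symmetric])
    qed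
    have "norm (x - x0) / \<delta> \<le> 1"
    proof -
      have "\<delta> ^ r \<le> \<delta> ^ 1" using \<delta> r_pos by (intro power_decreasing) auto
      thus ?thesis using nr \<delta> by simp
    qed
    hence "(norm (x - x0) / \<delta>) ^ (2 * r) \<le> 1" using \<delta> by (intro power_le_one) auto
    hence b: "(((x - x0) \<bullet> (x - x0)) / \<delta>\<^sup>2) ^ r \<le> 1"
      by (simp add: power_mult power_divide flip: power2_norm_eq_inner)
    show ?thesis unfolding gauge_def using a b by (intro add_mono sum_mono) auto
  qed
  moreover have "1 + (\<Sum>M\<in>msets r. (C M)\<^sup>2) + 1 \<ge> 1" by (simp add: sum_nonneg)
  ultimately show ?thesis using \<epsilon>(1) by blast
qed

section \<open>Volume of anisotropic boxes\<close>

definition coord :: "'a \<Rightarrow> 'a \<Rightarrow> real" where "coord b = dual {#b#}"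

lemma smooth_coord: "smooth_on \<Omega> (coord b)"
  unfolding coord_def by (rule smooth_dual)

text \<open>The differential of \<open>coord b\<close> at \<open>x0\<close> is \<open>lin_coord b\<close>, and it is continuous.\<close>

lemma coord_close_to_lin_coord:
  assumes b: "b \<in> B" and \<eta>: "\<eta> > 0"
  shows "\<exists>e>0. ball x0 e \<subseteq> \<Omega> \<and> (\<forall>x\<in>ball x0 e. \<forall>y\<in>ball x0 e.
    \<bar>coord b x - coord b y - lin_coord b (x - y)\<bar> \<le> \<eta> * norm (x - y))"
proof -
  define h where "h = (\<lambda>x. coord b x - lin_coord b (x - x0))"
  have h: "smooth_on \<Omega> h" unfolding h_def by (intro smooth_on_diff op smooth_coord smooth_lin_coord)
  obtain D d where D: "D \<ge> 0" "d > 0" "ball x0 d \<subseteq> \<Omega>"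
    "\<And>x L \<eta>. x \<in> ball x0 d \<Longrightarrow> bounded_linear (L::'a\<Rightarrow>real) \<Longrightarrow> \<forall>b\<in>B. \<bar>L (Y b x)\<bar> \<le> \<eta> \<Longrightarrow> onorm L \<le> D * \<eta>"
    using frame_bound by blast
  \<comment> \<open>\<open>D + 1\<close> instead of \<open>D\<close>, as \<open>D\<close> may vanish\<close>
  define \<eta>' where "\<eta>' = \<eta> / (D + 1)"
  have \<eta>': "\<eta>' > 0" "D * \<eta>' \<le> \<eta>" using D(1) \<eta> by (auto simp: \<eta>'_def field_simps)
  have "\<exists>e>0. \<forall>x\<in>ball x0 e. \<bar>vf_apply (Y c) h x\<bar> \<le> \<eta>'" if c: "c \<in> B" for c
  proof -
    have m: "{#c#} \<in> msets (Suc r)" using c by (simp add: msets_def)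
    have rp: "rep {#c#} = [c]"
      using length_rep[of "{#c#}"] set_rep[of "{#c#}"] by (cases "rep {#c#}") auto
    have "vf_apply (Y c) h x0 = vf_apply (Y c) (coord b) x0 - lin_coord b (Y c x0)"
      unfolding h_def by (simp add: vf_apply_diff[OF smooth_coord smooth_lin_coord x0] vf_apply_lin_coord[OF x0])
    also have "\<dots> = 0"
      using word_dual[OF m, of "{#b#}"] lin_coord_basis[OF c] by (simp add: rp coord_def Y_x0[OF c] eq_commute)
    finally have z: "vf_apply (Y c) h x0 = 0" .
    have "isCont (vf_apply (Y c) h) x0"
      using smooth_on_continuous[OF smooth_on_vf_apply[OF op h smooth_Y[OF c]]] op x0
        continuous_on_eq_continuous_at by blast
    then obtain d where d: "d > 0"
      "\<And>x. dist x x0 < d \<Longrightarrow> dist (vf_apply (Y c) h x) (vf_apply (Y c) h x0) < \<eta>'"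
      using \<eta>'(1) unfolding continuous_at_eps_delta by blast
    thus ?thesis using z
      by (intro exI[of _ d]) (auto simp: dist_norm norm_minus_commute less_imp_le)
  qed
  then obtain e where e: "\<And>c. c \<in> B \<Longrightarrow> e c > 0"
    "\<And>c x. c \<in> B \<Longrightarrow> x \<in> ball x0 (e c) \<Longrightarrow> \<bar>vf_apply (Y c) h x\<bar> \<le> \<eta>'" by metis
  define \<epsilon> where "\<epsilon> = Min (insert d (e ` B))"
  have \<epsilon>: "\<epsilon> > 0" "\<epsilon> \<le> d" "\<And>b. b \<in> B \<Longrightarrow> \<epsilon> \<le> e b"
    using e(1) D finite_B by (auto simp: \<epsilon>_def)
  have sub: "ball x0 \<epsilon> \<subseteq> \<Omega>" using D(3) subset_ball[OF \<epsilon>(2)] by blast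
  have "\<bar>coord b x - coord b y - lin_coord b (x - y)\<bar> \<le> \<eta> * norm (x - y)"
    if x: "x \<in> ball x0 \<epsilon>" and y: "y \<in> ball x0 \<epsilon>" for x y
  proof -
    have "norm (h x - h y) \<le> \<eta> * norm (x - y)"
    proof (rule differentiable_bound[OF convex_ball _ _ x y])
      fix z assume z: "z \<in> ball x0 \<epsilon>"
      show D': "(h has_derivative frechet_derivative h (at z)) (at z within ball x0 \<epsilon>)"
        using smooth_on_has_derivative[OF h] sub z has_derivative_at_withinI by blast
      have "onorm (frechet_derivative h (at z)) \<le> D * \<eta>'"
      proof (rule D(4))
        show "z \<in> ball x0 d" using z \<epsilon> by auto
        show "bounded_linear (frechet_derivative h (at z))"
          using D' has_derivative_bounded_linear by blast
        show "\<forall>b\<in>B. \<bar>frechet_derivative h (at z) (Y b z)\<bar> \<le> \<eta>'"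
          using e(2) z \<epsilon>(3) by (fastforce simp: vf_apply_def)
      qed
      thus "onorm (frechet_derivative h (at z)) \<le> \<eta>" using \<eta>' by linarith
    qed
    moreover have "h x - h y = coord b x - coord b y - lin_coord b (x - y)"
      using linear_diff[OF bounded_linear.linear[OF lin_coord_bounded_linear], of b "x - x0" "y - x0"]
      by (simp add: h_def)
    ultimately show ?thesis by simp
  qed
  thus ?thesis using \<epsilon>(1) sub by blast
qed

lemma coord_inverse_lipschitz:
  "\<exists>e>0. \<exists>C>0. ball x0 e \<subseteq> \<Omega> \<and> (\<forall>x\<in>ball x0 e. \<forall>y\<in>ball x0 e.
     norm (x - y) \<le> C * (\<Sum>b\<in>B. \<bar>coord b x - coord b y\<bar>))"
proof -
  define A where "A = (\<Sum>b\<in>B. norm b) + 1"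
  have A: "A > 0" "\<And>b. b \<in> B \<Longrightarrow> norm b \<le> A"
    unfolding A_def using member_le_sum[of _ B norm] finite_B
    by (auto intro!: add_nonneg_pos sum_nonneg) (smt (verit) norm_ge_zero)
  define \<eta> where "\<eta> = 1 / (2 * A)"
  have \<eta>: "\<eta> > 0" using A by (simp add: \<eta>_def)
  obtain e where e: "\<And>b. b \<in> B \<Longrightarrow> e b > 0" "\<And>b. b \<in> B \<Longrightarrow> ball x0 (e b) \<subseteq> \<Omega>"
    "\<And>b x y. b \<in> B \<Longrightarrow> x \<in> ball x0 (e b) \<Longrightarrow> y \<in> ball x0 (e b) \<Longrightarrow>
      \<bar>coord b x - coord b y - lin_coord b (x - y)\<bar> \<le> \<eta> * norm (x - y)"
    using coord_close_to_lin_coord[OF _ \<eta>] by metis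
  define \<epsilon> where "\<epsilon> = Min (e ` B)"
  have \<epsilon>: "\<epsilon> > 0" "\<And>b. b \<in> B \<Longrightarrow> \<epsilon> \<le> e b"
    using e(1) B_nonempty finite_B by (auto simp: \<epsilon>_def)
  have "norm (x - y) \<le> 2 * A * (\<Sum>b\<in>B. \<bar>coord b x - coord b y\<bar>)"
    if x: "x \<in> ball x0 \<epsilon>" and y: "y \<in> ball x0 \<epsilon>" for x y
  proof -
    have p: "\<bar>lin_coord b (x - y)\<bar> \<le> \<bar>coord b x - coord b y\<bar> + \<eta> * norm (x - y)" if b: "b \<in> B" for b
    proof -
      have "x \<in> ball x0 (e b)" "y \<in> ball x0 (e b)" using x y \<epsilon>(2)[OF b] by auto
      from e(3)[OF b this] show ?thesis by linarith
    qed
    have "norm (x - y) = norm (\<Sum>b\<in>B. lin_coord b (x - y) *\<^sub>R b)" by (simp only: lin_coord_expansion)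
    also have "\<dots> \<le> (\<Sum>b\<in>B. \<bar>lin_coord b (x - y)\<bar> * norm b)"
      by (rule order_trans[OF norm_sum]) simp
    also have "\<dots> \<le> (\<Sum>b\<in>B. \<bar>coord b x - coord b y\<bar> * A + (\<eta> * norm (x - y)) * norm b)"
    proof (rule sum_mono)
      fix b assume b: "b \<in> B"
      have "\<bar>lin_coord b (x - y)\<bar> * norm b \<le> (\<bar>coord b x - coord b y\<bar> + \<eta> * norm (x - y)) * norm b"
        by (intro mult_right_mono p b) auto
      also have "\<dots> \<le> \<bar>coord b x - coord b y\<bar> * A + (\<eta> * norm (x - y)) * norm b"
        using mult_left_mono[OF A(2)[OF b], of "\<bar>coord b x - coord b y\<bar>"] by (simp add: distrib_right)
      finally show "\<bar>lin_coord b (x - y)\<bar> * norm b \<le> \<bar>coord b x - coord b y\<bar> * A + (\<eta> * norm (x - y)) * norm b" .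
    qed
    also have "\<dots> = A * (\<Sum>b\<in>B. \<bar>coord b x - coord b y\<bar>) + \<eta> * norm (x - y) * (A - 1)"
      by (simp add: sum.distrib sum_distrib_left sum_distrib_right A_def mult_ac)
    also have "\<eta> * norm (x - y) * (A - 1) \<le> \<eta> * norm (x - y) * A"
      using \<eta> by (intro mult_left_mono) auto
    also have "\<eta> * norm (x - y) * A = norm (x - y) / 2" using A by (simp add: \<eta>_def)
    finally show ?thesis by simp
  qed
  moreover have "ball x0 \<epsilon> \<subseteq> \<Omega>"
  proof -
    obtain b where "b \<in> B" using B_nonempty by blast
    thus ?thesis using e(2) subset_ball[OF \<epsilon>(2)] by blast
  qed
  moreover have "2 * A > 0" using A by simp
  ultimately show ?thesis using \<epsilon>(1) by blast
qed

lemma card_B: "card B = DIM('a)"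
  using indep_B span_B by (metis dim_UNIV dim_span_eq_card_independent)

text \<open>A volume bound from the Lipschitz inverse alone: cut the box in the range into
  \<open>O(\<tau> ^ Q / h ^ N)\<close> cubes of side \<open>h = \<tau> ^ r\<close>, which is at most its shortest side. Each cube has a
  preimage of diameter \<open>O(h)\<close>, hence of volume \<open>O(h ^ N)\<close>.\<close>

lemma anisotropic_box_volume:
  "\<exists>e>0. \<exists>C\<ge>0. \<forall>\<tau>. 0 < \<tau> \<longrightarrow> \<tau> \<le> 1 \<longrightarrow>
    (\<exists>G\<in>lmeasurable. {x\<in>ball x0 e. \<forall>b\<in>B. \<bar>coord b x\<bar> \<le> \<tau> ^ w b} \<subseteq> G \<and>
       measure lebesgue G \<le> C * \<tau> ^ (\<Sum>b\<in>B. w b))"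
proof -
  obtain e A where e: "e > 0" "A > 0" "ball x0 e \<subseteq> \<Omega>"
    "\<And>x y. x \<in> ball x0 e \<Longrightarrow> y \<in> ball x0 e \<Longrightarrow> norm (x - y) \<le> A * (\<Sum>b\<in>B. \<bar>coord b x - coord b y\<bar>)"
    using coord_inverse_lipschitz by blast
  let ?N = "DIM('a)"
  define C where "C = 5 ^ ?N * (unit_ball_vol ?N * (A * ?N) ^ ?N)"
  have "\<exists>G\<in>lmeasurable. {x\<in>ball x0 e. \<forall>b\<in>B. \<bar>coord b x\<bar> \<le> \<tau> ^ w b} \<subseteq> G \<and>
       measure lebesgue G \<le> C * \<tau> ^ (\<Sum>b\<in>B. w b)" if l: "0 < \<tau>" "\<tau> \<le> 1" for \<tau>
  proof -
    define T where "T = {x\<in>ball x0 e. \<forall>b\<in>B. \<bar>coord b x\<bar> \<le> \<tau> ^ w b}"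
    define h where "h = \<tau> ^ r"
    have h: "h > 0" using l by (simp add: h_def)
    define k where "k = (\<lambda>b. \<lceil>\<tau> ^ w b / h\<rceil>)"
    define Z where "Z = (\<Pi>\<^sub>E b\<in>B. {- k b .. k b})"
    have finZ: "finite Z" unfolding Z_def by (intro finite_PiE finite_B) auto
    define cell where "cell = (\<lambda>x. \<lambda>b\<in>B. \<lfloor>coord b x / h\<rfloor>)"
    have cellZ: "cell x \<in> Z" if "x \<in> T" for x
    proof -
      have "\<lfloor>coord b x / h\<rfloor> \<in> {- k b .. k b}" if b: "b \<in> B" for b
      proof -
        have "\<bar>coord b x / h\<bar> \<le> \<tau> ^ w b / h"
          using \<open>x \<in> T\<close> b h by (auto simp: T_def abs_divide intro: divide_right_mono)
        hence "coord b x / h \<le> k b" "- real_of_int (k b) \<le> coord b x / h"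
          using le_of_int_ceiling[of "\<tau> ^ w b / h"] unfolding k_def by linarith+
        thus ?thesis by (auto simp: floor_le_iff le_floor_iff)
      qed
      thus ?thesis by (auto simp: Z_def cell_def)
    qed
    define ctr where "ctr = (\<lambda>z. SOME x. x \<in> T \<and> cell x = z)"
    define G where "G = (\<Union>z\<in>Z. cball (ctr z) (A * ?N * h))"
    have "T \<subseteq> G"
    proof
      fix x assume x: "x \<in> T"
      define y where "y = ctr (cell x)"
      have y: "y \<in> T" "cell y = cell x"
        using someI[of "\<lambda>y. y \<in> T \<and> cell y = cell x" x] x by (auto simp: y_def ctr_def)
      have d: "\<bar>coord b y - coord b x\<bar> \<le> h" if b: "b \<in> B" for b
      proof -
        have "\<lfloor>coord b x / h\<rfloor> = \<lfloor>coord b y / h\<rfloor>" using y(2) b by (auto simp: cell_def fun_eq_iff split: if_splits)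
        hence "\<bar>coord b y / h - coord b x / h\<bar> \<le> 1"
          using floor_correct[of "coord b x / h"] floor_correct[of "coord b y / h"] by linarith
        hence "\<bar>(coord b y - coord b x) / h\<bar> \<le> 1" by (simp add: diff_divide_distrib)
        thus ?thesis using h by (simp add: abs_divide)
      qed
      have "norm (y - x) \<le> A * (\<Sum>b\<in>B. \<bar>coord b y - coord b x\<bar>)"
        using x y by (intro e(4)) (auto simp: T_def)
      also have "\<dots> \<le> A * (\<Sum>b\<in>B. h)" using e(2) d by (intro mult_left_mono sum_mono) auto
      also have "\<dots> = A * ?N * h" by (simp add: card_B)
      finally have "x \<in> cball y (A * ?N * h)" by (simp add: dist_norm)
      thus "x \<in> G" unfolding G_def y_def using cellZ[OF x] by blast
    qed
    moreover have "G \<in> lmeasurable" unfolding G_def by (intro fmeasurable.finite_UN finZ) auto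
    moreover have "measure lebesgue G \<le> C * \<tau> ^ (\<Sum>b\<in>B. w b)"
    proof -
      have vol: "measure lebesgue (cball p (A * ?N * h)) = unit_ball_vol ?N * (A * ?N) ^ ?N * h ^ ?N" for p :: 'a
        using content_cball[of "A * ?N * h" p] e(2) h by (simp add: power_mult_distrib mult.assoc)
      have "measure lebesgue G \<le> (\<Sum>z\<in>Z. measure lebesgue (cball (ctr z) (A * ?N * h)))"
        unfolding G_def by (intro measure_UNION_le finZ) auto
      also have "\<dots> = card Z * (unit_ball_vol ?N * (A * ?N) ^ ?N * h ^ ?N)" by (simp add: vol)
      also have "\<dots> \<le> (\<Prod>b\<in>B. 5 * (\<tau> ^ w b / h)) * (unit_ball_vol ?N * (A * ?N) ^ ?N * h ^ ?N)"
      proof (rule mult_right_mono)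
        have "card Z = (\<Prod>b\<in>B. card {- k b .. k b})" unfolding Z_def by (rule card_PiE[OF finite_B])
        hence "real (card Z) = (\<Prod>b\<in>B. real (card {- k b .. k b}))" by simp
        also have "\<dots> \<le> (\<Prod>b\<in>B. 5 * (\<tau> ^ w b / h))"
        proof (rule prod_mono, safe)
          fix b assume b: "b \<in> B"
          have "1 \<le> \<tau> ^ w b / h"
            using power_decreasing[OF w_le[OF b], of \<tau>] l h by (simp add: h_def)
          moreover have "real_of_int (k b) \<le> \<tau> ^ w b / h + 1"
            unfolding k_def by linarith
          moreover have "0 \<le> k b"
            unfolding k_def using calculation(1) by linarith
          ultimately show "real (card {- k b .. k b}) \<le> 5 * (\<tau> ^ w b / h)"
            by simp
        qed auto
        finally show "real (card Z) \<le> (\<Prod>b\<in>B. 5 * (\<tau> ^ w b / h))" .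
      qed (use e(2) h in auto)
      also have "(\<Prod>b\<in>B. 5 * (\<tau> ^ w b / h)) = 5 ^ ?N * \<tau> ^ (\<Sum>b\<in>B. w b) / h ^ ?N"
        by (simp add: prod.distrib prod_dividef card_B power_sum)
      also have "\<dots> * (unit_ball_vol ?N * (A * ?N) ^ ?N * h ^ ?N) = C * \<tau> ^ (\<Sum>b\<in>B. w b)"
        using h by (simp add: C_def)
      finally show ?thesis .
    qed
    ultimately show ?thesis unfolding T_def by blast
  qed
  moreover have "C \<ge> 0" unfolding C_def using e(2) by simp
  ultimately show ?thesis using e(1) by blast
qed

end


section \<open>Density of smooth domains at boundary points\<close>

text \<open>At a boundary point the differential of the defining function is negative in some direction, so
  small balls centred along that direction, of radius proportional to their distance, lie in the
  domain.\<close>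

lemma smooth_boundary_contains_balls:
  fixes S :: "'a::euclidean_space set"
  assumes S: "open S" "smooth_boundary S" and x0: "x0 \<in> closure S"
  shows "\<exists>c>0. \<exists>e>0. \<forall>t. 0 < t \<longrightarrow> t \<le> e \<longrightarrow> (\<exists>y. ball y (c * t) \<subseteq> S \<inter> cball x0 t)"
proof (cases "x0 \<in> S")
  case True
  then obtain d where d: "d > 0" "ball x0 d \<subseteq> S" using S(1) open_contains_ball by blast
  have "ball x0 (1 * t) \<subseteq> S \<inter> cball x0 t" if "t \<le> d" for t
    using d(2) subset_ball[OF that, of x0] by auto
  then show ?thesis using d(1) zero_less_one by metis
next
  case False
  hence "x0 \<in> frontier S" using x0 S(1) by (simp add: frontier_def interior_open)
  then obtain U \<rho> where U: "open U" "x0 \<in> U" "smooth_on U \<rho>" "\<rho> x0 = 0"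
    "frechet_derivative \<rho> (at x0) \<noteq> (\<lambda>_. 0)" "S \<inter> U = {y\<in>U. \<rho> y < (0::real)}"
    using S(2) unfolding smooth_boundary_def by blast
  define D where "D = frechet_derivative \<rho> (at x0)"
  have hd: "(\<rho> has_derivative D) (at x0)"
    unfolding D_def by (rule smooth_on_has_derivative[OF U(3,2)])
  hence bl: "bounded_linear D" by (rule has_derivative_bounded_linear)
  note lin = bounded_linear.linear[OF bl]
  obtain v0 where v0: "D v0 \<noteq> 0" using U(5) by (auto simp: D_def fun_eq_iff)
  define v where "v = (- sgn (D v0) / (2 * norm v0)) *\<^sub>R v0"
  have v0n: "norm v0 > 0" using v0 linear_0[OF lin] by auto
  have nv: "norm v = 1 / 2" using v0 v0n by (simp add: v_def abs_sgn_eq abs_mult)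
  define a where "a = - D v"
  have a: "a > 0"
  proof -
    have "a = \<bar>D v0\<bar> / (2 * norm v0)"
      by (simp add: a_def v_def linear_scale[OF lin] linear_neg[OF lin] abs_sgn mult.commute)
    thus ?thesis using v0 v0n by simp
  qed
  define d0 where "d0 = onorm D"
  have d0: "d0 \<ge> 0" unfolding d0_def by (rule onorm_pos_le[OF bl])
  define c where "c = min (1 / 2) (a / (2 * (d0 + 1)))"
  have c: "c > 0" "c \<le> 1 / 2" "d0 * c \<le> a / 2"
  proof -
    show "c > 0" using a d0 by (simp add: c_def)
    show "c \<le> 1 / 2" unfolding c_def by (rule min.cobounded1)
    have "d0 * c \<le> d0 * (a / (2 * (d0 + 1)))" using d0 by (intro mult_left_mono) (auto simp: c_def)
    also have "\<dots> = (d0 / (d0 + 1)) * (a / 2)" by simp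
    also have "\<dots> \<le> 1 * (a / 2)" using d0 a by (intro mult_right_mono) auto
    finally show "d0 * c \<le> a / 2" by simp
  qed
  obtain d1 where d1: "d1 > 0" "ball x0 d1 \<subseteq> U" using U(1,2) open_contains_ball by blast
  obtain d2 where d2: "d2 > 0"
    "\<And>y. norm (y - x0) < d2 \<Longrightarrow> norm (\<rho> y - \<rho> x0 - D (y - x0)) \<le> a / 4 * norm (y - x0)"
    using hd a unfolding has_derivative_at_alt by (metis zero_less_divide_iff zero_less_numeral)
  define e where "e = min d1 d2 / 2"
  have e: "e > 0" "e < d1" "e < d2" using d1(1) d2(1) by (auto simp: e_def)
  have "ball (x0 + t *\<^sub>R v) (c * t) \<subseteq> S \<inter> cball x0 t" if t: "0 < t" "t \<le> e" for t
  proof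
    fix z assume z: "z \<in> ball (x0 + t *\<^sub>R v) (c * t)"
    define s where "s = z - (x0 + t *\<^sub>R v)"
    have s: "norm s < c * t" using z by (simp add: s_def dist_norm norm_minus_commute)
    have zx: "z - x0 = t *\<^sub>R v + s" by (simp add: s_def)
    have ct: "c * t \<le> t / 2" using mult_right_mono[OF c(2), of t] t by simp
    have "norm (t *\<^sub>R v) = t / 2" using nv t by simp
    hence nz: "norm (z - x0) < t"
      using norm_triangle_ineq[of "t *\<^sub>R v" s] s ct unfolding zx by linarith
    have zU: "z \<in> U" using nz t e d1(2) by (auto simp: dist_norm norm_minus_commute subset_iff)
    have "\<bar>D s\<bar> \<le> d0 * norm s" using onorm[OF bl, of s] by (simp add: d0_def)
    also have "\<dots> \<le> d0 * (c * t)" using s d0 by (intro mult_left_mono) auto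
    also have "\<dots> \<le> a / 2 * t" using mult_right_mono[OF c(3), of t] t by (simp add: mult.assoc)
    finally have "D s \<le> a / 2 * t" by linarith
    moreover have "D (z - x0) = - a * t + D s"
      unfolding zx by (simp add: linear_add[OF lin] linear_scale[OF lin] a_def)
    ultimately have "D (z - x0) \<le> - (a / 2 * t)" by linarith
    moreover have "\<bar>\<rho> z - D (z - x0)\<bar> \<le> a / 4 * norm (z - x0)"
      using d2(2)[of z] nz t e U(4) by simp
    moreover have "a / 4 * norm (z - x0) \<le> a / 4 * t" using nz a by (intro mult_left_mono) auto
    moreover have "a * t > 0" using a t by simp
    ultimately have "\<rho> z < 0" by linarith
    hence "z \<in> S" using U(6) zU by blast
    thus "z \<in> S \<inter> cball x0 t" using nz by (simp add: dist_norm norm_minus_commute)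
  qed
  then show ?thesis using c(1) e(1) by blast
qed

section \<open>Moser iteration\<close>

text \<open>Iterating the reverse inequality drives the exponent of any polynomial lower bound to the
  fixed point \<open>p * q / (q - p)\<close> of the affine contraction \<open>a \<mapsto> p + a * p / q\<close>.\<close>

lemma moser_lower_bound:
  fixes \<Phi> :: "real \<Rightarrow> real \<Rightarrow> real"
  assumes pq: "1 \<le> p" "p < q"
    and nonneg: "\<And>\<delta> s. 0 \<le> \<Phi> \<delta> s"
    and step: "\<And>s. s > 0 \<Longrightarrow> \<exists>D>0. \<forall>\<delta>\<in>{0<..1}. \<Phi> \<delta> (q / p * s) powr (1 / q) \<le> D / \<delta> * \<Phi> \<delta> s powr (1 / p)"
    and start: "\<And>s. s > 0 \<Longrightarrow> \<exists>c>0. \<forall>\<delta>\<in>{0<..1}. c * \<delta> powr A \<le> \<Phi> \<delta> s"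
    and a: "p * q / (q - p) < a" and s: "s > 0"
  shows "\<exists>c>0. \<exists>a'<a. \<forall>\<delta>\<in>{0<..1}. c * \<delta> powr a' \<le> \<Phi> \<delta> s"
proof -
  define L where "L = p * q / (q - p)"
  \<comment> \<open>\<open>ex k\<close> is the \<open>k\<close>-th iterate of \<open>a \<mapsto> p + \<theta> * a\<close> starting at \<open>A\<close>\<close>
  define \<theta> where "\<theta> = p / q"
  have \<theta>: "0 < \<theta>" "\<theta> < 1" using pq by (auto simp: \<theta>_def)
  have L: "p + L * \<theta> = L" using pq by (simp add: L_def \<theta>_def field_simps)
  define ex where "ex = (\<lambda>k. L + (A - L) * \<theta> ^ k)"
  have ex_Suc: "ex (Suc k) = p + ex k * \<theta>" for k
  proof -
    have "p + ex k * \<theta> = (p + L * \<theta>) + (A - L) * \<theta> ^ Suc k" by (simp add: ex_def algebra_simps)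
    thus ?thesis by (simp add: L ex_def)
  qed
  have low: "\<exists>c>0. \<forall>\<delta>\<in>{0<..1}. c * \<delta> powr ex k \<le> \<Phi> \<delta> s" if "s > 0" for k s
    using that
  proof (induction k arbitrary: s)
    case 0
    then show ?case using start[OF 0] by (simp add: ex_def)
  next
    case (Suc k)
    have "q / p * s > 0" using pq Suc.prems by simp
    from Suc.IH[OF this] obtain c where c: "c > 0"
      "\<And>\<delta>. \<delta> \<in> {0<..1} \<Longrightarrow> c * \<delta> powr ex k \<le> \<Phi> \<delta> (q / p * s)" by blast
    obtain D where D: "D > 0"
      "\<And>\<delta>. \<delta> \<in> {0<..1} \<Longrightarrow> \<Phi> \<delta> (q / p * s) powr (1 / q) \<le> D / \<delta> * \<Phi> \<delta> s powr (1 / p)"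
      using step[OF Suc.prems] by blast
    define k' where "k' = c powr (1 / q) / D"
    have k': "k' > 0" using c(1) D(1) by (simp add: k'_def)
    define c' where "c' = k' powr p"
    have "c' * \<delta> powr ex (Suc k) \<le> \<Phi> \<delta> s" if d: "\<delta> \<in> {0<..1}" for \<delta>
    proof -
      have d0: "\<delta> > 0" using d by simp
      have "(c * \<delta> powr ex k) powr (1 / q) \<le> \<Phi> \<delta> (q / p * s) powr (1 / q)"
        using c d pq by (intro powr_mono2) auto
      also have "\<dots> \<le> D / \<delta> * \<Phi> \<delta> s powr (1 / p)" by (rule D(2)[OF d])
      finally have le: "(c * \<delta> powr ex k) powr (1 / q) * (\<delta> / D) \<le> \<Phi> \<delta> s powr (1 / p)"
        using D(1) d0 by (simp add: field_simps)
      have eq: "(c * \<delta> powr ex k) powr (1 / q) * (\<delta> / D)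
          = k' * \<delta> powr (ex k / q + 1)"
        using c(1) d0 by (simp add: powr_mult powr_powr powr_add k'_def)
      from le[unfolded eq] have "(k' * \<delta> powr (ex k / q + 1)) powr p \<le> (\<Phi> \<delta> s powr (1 / p)) powr p"
        using k' pq by (intro powr_mono2) auto
      also have "(\<Phi> \<delta> s powr (1 / p)) powr p = \<Phi> \<delta> s"
        using pq nonneg[of \<delta> s] by (simp add: powr_powr)
      also have "(k' * \<delta> powr (ex k / q + 1)) powr p = c' * \<delta> powr ((ex k / q + 1) * p)"
        using k' d0 by (simp add: powr_mult powr_powr c'_def)
      also have "(ex k / q + 1) * p = ex (Suc k)" by (simp add: ex_Suc \<theta>_def algebra_simps)
      finally show ?thesis .
    qed
    moreover have "c' > 0" using k' by (simp add: c'_def)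
    ultimately show ?case by blast
  qed
  have "(\<lambda>k. \<theta> ^ k) \<longlonglongrightarrow> 0" by (rule LIMSEQ_realpow_zero) (use \<theta> in auto)
  hence "(\<lambda>k. L + (A - L) * \<theta> ^ k) \<longlonglongrightarrow> L + (A - L) * 0"
    by (intro tendsto_add tendsto_mult tendsto_const)
  hence "\<forall>\<^sub>F k in sequentially. ex k < a"
    using a unfolding L_def[symmetric] ex_def by (simp add: order_tendsto_iff)
  then obtain k where "ex k < a" by (auto simp: eventually_sequentially)
  thus ?thesis using low[OF s] by blast
qed

section \<open>Integrals of powers of the gauge\<close>

lemma set_integrable_continuous_compact:
  fixes f :: "'a::euclidean_space \<Rightarrow> real"
  assumes "compact K" "continuous_on K f" "open S" "S \<subseteq> K"
  shows "set_integrable lebesgue S f"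
proof -
  have "integrable lborel (\<lambda>x. indicator K x *\<^sub>R f x)"
    by (rule borel_integrable_compact[OF assms(1,2)])
  hence "set_integrable lebesgue K f"
    unfolding set_integrable_def
    by (subst integrable_completion) (auto dest: borel_measurable_integrable)
  thus ?thesis by (rule set_integrable_subset) (use assms in auto)
qed

lemma integrable_indicator_scaleR:
  "G \<in> lmeasurable \<Longrightarrow> integrable lebesgue (\<lambda>x. indicator G x *\<^sub>R (c :: real))"
  by (intro integrable_scaleR_left) (simp add: lmeasurable_iff_integrable)

context adapted_frame
begin

definition gauge_integral :: "'a set \<Rightarrow> real \<Rightarrow> real \<Rightarrow> real" where
  "gauge_integral S \<delta> s = (LINT x:S|lebesgue. gauge \<delta> x powr (- s))"

lemma gauge_powr_integrable:
  assumes "open S" "compact (closure S)" "closure S \<subseteq> \<Omega>"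
  shows "set_integrable lebesgue S (\<lambda>x. gauge \<delta> x powr a)"
proof (rule set_integrable_continuous_compact[OF assms(2) _ assms(1) closure_subset])
  have "continuous_on (closure S) (gauge \<delta>)"
    using smooth_on_continuous[OF smooth_gauge] assms(3) continuous_on_subset by blast
  thus "continuous_on (closure S) (\<lambda>x. gauge \<delta> x powr a)"
    using gauge_ge_1[of \<delta>] by (intro continuous_on_powr continuous_on_const) (auto, smt (verit))
qed

lemma gauge_integral_nonneg: "0 \<le> gauge_integral S \<delta> s"
  unfolding gauge_integral_def set_lebesgue_integral_def by (intro integral_nonneg_AE) auto

text \<open>In a Euclidean ball of radius \<open>O(\<delta> ^ r)\<close> the gauge is bounded, and the domain fills a fixed
  proportion of it. The exponent is far from optimal, but any polynomial bound can start the
  iteration.\<close>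

lemma gauge_integral_lower:
  assumes S: "open S" "compact (closure S)" "closure S \<subseteq> \<Omega>" "smooth_boundary S" "x0 \<in> closure S"
    and s: "s > 0"
  shows "\<exists>c>0. \<forall>\<delta>\<in>{0<..1}. c * \<delta> powr (r * DIM('a)) \<le> gauge_integral S \<delta> s"
proof -
  let ?N = "DIM('a)"
  obtain C e1 where C: "C \<ge> 1" "e1 > 0"
    "\<And>\<delta> x. 0 < \<delta> \<Longrightarrow> \<delta> \<le> 1 \<Longrightarrow> norm (x - x0) \<le> e1 * \<delta> ^ r \<Longrightarrow> gauge \<delta> x \<le> C"
    using gauge_bounded_near by metis
  obtain c e2 where c: "c > 0" "e2 > 0"
    "\<And>t. 0 < t \<Longrightarrow> t \<le> e2 \<Longrightarrow> \<exists>y. ball y (c * t) \<subseteq> S \<inter> cball x0 t"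
    using smooth_boundary_contains_balls[OF S(1,4,5)] by metis
  define e where "e = min e1 e2"
  have e: "e > 0" "e \<le> e1" "e \<le> e2" using C c by (auto simp: e_def)
  define k where "k = C powr (- s) * (unit_ball_vol ?N * (c * e) ^ ?N)"
  have "k * \<delta> powr (r * ?N) \<le> gauge_integral S \<delta> s" if d: "\<delta> \<in> {0<..1}" for \<delta>
  proof -
    have \<delta>: "0 < \<delta>" "\<delta> \<le> 1" using d by auto
    define t where "t = e * \<delta> ^ r"
    have "\<delta> ^ r \<le> 1" using \<delta> by (intro power_le_one) auto
    hence te: "t \<le> e" using e mult_left_mono[of "\<delta> ^ r" 1 e] by (simp add: t_def)
    have t: "t > 0" "t \<le> e2" "t \<le> e1 * \<delta> ^ r"
    proof -
      show "t > 0" using e \<delta> by (simp add: t_def)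
      show "t \<le> e2" using te e by linarith
      show "t \<le> e1 * \<delta> ^ r" unfolding t_def using e \<delta> by (intro mult_right_mono) auto
    qed
    obtain y where y: "ball y (c * t) \<subseteq> S \<inter> cball x0 t" using c(3)[OF t(1,2)] by blast
    have "C powr (- s) * measure lebesgue (ball y (c * t))
      = (LINT x|lebesgue. indicator (ball y (c * t)) x *\<^sub>R (C powr (- s)))"
      by simp
    also have "\<dots> \<le> (LINT x|lebesgue. indicator S x *\<^sub>R (gauge \<delta> x powr (- s)))"
    proof (rule integral_mono)
      show "integrable lebesgue (\<lambda>x. indicator (ball y (c * t)) x *\<^sub>R (C powr (- s)))"
        by (intro integrable_indicator_scaleR lmeasurable_ball)
      show "integrable lebesgue (\<lambda>x. indicator S x *\<^sub>R (gauge \<delta> x powr (- s)))"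
        using gauge_powr_integrable[OF S(1-3)] by (simp add: set_integrable_def)
      fix x
      show "indicator (ball y (c * t)) x *\<^sub>R (C powr (- s)) \<le> indicator S x *\<^sub>R (gauge \<delta> x powr (- s))"
      proof (cases "x \<in> ball y (c * t)")
        case True
        hence "x \<in> S \<inter> cball x0 t" using y by blast
        hence x: "x \<in> S" "norm (x - x0) \<le> t" by (auto simp: dist_norm norm_minus_commute)
        have "gauge \<delta> x \<le> C" using C(3)[OF \<delta>] x(2) t(3) by simp
        hence "C powr (- s) \<le> gauge \<delta> x powr (- s)"
          using s gauge_ge_1[of \<delta> x] by (intro powr_mono2') auto
        then show ?thesis using True x by simp
      qed (simp add: indicator_def)
    qed
    finally have "C powr (- s) * measure lebesgue (ball y (c * t)) \<le> gauge_integral S \<delta> s"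
      by (simp add: gauge_integral_def set_lebesgue_integral_def)
    moreover have "measure lebesgue (ball y (c * t)) = unit_ball_vol ?N * (c * t) ^ ?N"
      using content_ball[of "c * t" y] c(1) t(1) by simp
    moreover have "(c * t) ^ ?N = (c * e) ^ ?N * \<delta> powr (r * ?N)"
    proof -
      have "\<delta> powr (r * ?N) = \<delta> ^ (r * ?N)" using \<delta> by (rule_tac powr_realpow) simp
      thus ?thesis by (simp add: t_def power_mult_distrib power_mult)
    qed
    ultimately show ?thesis by (simp add: k_def mult_ac)
  qed
  moreover have "k > 0" using C c e by (simp add: k_def)
  ultimately show ?thesis by blast
qed

text \<open>Let \<open>\<tau> = \<delta> powr \<gamma>\<close> with \<open>\<gamma> < 1\<close>, so that \<open>\<tau> / \<delta>\<close> is large. Where the gauge is at most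
  \<open>(\<tau> / \<delta>)\<^sup>2\<close> the point lies in the box of scale \<open>\<tau>\<close>, because all weights are at least one;
  elsewhere a large negative power of the gauge is negligible.\<close>

lemma gauge_integral_upper:
  assumes S: "open S" "compact (closure S)" "closure S \<subseteq> \<Omega>"
    and a: "0 < a" "a < real (\<Sum>b\<in>B. w b)"
  shows "\<exists>s>0. \<exists>C\<ge>0. \<exists>\<delta>1>0. \<forall>\<delta>. 0 < \<delta> \<longrightarrow> \<delta> \<le> \<delta>1 \<longrightarrow> \<delta> \<le> 1 \<longrightarrow> gauge_integral S \<delta> s \<le> C * \<delta> powr a"
proof -
  define Q where "Q = (\<Sum>b\<in>B. w b)"
  \<comment> \<open>then \<open>\<tau> ^ Q = \<delta> powr a\<close>\<close>
  define \<gamma> where "\<gamma> = a / Q"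
  have \<gamma>: "0 < \<gamma>" "\<gamma> < 1" "\<gamma> * Q = a" using a by (auto simp: \<gamma>_def Q_def)
  obtain e C where e: "e > 0" "C \<ge> 0"
    and cover: "\<forall>\<tau>. 0 < \<tau> \<longrightarrow> \<tau> \<le> 1 \<longrightarrow>
      (\<exists>G\<in>lmeasurable. {x\<in>ball x0 e. \<forall>b\<in>B. \<bar>coord b x\<bar> \<le> \<tau> ^ w b} \<subseteq> G \<and>
        measure lebesgue G \<le> C * \<tau> ^ Q)"
    using anisotropic_box_volume unfolding Q_def[symmetric] by (elim exE conjE)
  \<comment> \<open>then \<open>((\<tau> / \<delta>)\<^sup>2) powr (- s) = \<delta> powr a\<close>\<close>
  define s where "s = a / (2 * (1 - \<gamma>))"
  have s: "s > 0" using a(1) \<gamma>(2) by (simp add: s_def)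
  define \<delta>1 where "\<delta>1 = (e / 2) powr (1 / \<gamma>)"
  have Sm: "S \<in> lmeasurable"
    using S(1,2) by (meson bounded_closure bounded_subset closure_subset compact_imp_bounded lmeasurable_open)
  have "gauge_integral S \<delta> s \<le> (C + measure lebesgue S) * \<delta> powr a"
    if \<delta>: "0 < \<delta>" "\<delta> \<le> 1" "\<delta> \<le> \<delta>1" for \<delta>
  proof -
    define \<tau> where "\<tau> = \<delta> powr \<gamma>"
    define t where "t = \<delta> powr (\<gamma> - 1)"
    have \<tau>: "0 < \<tau>" "\<tau> \<le> 1" using \<delta> \<gamma> by (auto simp: \<tau>_def intro: powr_le1)
    have t\<delta>: "t * \<delta> = \<tau>" using \<delta> by (simp add: t_def \<tau>_def powr_diff)
    have t1: "t \<ge> 1" unfolding t_def using \<delta> \<gamma> powr_mono'[of "\<gamma> - 1" 0 \<delta>] by simp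
    have "\<tau> \<le> \<delta>1 powr \<gamma>" unfolding \<tau>_def using \<delta> \<gamma> by (intro powr_mono2) auto
    also have "\<dots> = e / 2" using e \<gamma> by (simp add: \<delta>1_def powr_powr)
    finally have \<tau>e: "\<tau> < e" using e(1) by simp
    obtain G where G: "G \<in> lmeasurable" "{x\<in>ball x0 e. \<forall>b\<in>B. \<bar>coord b x\<bar> \<le> \<tau> ^ w b} \<subseteq> G"
      "measure lebesgue G \<le> C * \<tau> ^ Q" using cover \<tau> by blast
    have inG: "x \<in> G" if g: "gauge \<delta> x \<le> t\<^sup>2" for x
    proof -
      have sg: "sqrt (gauge \<delta> x) \<le> t" using g t1 by (intro real_le_lsqrt) auto
      have "(norm (x - x0) / \<delta>) ^ r \<le> t ^ r"
        using norm_le_gauge[OF \<delta>(1), of x] sg power_increasing[OF r_pos t1] by simp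
      hence "norm (x - x0) / \<delta> \<le> t" using t1 \<delta> r_pos by (simp add: power_mono_iff)
      hence "norm (x - x0) \<le> \<tau>" using \<delta> t\<delta> by (simp add: field_simps)
      moreover have "\<bar>coord b x\<bar> \<le> \<tau> ^ w b" if b: "b \<in> B" for b
      proof -
        have M: "{#b#} \<in> msets r" using b r_pos by (simp add: msets_def)
        have cw: "capped_wt {#b#} = w b" using w_le[OF b] by (simp add: capped_wt_def wt_def)
        have "\<bar>coord b x\<bar> / \<delta> ^ w b \<le> t" using dual_le_gauge[OF M \<delta>(1), of x] sg by (simp add: cw coord_def)
        also have "\<dots> \<le> t ^ w b" using power_increasing[OF w_pos[OF b] t1] by simp
        finally have "\<bar>coord b x\<bar> \<le> t ^ w b * \<delta> ^ w b" using \<delta> by (simp add: field_simps)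
        thus ?thesis by (simp add: t\<delta> flip: power_mult_distrib)
      qed
      ultimately show ?thesis using G(2) \<tau>e by (auto simp: dist_norm norm_minus_commute subset_iff)
    qed
    have far: "gauge \<delta> x powr (- s) \<le> \<delta> powr a" if g: "t\<^sup>2 \<le> gauge \<delta> x" for x
    proof -
      have "gauge \<delta> x powr (- s) \<le> (t\<^sup>2) powr (- s)"
        using g s t1 by (intro powr_mono2') auto
      also have "t\<^sup>2 = t powr 2" using t1 by (simp add: powr_numeral)
      also have "(t powr 2) powr (- s) = \<delta> powr ((\<gamma> - 1) * 2 * (- s))"
        by (simp add: t_def powr_powr)
      also have "(\<gamma> - 1) * 2 * (- s) = a" using \<gamma> by (simp add: s_def field_simps)
      finally show ?thesis .
    qed
    have "gauge_integral S \<delta> s = (LINT x|lebesgue. indicator S x *\<^sub>R (gauge \<delta> x powr (- s)))"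
      by (simp add: gauge_integral_def set_lebesgue_integral_def)
    also have "\<dots> \<le> (LINT x|lebesgue. indicator G x *\<^sub>R 1 + indicator S x *\<^sub>R (\<delta> powr a))"
    proof (rule integral_mono)
      show "integrable lebesgue (\<lambda>x. indicator S x *\<^sub>R (gauge \<delta> x powr (- s)))"
        using gauge_powr_integrable[OF S] by (simp add: set_integrable_def)
      show "integrable lebesgue (\<lambda>x. indicator G x *\<^sub>R 1 + indicator S x *\<^sub>R (\<delta> powr a))"
        by (intro Bochner_Integration.integrable_add integrable_indicator_scaleR G(1) Sm)
      fix x
      show "indicator S x *\<^sub>R (gauge \<delta> x powr (- s)) \<le> indicator G x *\<^sub>R 1 + indicator S x *\<^sub>R (\<delta> powr a)"
      proof (cases "gauge \<delta> x \<le> t\<^sup>2")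
        case True
        have "gauge \<delta> x powr (- s) \<le> 1 powr (- s)"
          using gauge_ge_1 s by (intro powr_mono2') auto
        hence "gauge \<delta> x powr (- s) \<le> 1 + \<delta> powr a"
          using powr_ge_zero[of \<delta> a] unfolding powr_one_eq_one by linarith
        then show ?thesis using inG[OF True] by (auto simp: indicator_def)
      next
        case False
        then show ?thesis using far[of x] by (auto simp: indicator_def)
      qed
    qed
    also have "\<dots> = measure lebesgue G + measure lebesgue S * \<delta> powr a"
      by (subst Bochner_Integration.integral_add[OF integrable_indicator_scaleR[OF G(1)]
            integrable_indicator_scaleR[OF Sm]]) simp
    also have "measure lebesgue G \<le> C * \<delta> powr a"
    proof -
      have "\<tau> ^ Q = \<delta> powr a" using \<delta> \<tau> \<gamma>(3) by (simp add: \<tau>_def powr_powr flip: powr_realpow)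
      thus ?thesis using G(3) by simp
    qed
    finally show ?thesis by (simp add: distrib_right)
  qed
  moreover have "\<delta>1 > 0" "C + measure lebesgue S \<ge> 0" using e by (auto simp: \<delta>1_def)
  ultimately show ?thesis using s by blast
qed

text \<open>Test function: \<open>gauge \<delta> powr (- s / p)\<close>. Its subelliptic gradient is at most \<open>O(1 / \<delta>)\<close> times
  the function itself, so both sides of the Sobolev inequality are integrals of powers of the gauge.\<close>

lemma sobolev_gauge_integral:
  assumes S: "open S" "compact (closure S)" "closure S \<subseteq> \<Omega>"
    and pq: "1 \<le> p" "p < q" and s: "s > 0"
    and sob: "\<And>f :: 'a \<Rightarrow> complex. smooth_up_to_boundary S f \<Longrightarrow>
      Lp_norm q S f \<le> C * (Lp_norm p S (subelliptic_gradient_length n X f) + Lp_norm p S f)"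
  shows "\<exists>D>0. \<forall>\<delta>\<in>{0<..1}. gauge_integral S \<delta> (q / p * s) powr (1 / q) \<le> D / \<delta> * gauge_integral S \<delta> s powr (1 / p)"
proof -
  obtain A where A: "A \<ge> 0" "\<And>i \<delta> x. i \<in> {1..n} \<Longrightarrow> 0 < \<delta> \<Longrightarrow> \<delta> \<le> 1 \<Longrightarrow> x \<in> closure S \<Longrightarrow>
    \<bar>vf_apply (X i) (gauge \<delta>) x\<bar> \<le> A / \<delta> * gauge \<delta> x"
    using gauge_gradient[OF S(2,3)] by blast
  define k where "k = s / p"
  have k: "k > 0" using s pq by (simp add: k_def)
  define E where "E = sqrt n * (k * A)"
  have E: "E \<ge> 0" using k A by (simp add: E_def)
  define D where "D = \<bar>C\<bar> * (E + 1) + 1"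
  have "gauge_integral S \<delta> (q / p * s) powr (1 / q) \<le> D / \<delta> * gauge_integral S \<delta> s powr (1 / p)" if d: "\<delta> \<in> {0<..1}" for \<delta>
  proof -
    have \<delta>: "0 < \<delta>" "\<delta> \<le> 1" using d by auto
    have gp: "gauge \<delta> x > 0" for x using gauge_ge_1[of \<delta> x] by linarith
    define g where "g = (\<lambda>x. gauge \<delta> x powr (- k))"
    define f where "f = (\<lambda>x. complex_of_real (g x))"
    have sg: "smooth_on \<Omega> g" unfolding g_def using gp by (intro smooth_on_powr op smooth_gauge) auto
    have "smooth_on \<Omega> f" unfolding f_def by (rule smooth_on_bounded_linear[OF op bounded_linear_of_real sg])
    hence "smooth_up_to_boundary S f" unfolding smooth_up_to_boundary_def using op S(3) by blast
    from sob[OF this] have main: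
      "Lp_norm q S f \<le> C * (Lp_norm p S (subelliptic_gradient_length n X f) + Lp_norm p S f)" .
    have Lf: "Lp_norm q' S f = gauge_integral S \<delta> (k * q') powr (1 / q')" for q'
      unfolding Lp_norm_def gauge_integral_def f_def g_def by (simp add: powr_powr)
    have vfg: "vf_apply (X i) g x = - k * gauge \<delta> x powr (- k - 1) * vf_apply (X i) (gauge \<delta>) x"
      if "x \<in> \<Omega>" for i x
    proof -
      have "((\<lambda>z. z powr (- k)) has_derivative (*) (- k * gauge \<delta> x powr (- k - 1))) (at (gauge \<delta> x))"
        using has_real_derivative_powr[OF gp[of x], of "- k"] unfolding has_field_derivative_def .
      from diff_chain_at[OF smooth_on_has_derivative[OF smooth_gauge that] this]
      have "(g has_derivative (\<lambda>h. (- k * gauge \<delta> x powr (- k - 1)) * frechet_derivative (gauge \<delta>) (at x) h)) (at x)"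
        unfolding g_def o_def .
      from vf_apply_eqI[OF this, of "X i"] show ?thesis by (simp add: vf_apply_def)
    qed
    have grad: "norm (subelliptic_gradient_length n X f x) \<le> E / \<delta> * g x" if x: "x \<in> S" for x
    proof -
      have xc: "x \<in> closure S" using x closure_subset by blast
      hence xO: "x \<in> \<Omega>" using S(3) by blast
      have b: "cmod (vf_apply (X i) f x) \<le> k * A / \<delta> * g x" if i: "i \<in> {1..n}" for i
      proof -
        have "vf_apply (X i) f x = complex_of_real (vf_apply (X i) g x)"
          unfolding f_def by (rule vf_apply_bounded_linear[OF bounded_linear_of_real sg xO])
        hence "cmod (vf_apply (X i) f x) = k * gauge \<delta> x powr (- k - 1) * \<bar>vf_apply (X i) (gauge \<delta>) x\<bar>"
          using k by (simp add: vfg[OF xO] abs_mult norm_mult)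
        also have "\<dots> \<le> k * gauge \<delta> x powr (- k - 1) * (A / \<delta> * gauge \<delta> x)"
          using k by (intro mult_left_mono A(2)[OF i \<delta> xc]) auto
        also have "\<dots> = k * A / \<delta> * (gauge \<delta> x powr (- k - 1) * gauge \<delta> x powr 1)"
          using gp[of x] by simp
        also have "\<dots> = k * A / \<delta> * g x" by (simp only: powr_add[symmetric]) (simp add: g_def)
        finally show ?thesis .
      qed
      have g0: "g x \<ge> 0" by (simp add: g_def)
      have "(\<Sum>i=1..n. (cmod (vf_apply (X i) f x))\<^sup>2) \<le> (\<Sum>i=1..n. (k * A / \<delta> * g x)\<^sup>2)"
        by (intro sum_mono power_mono b) auto
      also have "\<dots> = n * (k * A / \<delta> * g x)\<^sup>2" by simp
      finally have "subelliptic_gradient_length n X f x \<le> sqrt (n * (k * A / \<delta> * g x)\<^sup>2)"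
        unfolding subelliptic_gradient_length_def by (rule real_sqrt_le_mono)
      also have "\<dots> = E / \<delta> * g x"
        using k A(1) \<delta> g0 by (simp add: real_sqrt_mult E_def)
      finally show ?thesis by (simp add: subelliptic_gradient_length_def sum_nonneg)
    qed
    have Lg: "Lp_norm p S (subelliptic_gradient_length n X f) \<le> E / \<delta> * gauge_integral S \<delta> s powr (1 / p)"
    proof -
      let ?G = "\<lambda>x. norm (subelliptic_gradient_length n X f x) powr p"
      let ?F = "\<lambda>x. (E / \<delta>) powr p * gauge \<delta> x powr (- s)"
      have iF: "set_integrable lebesgue S ?F"
        by (intro set_integrable_mult_right gauge_powr_integrable[OF S])
      have F0: "(LINT x:S|lebesgue. ?F x) = (E / \<delta>) powr p * gauge_integral S \<delta> s"
        by (simp add: gauge_integral_def)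
      have "(LINT x:S|lebesgue. ?G x) \<le> (LINT x:S|lebesgue. ?F x)"
      proof (cases "set_integrable lebesgue S ?G")
        case True
        show ?thesis
        proof (rule set_integral_mono[OF True iF])
          fix x assume x: "x \<in> S"
          have "?G x \<le> (E / \<delta> * g x) powr p"
            using grad[OF x] pq by (intro powr_mono2) auto
          also have "\<dots> = ?F x"
          proof -
            have "(E / \<delta> * g x) powr p = (E / \<delta>) powr p * g x powr p"
              by (rule powr_mult)
            thus ?thesis using pq by (simp add: g_def powr_powr k_def)
          qed
          finally show "?G x \<le> ?F x" .
        qed
      next
        \<comment> \<open>a non-integrable integrand has Bochner integral zero\<close>
        case False
        hence "(LINT x:S|lebesgue. ?G x) = 0"
          unfolding set_integrable_def set_lebesgue_integral_def by (rule not_integrable_integral_eq)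
        then show ?thesis unfolding F0 by (simp add: gauge_integral_nonneg)
      qed
      hence "(LINT x:S|lebesgue. ?G x) powr (1 / p) \<le> ((E / \<delta>) powr p * gauge_integral S \<delta> s) powr (1 / p)"
        unfolding F0 using pq
        by (intro powr_mono2) (auto simp: set_lebesgue_integral_def intro!: integral_nonneg_AE)
      also have "\<dots> = E / \<delta> * gauge_integral S \<delta> s powr (1 / p)"
        using E \<delta> pq by (simp add: powr_mult gauge_integral_nonneg powr_powr)
      finally show ?thesis by (simp add: Lp_norm_def)
    qed
    define P where "P = gauge_integral S \<delta> s powr (1 / p)"
    have P: "P \<ge> 0" by (simp add: P_def)
    have G0: "Lp_norm p S (subelliptic_gradient_length n X f) \<ge> 0" by (simp add: Lp_norm_def)
    have kp: "k * p = s" "k * q = q / p * s" using pq by (auto simp: k_def)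
    have "gauge_integral S \<delta> (q / p * s) powr (1 / q)
      \<le> C * (Lp_norm p S (subelliptic_gradient_length n X f) + P)"
      using main unfolding Lf kp P_def .
    also have "\<dots> \<le> \<bar>C\<bar> * (Lp_norm p S (subelliptic_gradient_length n X f) + P)"
      using G0 P by (intro mult_right_mono) auto
    also have "\<dots> \<le> \<bar>C\<bar> * (E / \<delta> * P + P / \<delta>)"
    proof -
      have "P \<le> P / \<delta>" using P \<delta> by (simp add: le_divide_eq mult_left_le)
      thus ?thesis using Lg unfolding P_def by (intro mult_left_mono add_mono) auto
    qed
    also have "\<dots> = \<bar>C\<bar> * (E + 1) / \<delta> * P"
      by (simp add: algebra_simps add_divide_distrib)
    also have "\<dots> \<le> D / \<delta> * P"
      using P \<delta> by (intro mult_right_mono divide_right_mono) (auto simp: D_def)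
    finally show ?thesis by (simp add: P_def)
  qed
  moreover have "D > 0" unfolding D_def using E by (intro add_nonneg_pos mult_nonneg_nonneg) auto
  ultimately show ?thesis by blast
qed

text \<open>The lower bound from the iteration has an exponent below \<open>a\<close> and the upper bound has exponent \<open>a\<close>;
  they contradict each other for small \<open>\<delta>\<close>.\<close>

lemma no_sobolev:
  assumes S: "open S" "compact (closure S)" "closure S \<subseteq> \<Omega>" "smooth_boundary S" "x0 \<in> closure S"
    and pq: "1 \<le> p" "p < q" and Q: "p * q / (q - p) < real (\<Sum>b\<in>B. w b)"
    and sob: "\<And>f :: 'a \<Rightarrow> complex. smooth_up_to_boundary S f \<Longrightarrow>
      Lp_norm q S f \<le> C * (Lp_norm p S (subelliptic_gradient_length n X f) + Lp_norm p S f)"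
  shows False
proof -
  obtain a where a: "p * q / (q - p) < a" "a < real (\<Sum>b\<in>B. w b)" using Q dense by blast
  have "p * q / (q - p) > 0" using pq by simp
  hence a0: "a > 0" using a by linarith
  obtain s C' \<delta>1 where s: "s > 0" "C' \<ge> 0" "\<delta>1 > 0"
    "\<And>\<delta>. 0 < \<delta> \<Longrightarrow> \<delta> \<le> \<delta>1 \<Longrightarrow> \<delta> \<le> 1 \<Longrightarrow> gauge_integral S \<delta> s \<le> C' * \<delta> powr a"
    using gauge_integral_upper[OF S(1-3) a0 a(2)] by metis
  obtain c a' where c: "c > 0" "a' < a" "\<And>\<delta>. \<delta> \<in> {0<..1} \<Longrightarrow> c * \<delta> powr a' \<le> gauge_integral S \<delta> s"
    using moser_lower_bound[where \<Phi> = "gauge_integral S" and A = "r * DIM('a)",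
        OF pq gauge_integral_nonneg sobolev_gauge_integral[OF S(1-3) pq _ sob] gauge_integral_lower[OF S] a(1) s(1)]
    by blast
  define \<epsilon> where "\<epsilon> = a - a'"
  have \<epsilon>: "\<epsilon> > 0" using c by (simp add: \<epsilon>_def)
  define \<delta> where "\<delta> = min (min 1 \<delta>1) ((c / (C' + 1)) powr (1 / \<epsilon>) / 2)"
  have \<delta>: "0 < \<delta>" "\<delta> \<le> \<delta>1" "\<delta> \<le> 1" using s c by (auto simp: \<delta>_def)
  have lt: "\<delta> < (c / (C' + 1)) powr (1 / \<epsilon>)"
  proof -
    have "(c / (C' + 1)) powr (1 / \<epsilon>) > 0" using c s by simp
    moreover have "\<delta> \<le> (c / (C' + 1)) powr (1 / \<epsilon>) / 2" unfolding \<delta>_def by (rule min.cobounded2)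
    ultimately show ?thesis by linarith
  qed
  have "c * \<delta> powr a' \<le> C' * \<delta> powr a" using c(3)[of \<delta>] s(4)[OF \<delta>] \<delta> by simp
  also have "\<delta> powr a = \<delta> powr \<epsilon> * \<delta> powr a'" by (simp add: \<epsilon>_def flip: powr_add)
  finally have "c \<le> C' * \<delta> powr \<epsilon>" using \<delta> by (simp flip: mult.assoc)
  also have "\<dots> \<le> (C' + 1) * \<delta> powr \<epsilon>" by (intro mult_right_mono) auto
  also have "\<dots> < (C' + 1) * ((c / (C' + 1)) powr (1 / \<epsilon>)) powr \<epsilon>"
    using lt \<delta> \<epsilon> s(2) by (intro mult_strict_left_mono powr_less_mono2) auto
  also have "\<dots> = c" using c s \<epsilon> by (simp add: powr_powr)
  finally show False by simp
qed

end

theorem mainTheorem5: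
  fixes X :: "nat \<Rightarrow> real^'N \<Rightarrow> real^'N" and n r :: nat
    and \<Omega> \<Omega>' :: "(real^'N) set" and p pstar Q :: real
  assumes "open \<Omega>" and "connected \<Omega>"
    and "\<forall>i\<in>{1..n}. smooth_on \<Omega> (X i)"
    and "\<forall>x\<in>\<Omega>. commutator_span n X r x = UNIV"
    and "open \<Omega>'" and "\<Omega>' \<noteq> {}"
    and "compact (closure \<Omega>')" and "closure \<Omega>' \<subseteq> \<Omega>"
    and "smooth_boundary \<Omega>'"
    and "Q = nonisotropic_dim n X r (closure \<Omega>')"
    and "1 \<le> p" and "p < Q" and "1 / pstar = 1 / p - 1 / Q"
  shows "\<forall>q>pstar. \<not> (\<exists>C::real. \<forall>f :: real^'N \<Rightarrow> complex.
           smooth_up_to_boundary \<Omega>' f \<longrightarrow>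
             Lp_norm q \<Omega>' f \<le>
               C * (Lp_norm p \<Omega>' (subelliptic_gradient_length n X f) + Lp_norm p \<Omega>' f))"
proof (intro allI impI notI)
  fix q assume q: "pstar < q"
  \<comment> \<open>\<open>q > pstar\<close> says that the exponent \<open>p * q / (q - p)\<close> of the iteration is less than \<open>Q\<close>\<close>
  assume "\<exists>C::real. \<forall>f :: real^'N \<Rightarrow> complex. smooth_up_to_boundary \<Omega>' f \<longrightarrow>
    Lp_norm q \<Omega>' f \<le> C * (Lp_norm p \<Omega>' (subelliptic_gradient_length n X f) + Lp_norm p \<Omega>' f)"
  then obtain C where sob: "\<And>f :: real^'N \<Rightarrow> complex. smooth_up_to_boundary \<Omega>' f \<Longrightarrow>
    Lp_norm q \<Omega>' f \<le> C * (Lp_norm p \<Omega>' (subelliptic_gradient_length n X f) + Lp_norm p \<Omega>' f)"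
    by blast
  have p: "0 < p" "p < Q" using assms(11,12) by auto
  have ps: "1 / pstar > 0" unfolding assms(13) using p by (simp add: frac_less2)
  hence ps0: "pstar > 0" by (simp add: zero_less_divide_iff)
  have q0: "q > 0" using ps0 q by linarith
  have "1 / q < 1 / pstar" using q ps0 by (simp add: frac_less2)
  hence iq: "1 / Q < 1 / p - 1 / q" using assms(13) by linarith
  have "0 < 1 / Q" using p by simp
  hence "1 / q < 1 / p" using iq by linarith
  hence pq: "p < q" using p q0 by (simp add: field_simps)
  have "1 / p - 1 / q = (q - p) / (p * q)" using p q0 by (simp add: field_simps)
  hence iL: "1 / Q < 1 / (p * q / (q - p))" using iq by simp
  have "p * q / (q - p) < Q"
  proof (rule ccontr)
    assume "\<not> p * q / (q - p) < Q"
    hence "1 / (p * q / (q - p)) \<le> 1 / Q" using p by (intro frac_le) auto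
    thus False using iL by linarith
  qed
  hence "p * q / (q - p) < (SUP x\<in>closure \<Omega>'. nonisotropic_dim_at n X r x)"
    unfolding assms(10) nonisotropic_dim_def .
  moreover have "nonisotropic_dim_at n X r ` closure \<Omega>' \<noteq> {}" using assms(6) by simp
  ultimately obtain x0 where x0: "x0 \<in> closure \<Omega>'" "p * q / (q - p) < nonisotropic_dim_at n X r x0"
    using less_cSupD[of "nonisotropic_dim_at n X r ` closure \<Omega>'" "p * q / (q - p)"] by blast
  interpret smooth_fields n X \<Omega>
    using assms(1,3) by unfold_locales auto
  have x0O: "x0 \<in> \<Omega>" using x0 assms(8) by blast
  obtain B w Y where fr: "adapted_frame n X \<Omega> x0 r B w Y"
    and dimQ: "real (\<Sum>b\<in>B. w b) = nonisotropic_dim_at n X r x0"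
    using adapted_frame_exists[OF x0O] assms(4) x0O by blast
  show False
    by (rule adapted_frame.no_sobolev[OF fr assms(5,7,8,9) x0(1) assms(11) pq _ sob])
       (use dimQ x0(2) in simp_all)
qed

end
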